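(* Let $1<p<n$, let $\Omega\subset\mathbb{R}^n$ be a bounded domain with smooth boundary and $0\in\Omega$. Let $\varphi\in C_0^\infty(\Omega)$ be a cut-off function such that $0\le\varphi\le1$ and $\varphi=1$ in $B_r(0)\subset\subset\Omega$. For $\varepsilon>0$ define $$\eta_\varepsilon(x)=\frac{\varphi(x)}{\left(\varepsilon+H_0(-x)^{p/(p-1)}\right)^{(n-p)/p}}.$$ Then the following hold: $$\|H(\nabla\eta_\varepsilon)\|^p_{L^p(\Omega)}=\frac{1}{c_{n,p}^{n-p}\,\varepsilon^{(n-p)/p}}\|H(\nabla U^H_{1,0})\|^p_{L^p(\mathbb{R}^n)}+O(1)\quad\text{as }\varepsilon\to0^+;$$ $$\int_\Omega\eta_\varepsilon^{p^\star}\,dx=\frac{1}{c_{n,p}^n\,\varepsilon^{n/p}}\|U^H_{1,0}\|^{p^\star}_{L^{p^\star}(\mathbb{R}^n)}+O(1)\quad\text{as }\varepsilon\to0^+.$$ Moreover, as $\varepsilon\to0^+$, $$\int_\Omega\eta_\varepsilon^p\,dx=\begin{cases}\dfrac{1}{c_{n,p}^{n-p}\,\varepsilon^{(n-p^2)/p}}\|U^H_{1,0}\|^p_{L^p(\mathbb{R}^n)}+O(1)&\text{if }n>p^2,\\[2mm]\dfrac{\omega(p-1)}{p}|\log\varepsilon|+O(1)&\text{if }n=p^2,\end{cases}$$ and, for $p<q<p^\star-1$ and all sufficiently small $\varepsilon>0$, $$\int_\Omega\eta_\varepsilon^q\,dx\ge\frac{c}{\varepsilon^{\frac{q(n-p)}{p}-\frac{n(p-1)}{p}}},$$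 where $c$ is a positive constant depending only on $n$, $p$ (and on the fixed norm $H$).
   Context: $H:\mathbb{R}^n\to\mathbb{R}$ is a fixed function (called a norm, though not assumed symmetric) such that: (i) $H$ is convex; (ii) $H(t\xi)=tH(\xi)$ for all $\xi\in\mathbb{R}^n$, $t>0$; (iii) $H(\xi)>0$ for all $\xi\neq0$; (iv) $H\in C^2(\mathbb{R}^n\setminus\{0\})$; (v) the set $\{x\in\mathbb{R}^n: H(x)<1\}$ is uniformly convex, i.e. all principal curvatures of its boundary are bounded away from $0$. The dual norm is $H_0(\zeta)=\sup_{H(\xi)=1}\langle\zeta,\xi\rangle$, and $\hat H_0(\zeta)=H_0(-\zeta)$. $p^\star=np/(n-p)$. $B_r(0)$ is the Euclidean ball of radius $r$. $$c_{n,p}=n^{1/p}\left(\frac{n-p}{p-1}\right)^{\frac{p-1}{p}},\qquad U^H_{1,0}(x)=\left(\frac{c_{n,p}}{1+\hat H_0(x)^{p/(p-1)}}\right)^{\frac{n-p}{p}}.$$ In the case $n=p^2$, $$\omega=\int_{\{\hat H_0=1\}}\frac{1}{|\nabla\hat H_0|}\,d\mathcal{H}^{p^2-1},$$ where $\mathcal{H}^{p^2-1}$ is the $(p^2-1)$-dimensional Hausdorff measure. *)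

theory Defs
  imports "HOL-Analysis.Analysis" "HOL-Library.Landau_Symbols"
begin

section \<open>Differentiability classes\<close>

text \<open>\<open>Ck_on k f S\<close> is meant for open \<open>S\<close>: all iterated directional derivatives of order below
  \<open>k\<close> are (Frechet) differentiable on \<open>S\<close>, and those of order \<open>k\<close> are continuous.\<close>

primrec Ck_on :: "nat \<Rightarrow> ('a::euclidean_space \<Rightarrow> real) \<Rightarrow> 'a set \<Rightarrow> bool" where
  "Ck_on 0 f S \<longleftrightarrow> continuous_on S f"
| "Ck_on (Suc k) f S \<longleftrightarrow>
     (\<forall>x\<in>S. f differentiable (at x)) \<and> (\<forall>v. Ck_on k (\<lambda>x. frechet_derivative f (at x) v) S)"

definition smooth_on :: "('a::euclidean_space \<Rightarrow> real) \<Rightarrow> 'a set \<Rightarrow> bool" where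
  "smooth_on f S \<longleftrightarrow> (\<forall>k. Ck_on k f S)"

definition grad :: "('a::euclidean_space \<Rightarrow> real) \<Rightarrow> 'a \<Rightarrow> 'a" where
  "grad f x = (\<Sum>b\<in>Basis. frechet_derivative f (at x) b *\<^sub>R b)"

text \<open>Near each boundary point, \<open>\<Omega>\<close> is the strict supergraph, in the direction of a unit vector
  \<open>\<nu>\<close>, of a smooth function of the component orthogonal to \<open>\<nu>\<close>. (The function
  \<open>\<gamma>\<close> is only ever evaluated on the hyperplane orthogonal to \<open>\<nu>\<close>.)\<close>

definition smooth_boundary :: "'a::euclidean_space set \<Rightarrow> bool" where
  "smooth_boundary \<Omega> \<longleftrightarrow>
     (\<forall>x\<in>frontier \<Omega>. \<exists>r>0. \<exists>\<nu> \<gamma>. norm \<nu> = 1 \<and> smooth_on \<gamma> UNIV \<and>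
        \<Omega> \<inter> ball x r = {y \<in> ball x r. \<gamma> (y - (y \<bullet> \<nu>) *\<^sub>R \<nu>) < y \<bullet> \<nu>})"

definition test_function :: "'a::euclidean_space set \<Rightarrow> ('a \<Rightarrow> real) \<Rightarrow> bool" where
  "test_function \<Omega> \<phi> \<longleftrightarrow>
     smooth_on \<phi> UNIV \<and> compact (closure {x. \<phi> x \<noteq> 0}) \<and> closure {x. \<phi> x \<noteq> 0} \<subseteq> \<Omega>"

section \<open>The anisotropic norm\<close>

definition unit_normal :: "('a::euclidean_space \<Rightarrow> real) \<Rightarrow> 'a \<Rightarrow> 'a" where
  "unit_normal H x = grad H x /\<^sub>R norm (grad H x)"

text \<open>Principal curvatures at \<open>x\<close> of the level hypersurface of \<open>H\<close> through \<open>x\<close>: the eigenvalues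
  of the Weingarten map, that is, of the differential of the Gauss map restricted to the tangent
  space (the orthogonal complement of the gradient). With this outward orientation the Euclidean
  unit sphere has curvatures \<open>+1\<close>.\<close>

definition principal_curvature :: "('a::euclidean_space \<Rightarrow> real) \<Rightarrow> 'a \<Rightarrow> real \<Rightarrow> bool" where
  "principal_curvature H x \<kappa> \<longleftrightarrow>
     (\<exists>u. u \<noteq> 0 \<and> u \<bullet> grad H x = 0 \<and>
          frechet_derivative (unit_normal H) (at x) u = \<kappa> *\<^sub>R u)"

text \<open>The curvatures are nonnegative because \<open>H\<close> is convex, so bounding their
  absolute values is the same as bounding them from below by a positive constant.\<close>

definition unif_convex_unit_ball :: "('a::euclidean_space \<Rightarrow> real) \<Rightarrow> bool" where
  "unif_convex_unit_ball H \<longleftrightarrow>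
     (\<exists>\<delta>>0. \<forall>x \<in> frontier {y. H y < 1}. \<forall>\<kappa>. principal_curvature H x \<kappa> \<longrightarrow> \<delta> \<le> \<bar>\<kappa>\<bar>)"

definition anisotropic_norm :: "('a::euclidean_space \<Rightarrow> real) \<Rightarrow> bool" where
  "anisotropic_norm H \<longleftrightarrow>
     convex_on UNIV H \<and>
     (\<forall>t>0. \<forall>\<xi>. H (t *\<^sub>R \<xi>) = t * H \<xi>) \<and>
     (\<forall>\<xi>. \<xi> \<noteq> 0 \<longrightarrow> H \<xi> > 0) \<and>
     Ck_on 2 H (UNIV - {0}) \<and>
     unif_convex_unit_ball H"

definition dual_norm :: "('a::euclidean_space \<Rightarrow> real) \<Rightarrow> 'a \<Rightarrow> real" where
  "dual_norm H \<zeta> = (SUP \<xi>\<in>{\<xi>. H \<xi> = 1}. \<zeta> \<bullet> \<xi>)"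

definition dual_norm_hat :: "('a::euclidean_space \<Rightarrow> real) \<Rightarrow> 'a \<Rightarrow> real" where
  "dual_norm_hat H \<zeta> = dual_norm H (- \<zeta>)"

section \<open>Lebesgue norms and Hausdorff measure\<close>

definition in_Lp :: "real \<Rightarrow> 'a::euclidean_space set \<Rightarrow> ('a \<Rightarrow> real) \<Rightarrow> bool" where
  "in_Lp p S f \<longleftrightarrow> set_integrable lebesgue S (\<lambda>x. \<bar>f x\<bar> powr p)"

definition Lp_norm :: "real \<Rightarrow> 'a::euclidean_space set \<Rightarrow> ('a \<Rightarrow> real) \<Rightarrow> real" where
  "Lp_norm p S f = (LINT x:S|lebesgue. \<bar>f x\<bar> powr p) powr (1 / p)"

text \<open>Hausdorff measure of integer order, with the factor that makes the top-dimensional one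
  agree with Lebesgue measure. The empty set is treated separately so that order \<open>0\<close> gives
  counting measure; boundedness is required since \<open>diameter\<close> is unspecified on unbounded sets.\<close>

definition hausdorff_outer :: "nat \<Rightarrow> 'a::euclidean_space set \<Rightarrow> ennreal" where
  "hausdorff_outer s A =
     (SUP \<delta>\<in>{0<..}. INF C\<in>{C :: nat \<Rightarrow> 'a set.
          A \<subseteq> (\<Union>i. C i) \<and> (\<forall>i. bounded (C i) \<and> diameter (C i) \<le> \<delta>)}.
        (\<Sum>i. if C i = {} then 0
              else ennreal (unit_ball_vol (real s) * (diameter (C i) / 2) ^ s)))"

definition hausdorff :: "nat \<Rightarrow> 'a::euclidean_space measure" where
  "hausdorff s = measure_of UNIV (sets borel) (hausdorff_outer s)"

section \<open>Extremals and truncated extremals\<close>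

definition crit_exp :: "real \<Rightarrow> real \<Rightarrow> real" where
  "crit_exp n p = n * p / (n - p)"

definition c_const :: "real \<Rightarrow> real \<Rightarrow> real" where
  "c_const n p = n powr (1 / p) * ((n - p) / (p - 1)) powr ((p - 1) / p)"

definition U_ext :: "(real^'n \<Rightarrow> real) \<Rightarrow> real \<Rightarrow> real^'n \<Rightarrow> real" where
  "U_ext H p x =
     (c_const (real CARD('n)) p / (1 + dual_norm_hat H x powr (p / (p - 1))))
       powr ((real CARD('n) - p) / p)"

definition eta :: "(real^'n \<Rightarrow> real) \<Rightarrow> real \<Rightarrow> (real^'n \<Rightarrow> real) \<Rightarrow> real \<Rightarrow> real^'n \<Rightarrow> real" where
  "eta H p \<phi> \<epsilon> x =
     \<phi> x / (\<epsilon> + dual_norm H (- x) powr (p / (p - 1))) powr ((real CARD('n) - p) / p)"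

text \<open>Only used when \<open>n = p\<^sup>2\<close>, so that the order \<open>n - 1\<close> below is \<open>p\<^sup>2 - 1\<close>.\<close>

definition omega :: "(real^'n \<Rightarrow> real) \<Rightarrow> real" where
  "omega H = (LINT x:{x. dual_norm_hat H x = 1}|hausdorff (CARD('n) - 1).
                1 / norm (grad (dual_norm_hat H) x))"

end

theory Submission
  imports Defs
begin

text \<open>
  Write \<open>N = dual_norm_hat H\<close>, \<open>q = p / (p - 1)\<close>, \<open>k = (n - p) / p\<close>. Where the cut-off equals \<open>1\<close> the truncated
  extremal is the radial profile \<open>w \<epsilon> = (\<epsilon> + N powr q) powr (- k)\<close>, and \<open>w \<epsilon>\<close> is a rescaling of
  \<open>w 1\<close>. Each expansion compares the integral over \<open>\<Omega>\<close> with the one over the whole space: both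
  differ from the integral over a small ball \<open>N \<le> \<rho>\<close> by a quantity bounded uniformly in \<open>\<epsilon>\<close>, since
  the profile decays faster than \<open>N powr (- n)\<close>. In the borderline case \<open>n = p\<^sup>2\<close> the profile behaves like
  \<open>N powr (- n)\<close> and polar coordinates for \<open>N\<close> give the logarithm with the factor \<open>n\<close> times the
  volume of the unit ball of \<open>N\<close>.

  Uniform convexity makes the maximiser in the definition of the dual norm unique, hence \<open>N\<close> is
  continuously differentiable off the origin and \<open>H (- \<nabla>N) = 1\<close>. It remains to identify \<open>omega H\<close>
  with \<open>n\<close> times that volume. The isodiametric inequality (Steiner symmetrization) and Vitali
  coverings show that the Hausdorff measure of top dimension is Lebesgue measure. Small pieces of the
  unit level of \<open>N\<close> are projected radially to the tangent hyperplane, which is bi-Lipschitz with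
  constant close to \<open>1\<close> and almost preserves the volume of the cone over the piece; for flat pieces
  the relation between area and volume of the cone is elementary.
\<close>

section \<open>Hausdorff measure\<close>

text \<open>The reflection in \<open>dual_norm_hat\<close> is tailored to an asymmetric
  \<open>H\<close>: the profile decreases in \<open>N\<close>, so its gradient is a nonnegative
  multiple of \<open>- hat_grad x\<close>, and \<open>H (- hat_grad x) = 1\<close> turns
  \<open>H\<close> of the gradient into a function of \<open>N x\<close> alone.

  The main obstacle is \<open>omega\<close>. The measure \<open>hausdorff\<close> is formed by
  \<open>measure_of\<close>, which yields the zero measure for a set function that is not countably
  additive, so additivity on Borel sets has to precede every statement about \<open>omega\<close>.
  The unit level of \<open>N\<close> is only known to be continuously differentiable, so the area is
  computed by purely metric comparisons: they use first-order data of \<open>N\<close> and lose a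
  factor that tends to 1. Flattened pieces live in a Euclidean type of one dimension less, and there
  the Hausdorff measure has top dimension.

  Radial integration itself needs only the volumes of the gauge balls, so the surface measure enters
  the expansions through a single identity.\<close>

definition hausdorff_weight :: "nat \<Rightarrow> 'a::euclidean_space set \<Rightarrow> ennreal" where
  "hausdorff_weight s C =
     (if C = {} then 0 else ennreal (unit_ball_vol (real s) * (diameter C / 2) ^ s))"

definition hausdorff_covers :: "real \<Rightarrow> 'a::euclidean_space set \<Rightarrow> (nat \<Rightarrow> 'a set) set" where
  "hausdorff_covers \<delta> A = {C. A \<subseteq> (\<Union>i. C i) \<and> (\<forall>i. bounded (C i) \<and> diameter (C i) \<le> \<delta>)}"

text \<open>Content at a fixed mesh \<delta>. Covering arguments, including the Vitali ones, are
  carried out at one mesh, and the supremum over \<delta> is taken only at the end.\<close>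

definition hausdorff_pre :: "nat \<Rightarrow> real \<Rightarrow> 'a::euclidean_space set \<Rightarrow> ennreal" where
  "hausdorff_pre s \<delta> A = (INF C\<in>hausdorff_covers \<delta> A. \<Sum>i. hausdorff_weight s (C i))"

lemma hausdorff_outer_eq_SUP: "hausdorff_outer s A = (SUP \<delta>\<in>{0<..}. hausdorff_pre s \<delta> A)"
  unfolding hausdorff_outer_def hausdorff_pre_def hausdorff_covers_def hausdorff_weight_def ..

lemma hausdorff_weight_empty [simp]: "hausdorff_weight s {} = 0"
  by (simp add: hausdorff_weight_def)

lemma hausdorff_pre_le_outer: "0 < \<delta> \<Longrightarrow> hausdorff_pre s \<delta> A \<le> hausdorff_outer s A"
  unfolding hausdorff_outer_eq_SUP by (rule SUP_upper) simp

lemma hausdorff_outer_leI: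
  "(\<And>\<delta>. 0 < \<delta> \<Longrightarrow> hausdorff_pre s \<delta> A \<le> c) \<Longrightarrow> hausdorff_outer s A \<le> c"
  unfolding hausdorff_outer_eq_SUP by (rule SUP_least) simp

lemma hausdorff_pre_leI:
  assumes "A \<subseteq> (\<Union>i. C i)" "\<And>i. bounded (C i)" "\<And>i. diameter (C i) \<le> \<delta>"
    and "(\<Sum>i. hausdorff_weight s (C i)) \<le> c"
  shows "hausdorff_pre s \<delta> A \<le> c"
  unfolding hausdorff_pre_def hausdorff_covers_def
  by (rule INF_lower2[of C]) (use assms in auto)

lemma hausdorff_pre_geI:
  assumes "\<And>C. A \<subseteq> (\<Union>i. C i) \<Longrightarrow> (\<And>i. bounded (C i)) \<Longrightarrow> (\<And>i. diameter (C i) \<le> \<delta>)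
      \<Longrightarrow> c \<le> (\<Sum>i. hausdorff_weight s (C i))"
  shows "c \<le> hausdorff_pre s \<delta> A"
  unfolding hausdorff_pre_def hausdorff_covers_def
  by (rule INF_greatest) (use assms in auto)

lemma hausdorff_pre_approx:
  assumes "hausdorff_pre s \<delta> A < c"
  obtains C where "A \<subseteq> (\<Union>i. C i)" "\<And>i. bounded (C i)" "\<And>i. diameter (C i) \<le> \<delta>"
    "(\<Sum>i. hausdorff_weight s (C i)) < c"
  using assms unfolding hausdorff_pre_def hausdorff_covers_def INF_less_iff by auto

lemma hausdorff_pre_mono: "A \<subseteq> B \<Longrightarrow> hausdorff_pre s \<delta> A \<le> hausdorff_pre s \<delta> B"
  by (rule hausdorff_pre_geI, rule hausdorff_pre_leI[OF _ _ _ order_refl]) auto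

lemma hausdorff_pre_antimono: "\<delta> \<le> \<delta>' \<Longrightarrow> hausdorff_pre s \<delta>' A \<le> hausdorff_pre s \<delta> A"
  by (rule hausdorff_pre_geI, rule hausdorff_pre_leI[OF _ _ _ order_refl]) (auto intro: order_trans)

lemma hausdorff_outer_mono: "A \<subseteq> B \<Longrightarrow> hausdorff_outer s A \<le> hausdorff_outer s B"
  by (rule hausdorff_outer_leI)
     (meson hausdorff_pre_le_outer hausdorff_pre_mono order_trans)

lemma hausdorff_pre_empty: "0 < \<delta> \<Longrightarrow> hausdorff_pre s \<delta> {} = 0"
  using hausdorff_pre_leI[of "{}" "\<lambda>_. {}" \<delta> s 0] by auto

lemma hausdorff_outer_empty [simp]: "hausdorff_outer s {} = 0"
  using hausdorff_outer_leI[of s "{}" 0] by (auto simp: hausdorff_pre_empty)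

text \<open>Each \<open>A i\<close> gets a cover that is optimal up to
  \<open>e * (1/2)^Suc i\<close>; all these covers are merged into one sequence through
  \<open>prod_decode\<close>, and the errors sum to \<open>e\<close>. Near-optimal covers require
  finite values, whence the case distinction.\<close>

lemma hausdorff_pre_UN_le:
  fixes A :: "nat \<Rightarrow> 'a::euclidean_space set"
  assumes "0 < \<delta>"
  shows "hausdorff_pre s \<delta> (\<Union>i. A i) \<le> (\<Sum>i. hausdorff_pre s \<delta> (A i))"
proof (cases "\<exists>i. hausdorff_pre s \<delta> (A i) = \<infinity>")
  case True
  then obtain i where i: "hausdorff_pre s \<delta> (A i) = \<infinity>" by auto
  have "hausdorff_pre s \<delta> (A i) \<le> (\<Sum>i. hausdorff_pre s \<delta> (A i))"
    using sum_le_suminf[of "\<lambda>i. hausdorff_pre s \<delta> (A i)" "{i}"] by simp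
  then show ?thesis using i by (simp add: top_unique)
next
  case False
  show ?thesis
  proof (rule ennreal_le_epsilon)
    fix e :: real assume e: "0 < e"
    have "\<exists>C. A i \<subseteq> (\<Union>j. C j) \<and> (\<forall>j. bounded (C j) \<and> diameter (C j) \<le> \<delta>) \<and>
        (\<Sum>j. hausdorff_weight s (C j)) \<le> hausdorff_pre s \<delta> (A i) + ennreal (e * (1/2)^Suc i)" for i
    proof -
      have "hausdorff_pre s \<delta> (A i) < hausdorff_pre s \<delta> (A i) + ennreal (e * (1/2)^Suc i)"
        using False e by (auto simp: less_top)
      then obtain C where "A i \<subseteq> (\<Union>j. C j)" "\<And>j. bounded (C j)" "\<And>j. diameter (C j) \<le> \<delta>"
        "(\<Sum>j. hausdorff_weight s (C j)) < hausdorff_pre s \<delta> (A i) + ennreal (e * (1/2)^Suc i)"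
        by (rule hausdorff_pre_approx) blast
      then show ?thesis by (intro exI[of _ C]) auto
    qed
    then obtain C where C: "\<And>i. A i \<subseteq> (\<Union>j. C i j)" "\<And>i j. bounded (C i j)"
      "\<And>i j. diameter (C i j) \<le> \<delta>"
      "\<And>i. (\<Sum>j. hausdorff_weight s (C i j)) \<le> hausdorff_pre s \<delta> (A i) + ennreal (e * (1/2)^Suc i)"
      by metis
    define D where "D k = case_prod C (prod_decode k)" for k
    have "hausdorff_pre s \<delta> (\<Union>i. A i) \<le> (\<Sum>k. hausdorff_weight s (D k))"
    proof (rule hausdorff_pre_leI[OF _ _ _ order_refl])
      show "(\<Union>i. A i) \<subseteq> (\<Union>k. D k)"
      proof
        fix x assume "x \<in> (\<Union>i. A i)"
        then obtain i j where "x \<in> C i j" using C(1) by blast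
        then have "x \<in> D (prod_encode (i, j))" by (simp add: D_def)
        then show "x \<in> (\<Union>k. D k)" by blast
      qed
    qed (auto simp: D_def C split: prod.split)
    also have "\<dots> = (\<Sum>i. \<Sum>j. hausdorff_weight s (C i j))"
      using suminf_ennreal_2dimen[of "\<lambda>i. \<Sum>j. hausdorff_weight s (C i j)"
          "\<lambda>(i,j). hausdorff_weight s (C i j)"]
      by (simp add: D_def split_beta)
    also have "\<dots> \<le> (\<Sum>i. hausdorff_pre s \<delta> (A i) + ennreal (e * (1/2)^Suc i))"
      by (intro suminf_le C) auto
    also have "\<dots> = (\<Sum>i. hausdorff_pre s \<delta> (A i)) + (\<Sum>i. ennreal (e * (1/2)^Suc i))"
      by (rule suminf_add[symmetric]) auto
    also have "(\<Sum>i. ennreal (e * (1/2)^Suc i)) = ennreal e"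
      using e sums_mult[OF power_half_series, of e]
      by (intro suminf_ennreal_eq) auto
    finally show "hausdorff_pre s \<delta> (\<Union>i. A i) \<le> (\<Sum>i. hausdorff_pre s \<delta> (A i)) + ennreal e" .
  qed
qed

lemma hausdorff_outer_UN_le: "hausdorff_outer s (\<Union>i::nat. A i) \<le> (\<Sum>i. hausdorff_outer s (A i))"
proof (rule hausdorff_outer_leI)
  fix \<delta> :: real assume d: "0 < \<delta>"
  note hausdorff_pre_UN_le[OF this]
  also have "(\<Sum>i. hausdorff_pre s \<delta> (A i)) \<le> (\<Sum>i. hausdorff_outer s (A i))"
    by (intro suminf_le hausdorff_pre_le_outer d) auto
  finally show "hausdorff_pre s \<delta> (\<Union>i. A i) \<le> (\<Sum>i. hausdorff_outer s (A i))" .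
qed

lemma hausdorff_pre_Un_le:
  assumes "0 < \<delta>"
  shows "hausdorff_pre s \<delta> (A \<union> B) \<le> hausdorff_pre s \<delta> A + hausdorff_pre s \<delta> B"
proof -
  have eq: "A \<union> B = (\<Union>i. binaryset A B i)"
    by (simp add: UN_binaryset_eq)
  have "(\<Sum>i. hausdorff_pre s \<delta> (binaryset A B i)) = hausdorff_pre s \<delta> A + hausdorff_pre s \<delta> B"
    by (intro suminf_binaryset_eq hausdorff_pre_empty assms)
  then show ?thesis
    using hausdorff_pre_UN_le[OF assms, of s "binaryset A B"] by (simp add: eq[symmetric])
qed

lemma hausdorff_outer_Un_le: "hausdorff_outer s (A \<union> B) \<le> hausdorff_outer s A + hausdorff_outer s B"
  using hausdorff_outer_UN_le[of s "binaryset A B"]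
  by (simp add: UN_binaryset_eq suminf_binaryset_eq)

section \<open>Caratheodory measurability of Borel sets\<close>

lemma hausdorff_outer_measure_space: "outer_measure_space UNIV (hausdorff_outer s)"
  unfolding outer_measure_space_def positive_def increasing_def countably_subadditive_def
  by (auto intro: hausdorff_outer_mono hausdorff_outer_UN_le)

text \<open>A covering set of diameter below \<open>d\<close> cannot meet both \<open>A\<close> and
  \<open>B\<close>. A cover of the union therefore splits into a cover of \<open>A\<close> and one
  of \<open>B\<close> without using any set twice.\<close>

lemma hausdorff_outer_metric:
  assumes d: "0 < d" "\<And>x y. x \<in> A \<Longrightarrow> y \<in> B \<Longrightarrow> d \<le> dist x y"
  shows "hausdorff_outer s A + hausdorff_outer s B \<le> hausdorff_outer s (A \<union> B)"
proof -
  have pre: "hausdorff_pre s \<delta> A + hausdorff_pre s \<delta> B \<le> hausdorff_pre s \<delta> (A \<union> B)"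
    if \<delta>: "0 < \<delta>" "\<delta> < d" for \<delta>
  proof (rule hausdorff_pre_geI)
    fix C assume C: "A \<union> B \<subseteq> (\<Union>i. C i)" "\<And>i::nat. bounded (C i)" "\<And>i. diameter (C i) \<le> \<delta>"
    define CA where "CA i = (if C i \<inter> A = {} then {} else C i)" for i
    define CB where "CB i = (if C i \<inter> B = {} then {} else C i)" for i
    have "hausdorff_pre s \<delta> A \<le> (\<Sum>i. hausdorff_weight s (CA i))"
    proof (rule hausdorff_pre_leI[OF _ _ _ order_refl])
      show "A \<subseteq> (\<Union>i. CA i)" using C(1) by (fastforce simp: CA_def)
    qed (use C \<delta> in \<open>auto simp: CA_def\<close>)
    moreover have "hausdorff_pre s \<delta> B \<le> (\<Sum>i. hausdorff_weight s (CB i))"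
    proof (rule hausdorff_pre_leI[OF _ _ _ order_refl])
      show "B \<subseteq> (\<Union>i. CB i)" using C(1) by (fastforce simp: CB_def)
    qed (use C \<delta> in \<open>auto simp: CB_def\<close>)
    moreover have "hausdorff_weight s (CA i) + hausdorff_weight s (CB i) \<le> hausdorff_weight s (C i)" for i
    proof -
      have "C i \<inter> A = {} \<or> C i \<inter> B = {}"
        using C(2,3)[of i] d(2) \<delta> diameter_bounded_bound[of "C i"] by (fastforce simp: disjoint_iff)
      then show ?thesis by (auto simp: CA_def CB_def)
    qed
    then have "(\<Sum>i. hausdorff_weight s (CA i)) + (\<Sum>i. hausdorff_weight s (CB i))
        \<le> (\<Sum>i. hausdorff_weight s (C i))"
      by (subst suminf_add) (auto intro: suminf_le)
    ultimately show "hausdorff_pre s \<delta> A + hausdorff_pre s \<delta> B \<le> (\<Sum>i. hausdorff_weight s (C i))"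
      by (meson add_mono order_trans)
  qed
  \<comment> \<open>Two independent meshes are lowered to a common one below \<open>d\<close>, so
    that the two suprema can then be taken one after the other.\<close>
  have "hausdorff_pre s \<delta>1 A + hausdorff_pre s \<delta>2 B \<le> hausdorff_outer s (A \<union> B)"
    if "0 < \<delta>1" "0 < \<delta>2" for \<delta>1 \<delta>2
  proof -
    define \<delta> where "\<delta> = min (min \<delta>1 \<delta>2) (d/2)"
    have \<delta>: "0 < \<delta>" "\<delta> < d" "\<delta> \<le> \<delta>1" "\<delta> \<le> \<delta>2" using that d by (auto simp: \<delta>_def)
    have "hausdorff_pre s \<delta>1 A + hausdorff_pre s \<delta>2 B \<le> hausdorff_pre s \<delta> A + hausdorff_pre s \<delta> B"
      by (intro add_mono hausdorff_pre_antimono \<delta>)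
    also note pre[OF \<delta>(1,2)]
    also note hausdorff_pre_le_outer[OF \<delta>(1)]
    finally show ?thesis .
  qed
  then have "hausdorff_outer s A + hausdorff_pre s \<delta>2 B \<le> hausdorff_outer s (A \<union> B)"
    if "0 < \<delta>2" for \<delta>2
    unfolding hausdorff_outer_eq_SUP[of s A] using that
    by (subst ennreal_SUP_add_left[symmetric]) (auto intro!: SUP_least simp: gt_ex)
  then have "(SUP \<delta>\<in>{0<..}. hausdorff_pre s \<delta> B + hausdorff_outer s A) \<le> hausdorff_outer s (A \<union> B)"
    by (intro SUP_least) (simp add: add.commute[of _ "hausdorff_outer s A"])
  moreover have "{0::real<..} \<noteq> {}" by (auto simp: gt_ex)
  ultimately have "(SUP \<delta>\<in>{0<..}. hausdorff_pre s \<delta> B) + hausdorff_outer s A \<le> hausdorff_outer s (A \<union> B)"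
    by (simp only: ennreal_SUP_add_left[symmetric] not_False_eq_True)
  then show ?thesis
    unfolding hausdorff_outer_eq_SUP[of s B] by (subst add.commute)
qed

text \<open>Caratheodory's criterion: the rings \<open>R k\<close> around \<open>F\<close> with indices of equal parity are separated,
  so their outer measures are summable and the tail of the series is small.\<close>

lemma hausdorff_outer_closed_split:
  fixes F X :: "'a::euclidean_space set"
  assumes F: "closed F" "F \<noteq> {}"
  shows "hausdorff_outer s (F \<inter> X) + hausdorff_outer s (X - F) \<le> hausdorff_outer s X"
proof (cases "hausdorff_outer s X = \<infinity>")
  case False
  let ?H = "hausdorff_outer s"
  define Y where "Y k = {x \<in> X. 1 / real (Suc k) \<le> infdist x F}" for k
  define R where "R k = Y (Suc k) - Y k" for k
  have Ymono: "Y i \<subseteq> Y j" if "i \<le> j" for i j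
  proof -
    have "1 / real (Suc j) \<le> 1 / real (Suc i)" using that by (auto intro: divide_left_mono)
    then show ?thesis by (auto simp: Y_def)
  qed
  have infd: "infdist x F \<le> infdist y F + dist x y" for x y
    by (simp add: infdist_triangle)
  have sepY: "?H (F \<inter> X) + ?H (Y k) \<le> ?H X" for k
  proof -
    have "?H (F \<inter> X) + ?H (Y k) \<le> ?H (F \<inter> X \<union> Y k)"
    proof (rule hausdorff_outer_metric[of "1 / real (Suc k)"])
      fix x y assume xy: "x \<in> F \<inter> X" "y \<in> Y k"
      have "infdist y F \<le> dist y x" using xy by (auto intro: infdist_le)
      then show "1 / real (Suc k) \<le> dist x y" using xy by (simp add: Y_def dist_commute)
    qed simp
    also have "\<dots> \<le> ?H X" by (rule hausdorff_outer_mono) (auto simp: Y_def)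
    finally show ?thesis .
  qed
  \<comment> \<open>\<open>Y k\<close> and \<open>R (k+1)\<close> are separated by the ring
    \<open>R k\<close>, whose width is \<open>1/(k+1) - 1/(k+2)\<close>. Going outwards in steps of
    two, every new ring can be added by the separated case; \<open>i\<close> selects the
    parity.\<close>
  have gap: "(\<Sum>j<m. ?H (R (2*j+i+1))) \<le> ?H (Y (2*m+i))" for i m
  proof (induction m)
    case (Suc m)
    let ?k = "2*m+i"
    have "?H (Y ?k) + ?H (R (Suc ?k)) \<le> ?H (Y ?k \<union> R (Suc ?k))"
    proof (rule hausdorff_outer_metric[of "1 / real (Suc ?k) - 1 / real (Suc (Suc ?k))"])
      fix x y assume xy: "x \<in> Y ?k" "y \<in> R (Suc ?k)"
      then show "1 / real (Suc ?k) - 1 / real (Suc (Suc ?k)) \<le> dist x y"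
        using infd[of x y] by (auto simp: Y_def R_def)
    next
      show "0 < 1 / real (Suc ?k) - 1 / real (Suc (Suc ?k))"
        using frac_less2[of 1 1 "real (Suc ?k)" "real (Suc (Suc ?k))"] by simp
    qed
    also have "\<dots> \<le> ?H (Y (2 * Suc m + i))"
      using Ymono[of ?k "2 * Suc m + i"] by (intro hausdorff_outer_mono) (auto simp: R_def)
    finally have *: "?H (Y ?k) + ?H (R (Suc ?k)) \<le> ?H (Y (2 * Suc m + i))" .
    have "(\<Sum>j<m. ?H (R (2*j+i+1))) + ?H (R (Suc ?k)) \<le> ?H (Y (2 * Suc m + i))"
      by (rule order_trans[OF add_right_mono[OF Suc] *])
    then show ?case by simp
  qed simp
  let ?a = "\<lambda>j. ?H (R (j+1))"
  have HY: "?H (Y k) \<le> ?H X" for k by (rule hausdorff_outer_mono) (auto simp: Y_def)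
  have "(\<Sum>j<2*m. ?a j) = (\<Sum>j<m. ?H (R (2*j+0+1))) + (\<Sum>j<m. ?H (R (2*j+1+1)))" for m
    by (induction m) (simp_all add: ac_simps)
  moreover have "(\<Sum>j<m. ?H (R (2*j+i+1))) \<le> ?H X" for i m
    using gap HY by (rule order_trans)
  ultimately have "(\<Sum>j<2*m. ?a j) \<le> ?H X + ?H X" for m
    by (metis add_mono)
  moreover have "(\<Sum>j<m. ?a j) \<le> (\<Sum>j<2*m. ?a j)" for m
    by (rule sum_mono2) auto
  ultimately have "(\<Sum>j<m. ?a j) \<le> ?H X + ?H X" for m
    by (meson order_trans)
  then have "suminf ?a \<le> ?H X + ?H X" by (intro suminf_le_const) auto
  moreover have "?H X + ?H X < \<infinity>"
    using False by (simp add: less_top)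
  ultimately have fin: "suminf ?a < \<infinity>"
    by (rule le_less_trans)
  show ?thesis
  proof (rule ennreal_le_epsilon)
    fix e :: real assume e: "0 < e"
    have "\<exists>k. suminf ?a \<le> (\<Sum>j<k. ?a j) + ennreal e"
    proof (rule ccontr)
      assume "\<not> ?thesis"
      then have "(\<Sum>j<k. ?a j) + ennreal e \<le> suminf ?a" for k by (auto simp: not_le less_imp_le)
      then have "(SUP k. (\<Sum>j<k. ?a j) + ennreal e) \<le> suminf ?a" by (rule SUP_least)
      then have "(SUP k. (\<Sum>j<k. ?a j)) + ennreal e \<le> suminf ?a"
        by (subst (asm) ennreal_SUP_add_left) auto
      then have "suminf ?a + ennreal e \<le> suminf ?a" by (simp add: suminf_eq_SUP)
      then have "suminf ?a + ennreal e \<le> suminf ?a + 0" by simp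
      then show False using fin e unfolding ennreal_add_left_cancel_le by simp
    qed
    then obtain k where k: "suminf ?a \<le> (\<Sum>j<k. ?a j) + ennreal e" ..
    have "suminf ?a = (\<Sum>j. ?a (j + k)) + (\<Sum>j<k. ?a j)"
      by (rule suminf_offset) simp
    moreover define S where "S = (\<Sum>j<k. ?a j)"
    ultimately have "S + (\<Sum>j. ?a (j + k)) \<le> S + ennreal e"
      using k by (simp add: add.commute)
    moreover have "S < \<infinity>"
      unfolding S_def by (rule le_less_trans[OF sum_le_suminf fin]) auto
    ultimately have tail: "(\<Sum>j. ?a (j + k)) \<le> ennreal e"
      by (auto simp: ennreal_add_left_cancel_le)
    have "X - F \<subseteq> Y (k+1) \<union> (\<Union>j. R (j + k + 1))"
    proof
      fix x assume x: "x \<in> X - F"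
      then have "0 < infdist x F" using F
        by (simp add: infdist_pos_not_in_closed)
      then obtain n where n: "inverse (real (Suc n)) < infdist x F"
        using reals_Archimedean by blast
      then have "x \<in> Y n" using x by (auto simp: Y_def divide_inverse)
      then have ex: "x \<in> Y (n + k + 1)" using Ymono[of n "n+k+1"] by auto
      have "x \<in> Y (k+1) \<union> (\<Union>j<m. R (j + k + 1))" if "x \<in> Y (m + k + 1)" for m
        using that
      proof (induction m)
        case (Suc m)
        then show ?case by (cases "x \<in> Y (m + k + 1)") (auto simp: R_def lessThan_Suc)
      qed simp
      from this[OF ex] show "x \<in> Y (k+1) \<union> (\<Union>j. R (j + k + 1))" by blast
    qed
    then have "?H (X - F) \<le> ?H (Y (k+1) \<union> (\<Union>j. R (j + k + 1)))" by (rule hausdorff_outer_mono)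
    also have "\<dots> \<le> ?H (Y (k+1)) + (\<Sum>j. ?a (j + k))"
      by (rule order_trans[OF hausdorff_outer_Un_le add_left_mono[OF hausdorff_outer_UN_le]])
    also have "\<dots> \<le> ?H (Y (k+1)) + ennreal e" by (intro add_left_mono tail)
    finally have "?H (F \<inter> X) + ?H (X - F) \<le> (?H (F \<inter> X) + ?H (Y (k+1))) + ennreal e"
      by (simp add: add_left_mono add.assoc)
    also have "\<dots> \<le> ?H X + ennreal e" by (intro add_right_mono sepY)
    finally show "?H (F \<inter> X) + ?H (X - F) \<le> ?H X + ennreal e" .
  qed
qed simp

text \<open>The measurable sets in the sense of Caratheodory form a sigma-algebra, and closed sets
  generate the Borel sets. The empty set is treated apart because \<open>infdist\<close> to it is
  the default value 0.\<close>

lemma borel_subset_lambda_system: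
  "sets (borel :: 'a::euclidean_space measure) \<subseteq> lambda_system UNIV UNIV (hausdorff_outer s)"
proof -
  interpret sigma_algebra "UNIV :: 'a set" UNIV
    using sigma_algebra_Pow[of "UNIV :: 'a set"] by simp
  let ?L = "lambda_system (UNIV :: 'a set) UNIV (hausdorff_outer s)"
  have ms: "measure_space UNIV ?L (hausdorff_outer s)"
    using caratheodory_lemma[OF hausdorff_outer_measure_space] by simp
  then have sa: "sigma_algebra UNIV ?L" by (simp add: measure_space_def)
  have "F \<in> ?L" if "closed F" for F
  proof (cases "F = {}")
    case False
    have "hausdorff_outer s (F \<inter> X) + hausdorff_outer s (X - F) = hausdorff_outer s X" for X
    proof (rule antisym)
      show "hausdorff_outer s X \<le> hausdorff_outer s (F \<inter> X) + hausdorff_outer s (X - F)"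
        using hausdorff_outer_Un_le[of s "F \<inter> X" "X - F"]
        by (metis Int_Diff_Un Int_commute)
    qed (rule hausdorff_outer_closed_split[OF that False])
    then show ?thesis by (simp add: lambda_system_def Diff_eq Int_commute)
  qed (use sigma_algebra.sigma_sets_eq[OF sa] sigma_sets.Empty in blast)
  then have "sigma_sets UNIV (Collect closed) \<subseteq> ?L"
    by (intro sigma_algebra.sigma_sets_subset[OF sa]) auto
  then show ?thesis by (simp add: borel_eq_closed)
qed

lemma sets_hausdorff [simp, measurable_cong]: "sets (hausdorff s) = sets borel"
  unfolding hausdorff_def using sets.sigma_sets_eq[of borel] by (simp add: sets_measure_of_conv)

lemma space_hausdorff [simp]: "space (hausdorff s) = UNIV"
  unfolding hausdorff_def by (simp add: space_measure_of_conv)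

text \<open>\<open>measure_of\<close> returns the prescribed values once countable additivity on the
  Borel sets is known; additivity is inherited from the larger system of Caratheodory measurable
  sets.\<close>

lemma emeasure_hausdorff:
  fixes A :: "'a::euclidean_space set"
  assumes "A \<in> sets borel"
  shows "emeasure (hausdorff s) A = hausdorff_outer s A"
proof (rule emeasure_measure_of[OF hausdorff_def])
  interpret sigma_algebra "UNIV :: 'a set" UNIV
    using sigma_algebra_Pow[of "UNIV :: 'a set"] by simp
  have "measure_space (UNIV :: 'a set) (lambda_system UNIV UNIV (hausdorff_outer s)) (hausdorff_outer s)"
    using caratheodory_lemma[OF hausdorff_outer_measure_space] by simp
  then show "countably_additive (sets (hausdorff s)) (hausdorff_outer s :: 'a set \<Rightarrow> ennreal)"
    using borel_subset_lambda_system[where 'a='a and s=s]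
    by (auto simp: measure_space_def countably_additive_def)
qed (use assms in \<open>auto simp: positive_def\<close>)

text \<open>Covering sets are cut down to \<open>A\<close> before \<open>f\<close> is applied, since
  \<open>f\<close> is controlled only there. Diameters grow at most by \<open>L\<close>, so mesh
  \<open>\<delta> / L\<close> in the source serves mesh \<delta> in the target.\<close>

lemma hausdorff_outer_Lipschitz_image:
  fixes f :: "'a::euclidean_space \<Rightarrow> 'b::euclidean_space"
  assumes L: "0 < L" and f: "\<And>x y. x \<in> A \<Longrightarrow> y \<in> A \<Longrightarrow> dist (f x) (f y) \<le> L * dist x y"
  shows "hausdorff_outer s (f ` A) \<le> ennreal (L ^ s) * hausdorff_outer s A"
proof (rule hausdorff_outer_leI)
  fix \<delta> :: real assume \<delta>: "0 < \<delta>"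
  have "hausdorff_pre s \<delta> (f ` A) \<le> ennreal (L ^ s) * (\<Sum>i. hausdorff_weight s (C i))"
    if C: "A \<subseteq> (\<Union>i. C i)" "\<And>i. bounded (C i)" "\<And>i. diameter (C i) \<le> \<delta> / L" for C :: "nat \<Rightarrow> 'a set"
  proof (rule hausdorff_pre_leI)
    let ?D = "\<lambda>i. f ` (C i \<inter> A)"
    have d: "dist x y \<le> L * diameter (C i)" if "x \<in> ?D i" "y \<in> ?D i" for i x y
    proof -
      obtain u v where uv: "u \<in> C i" "u \<in> A" "v \<in> C i" "v \<in> A" "x = f u" "y = f v" using \<open>x \<in> ?D i\<close> \<open>y \<in> ?D i\<close> by auto
      then have "dist x y \<le> L * dist u v" using f by auto
      also have "\<dots> \<le> L * diameter (C i)"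
        using uv L C(2) by (intro mult_left_mono diameter_bounded_bound) auto
      finally show ?thesis .
    qed
    have dD: "diameter (?D i) \<le> L * diameter (C i)" for i
      using d[of _ i] L diameter_ge_0[OF C(2)[of i]] by (intro diameter_le) (auto simp: dist_norm)
    show "f ` A \<subseteq> (\<Union>i. ?D i)" using C(1) by blast
    show bD: "bounded (?D i)" for i using d[of _ i] by (auto simp: bounded_two_points intro!: exI)
    have "L * diameter (C i) \<le> \<delta>" for i using C(3)[of i] L by (simp add: field_simps)
    then show "diameter (?D i) \<le> \<delta>" for i using dD[of i] by (meson order_trans)
    have "hausdorff_weight s (?D i) \<le> ennreal (L ^ s) * hausdorff_weight s (C i)" for i
    proof (cases "C i \<inter> A = {}")
      case False
      have "unit_ball_vol (real s) * (diameter (?D i) / 2) ^ s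
          \<le> unit_ball_vol (real s) * (L * diameter (C i) / 2) ^ s"
        using dD[of i] diameter_ge_0[OF bD[of i]] by (intro mult_left_mono power_mono) auto
      also have "\<dots> = L ^ s * (unit_ball_vol (real s) * (diameter (C i) / 2) ^ s)"
        by (simp add: power_mult_distrib power_divide)
      finally show ?thesis using False L
        by (auto simp: hausdorff_weight_def ennreal_mult'[symmetric] intro!: ennreal_leI)
    qed simp
    then have "(\<Sum>i. hausdorff_weight s (?D i)) \<le> (\<Sum>i. ennreal (L ^ s) * hausdorff_weight s (C i))"
      by (intro suminf_le) auto
    then show "(\<Sum>i. hausdorff_weight s (?D i)) \<le> ennreal (L ^ s) * (\<Sum>i. hausdorff_weight s (C i))"
      by simp
  qed
  then have "hausdorff_pre s \<delta> (f ` A) / ennreal (L ^ s) \<le> hausdorff_pre s (\<delta> / L) A"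
    using L by (intro hausdorff_pre_geI divide_le_posI_ennreal) auto
  also have "\<dots> \<le> hausdorff_outer s A" using \<delta> L by (intro hausdorff_pre_le_outer) auto
  finally have "hausdorff_pre s \<delta> (f ` A) / ennreal (L ^ s) * ennreal (L ^ s) \<le> hausdorff_outer s A * ennreal (L ^ s)"
    by (rule mult_right_mono) simp
  moreover have "hausdorff_pre s \<delta> (f ` A) / ennreal (L ^ s) * ennreal (L ^ s) = hausdorff_pre s \<delta> (f ` A)"
    using L by (simp add: ennreal_divide_times ennreal_mult_divide_eq)
  ultimately show "hausdorff_pre s \<delta> (f ` A) \<le> ennreal (L ^ s) * hausdorff_outer s A"
    by (simp add: mult.commute)
qed

section \<open>The isodiametric inequality\<close>

definition reflect :: "'a::euclidean_space \<Rightarrow> 'a \<Rightarrow> 'a" where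
  "reflect b x = x - (2 * (x \<bullet> b)) *\<^sub>R b"

text \<open>The parameter is the absolute coordinate along \<open>b\<close>, not the displacement
  from \<open>x\<close>. For \<open>b \<in> Basis\<close> the fibre is then the same for all points
  of a line parallel to \<open>b\<close>.\<close>

definition fibre :: "'a::euclidean_space \<Rightarrow> 'a set \<Rightarrow> 'a \<Rightarrow> real set" where
  "fibre b A x = {t. x + (t - x \<bullet> b) *\<^sub>R b \<in> A}"

text \<open>On every line the fibre is replaced by the open centred interval of the same measure.
  Phrasing this through the measure covers fibres of infinite length and reduces Borel measurability
  to that of the fibre measure.\<close>

definition steiner :: "'a::euclidean_space \<Rightarrow> 'a set \<Rightarrow> 'a set" where
  "steiner b A = {x. ennreal (2 * \<bar>x \<bullet> b\<bar>) < emeasure lborel (fibre b A x)}"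

lemma fibre_shift: "b \<in> Basis \<Longrightarrow> fibre b A (x + c *\<^sub>R b) = fibre b A x"
  by (simp add: fibre_def inner_simps algebra_simps)

lemma borel_fibre [measurable]: "A \<in> sets borel \<Longrightarrow> fibre b A x \<in> sets borel"
  using measurable_sets[of "\<lambda>t. x + (t - x \<bullet> b) *\<^sub>R b" "borel :: real measure" borel A]
  by (simp add: fibre_def vimage_def)

lemma emeasure_fibre:
  assumes "A \<in> sets borel"
  shows "emeasure lborel (fibre b A x) = (\<integral>\<^sup>+t. indicator A (x + (t - x \<bullet> b) *\<^sub>R b) \<partial>lborel)"
proof -
  have "emeasure lborel (fibre b A x) = (\<integral>\<^sup>+t. indicator (fibre b A x) t \<partial>lborel)"
    using assms by (subst nn_integral_indicator) auto
  also have "\<dots> = (\<integral>\<^sup>+t. indicator A (x + (t - x \<bullet> b) *\<^sub>R b) \<partial>lborel)"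
    by (intro nn_integral_cong) (simp add: fibre_def indicator_def)
  finally show ?thesis .
qed

lemma borel_measurable_fibre:
  assumes [measurable]: "A \<in> sets borel"
  shows "(\<lambda>x. emeasure lborel (fibre b A x)) \<in> borel_measurable borel"
  unfolding emeasure_fibre[OF assms] by measurable

lemma borel_steiner [measurable]:
  assumes [measurable]: "A \<in> sets borel"
  shows "steiner b A \<in> sets borel"
proof -
  note borel_measurable_fibre[measurable]
  show ?thesis unfolding steiner_def by measurable
qed

text \<open>Tonelli with the coordinate along \<open>b\<close> innermost, which makes volumes
  comparable fibre by fibre.\<close>

lemma nn_integral_lborel_split:
  fixes f :: "'a::euclidean_space \<Rightarrow> ennreal"
  assumes b: "b \<in> Basis" and f[measurable]: "f \<in> borel_measurable borel"
  shows "(\<integral>\<^sup>+x. f x \<partial>lborel) =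
    (\<integral>\<^sup>+y. (\<integral>\<^sup>+t. f ((\<Sum>j\<in>Basis - {b}. y j *\<^sub>R j) + t *\<^sub>R b) \<partial>lborel) \<partial>(\<Pi>\<^sub>M j\<in>Basis - {b}. lborel))"
proof -
  interpret product_sigma_finite "\<lambda>j::'a. lborel :: real measure" ..
  have ins: "insert b (Basis - {b}) = (Basis :: 'a set)" using b by auto
  have "(\<integral>\<^sup>+x. f x \<partial>lborel) = (\<integral>\<^sup>+y. f (\<Sum>j\<in>Basis. y j *\<^sub>R j) \<partial>(\<Pi>\<^sub>M j\<in>Basis. lborel))"
    by (subst lborel_eq, subst nn_integral_distr) auto
  also have "\<dots> = (\<integral>\<^sup>+y. f (\<Sum>j\<in>Basis. y j *\<^sub>R j) \<partial>(\<Pi>\<^sub>M j\<in>insert b (Basis - {b}). lborel))"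
    by (simp only: ins)
  also have "\<dots> = (\<integral>\<^sup>+y. (\<integral>\<^sup>+t. f (\<Sum>j\<in>Basis. (y(b := t)) j *\<^sub>R j) \<partial>lborel) \<partial>(\<Pi>\<^sub>M j\<in>Basis - {b}. lborel))"
  proof (rule product_nn_integral_insert)
    show "(\<lambda>y. f (\<Sum>j\<in>Basis. y j *\<^sub>R j)) \<in> borel_measurable (Pi\<^sub>M (insert b (Basis - {b})) (\<lambda>j. lborel))"
      unfolding ins by measurable
  qed auto
  also have "(\<lambda>y t. f (\<Sum>j\<in>Basis. (y(b := t)) j *\<^sub>R j)) = (\<lambda>y t. f ((\<Sum>j\<in>Basis - {b}. y j *\<^sub>R j) + t *\<^sub>R b))"
  proof (intro ext arg_cong[where f=f])
    fix y :: "'a \<Rightarrow> real" and t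
    have "(\<Sum>j\<in>Basis. (y(b := t)) j *\<^sub>R j) = t *\<^sub>R b + (\<Sum>j\<in>Basis - {b}. (y(b := t)) j *\<^sub>R j)"
      using b by (subst sum.remove[of _ b]) auto
    also have "(\<Sum>j\<in>Basis - {b}. (y(b := t)) j *\<^sub>R j) = (\<Sum>j\<in>Basis - {b}. y j *\<^sub>R j)"
      by (intro sum.cong) auto
    finally show "(\<Sum>j\<in>Basis. (y(b := t)) j *\<^sub>R j) = (\<Sum>j\<in>Basis - {b}. y j *\<^sub>R j) + t *\<^sub>R b"
      by (simp add: add.commute)
  qed
  finally show ?thesis .
qed

lemma emeasure_lborel_centered_interval:
  "emeasure lborel {t::real. ennreal (2 * \<bar>t\<bar>) < m} = m"
proof (cases m)
  case (real r)
  have "{t::real. ennreal (2 * \<bar>t\<bar>) < m} = {- (r/2) <..< r/2}"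
    using real by (auto simp: ennreal_less_iff abs_less_iff)
  then show ?thesis using real by (simp add: emeasure_lborel_Ioo)
next
  case top
  then show ?thesis by (simp add: ennreal_less_top)
qed

text \<open>Cavalieri's principle: the fibres of \<open>steiner b A\<close> are the centred
  intervals, so their measures agree with those of the fibres of \<open>A\<close>.\<close>

lemma emeasure_steiner:
  assumes b: "b \<in> Basis" and [measurable]: "A \<in> sets borel"
  shows "emeasure lborel (steiner b A) = emeasure lborel A"
proof -
  have fib: "(\<integral>\<^sup>+t. indicator B (z + t *\<^sub>R b) \<partial>lborel) = emeasure lborel (fibre b B z)"
    if "z \<bullet> b = 0" "B \<in> sets borel" for z B
    using that by (simp add: emeasure_fibre)
  have z: "(\<Sum>j\<in>Basis - {b}. y j *\<^sub>R j) \<bullet> b = 0" for y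
    using b by (simp add: inner_sum_left inner_Basis)
  have "fibre b (steiner b A) x = {t. ennreal (2 * \<bar>t\<bar>) < emeasure lborel (fibre b A x)}" for x
  proof -
    have "fibre b (steiner b A) x = {t. x + (t - x \<bullet> b) *\<^sub>R b \<in> steiner b A}"
      by (simp add: fibre_def)
    also have "\<dots> = {t. ennreal (2 * \<bar>t\<bar>) < emeasure lborel (fibre b A x)}"
      using b by (simp add: steiner_def fibre_shift inner_simps)
    finally show ?thesis .
  qed
  then have "emeasure lborel (fibre b (steiner b A) x) = emeasure lborel (fibre b A x)" for x
    by (simp add: emeasure_lborel_centered_interval)
  then have "(\<integral>\<^sup>+x. indicator (steiner b A) x \<partial>lborel) = (\<integral>\<^sup>+x. indicator A x \<partial>lborel)"
    by (subst (1 2) nn_integral_lborel_split[OF b]) (auto simp: fib z)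
  then show ?thesis by simp
qed

lemma reflect_steiner:
  assumes "b \<in> Basis"
  shows "reflect b x \<in> steiner b A \<longleftrightarrow> x \<in> steiner b A"
proof -
  have "fibre b A (reflect b x) = fibre b A x"
    using fibre_shift[OF assms, of A x "- (2 * (x \<bullet> b))"] by (simp add: reflect_def)
  then show ?thesis using assms by (simp add: steiner_def reflect_def inner_simps)
qed

text \<open>A reflection in an orthogonal direction permutes the lines parallel to \<open>b\<close>
  and keeps the parameter along them. Hence a symmetry obtained from an earlier direction survives
  the symmetrization in a later one.\<close>

lemma reflect_steiner_other:
  assumes "b \<in> Basis" "c \<in> Basis" "b \<noteq> c" and A: "\<And>x. reflect c x \<in> A \<longleftrightarrow> x \<in> A"
  shows "reflect c x \<in> steiner b A \<longleftrightarrow> x \<in> steiner b A"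
proof -
  have orth: "b \<bullet> c = 0" "c \<bullet> b = 0" using assms by (auto simp: inner_Basis)
  have "fibre b A (reflect c x) = fibre b A x"
  proof -
    have "reflect c x + (t - reflect c x \<bullet> b) *\<^sub>R b = reflect c (x + (t - x \<bullet> b) *\<^sub>R b)" for t
      by (simp add: reflect_def inner_simps orth)
    then show ?thesis by (simp add: fibre_def A)
  qed
  then show ?thesis by (simp add: steiner_def reflect_def inner_simps orth)
qed

text \<open>If all points of the two fibres were closer in direction \<open>b\<close> than \<open>x\<close> and \<open>y\<close> are, then the
  intervals spanned by the fibres would be shorter than the measures of the fibres allow.\<close>

lemma dist_steiner_le:
  assumes b: "b \<in> Basis" and A: "\<And>x y. x \<in> A \<Longrightarrow> y \<in> A \<Longrightarrow> dist x y \<le> d"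
    and x: "x \<in> steiner b A" and y: "y \<in> steiner b A"
  shows "dist x y \<le> d"
proof -
  let ?S = "fibre b A x" and ?T = "fibre b A y"
  define s t where "s = x \<bullet> b" and "t = y \<bullet> b"
  have S: "ennreal (2 * \<bar>s\<bar>) < emeasure lborel ?S" and T: "ennreal (2 * \<bar>t\<bar>) < emeasure lborel ?T"
    using x y by (simp_all add: steiner_def s_def t_def)
  have nonempty: "?S \<noteq> {}" "?T \<noteq> {}" using S T by auto
  \<comment> \<open>Moving both points along \<open>b\<close> changes only the component of their
    difference along \<open>b\<close>, from \<open>s - t\<close> to \<open>u - v\<close>.\<close>
  have dist2: "(dist (x + (u - s) *\<^sub>R b) (y + (v - t) *\<^sub>R b))\<^sup>2 = (dist x y)\<^sup>2 - (s - t)\<^sup>2 + (u - v)\<^sup>2" for u v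
  proof -
    define w e a where "w = x - y" and "e = s - t" and "a = u - v"
    have wb: "w \<bullet> b = e" "b \<bullet> w = e" by (simp_all add: w_def e_def s_def t_def inner_simps inner_commute)
    have "x + (u - s) *\<^sub>R b - (y + (v - t) *\<^sub>R b) = w + (a - e) *\<^sub>R b"
      by (simp add: w_def a_def e_def algebra_simps)
    moreover have "(w + (a - e) *\<^sub>R b) \<bullet> (w + (a - e) *\<^sub>R b) = w \<bullet> w - e\<^sup>2 + a\<^sup>2"
      using b by (simp add: inner_simps wb power2_eq_square algebra_simps)
    ultimately show ?thesis
      by (simp only: dist_norm power2_norm_eq_inner w_def e_def a_def)
  qed
  have "\<exists>u\<in>?S. \<exists>v\<in>?T. \<bar>s - t\<bar> \<le> \<bar>u - v\<bar>"
  proof (rule ccontr)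
    assume "\<not> ?thesis"
    then have far: "\<bar>u - v\<bar> < \<bar>s\<bar> + \<bar>t\<bar>" if "u \<in> ?S" "v \<in> ?T" for u v
      using that abs_triangle_ineq4[of s t] by fastforce
    obtain u0 v0 where uv0: "u0 \<in> ?S" "v0 \<in> ?T" using nonempty by auto
    let ?m = "\<bar>s\<bar> + \<bar>t\<bar>"
    have "v0 - ?m \<le> u \<and> u \<le> v0 + ?m" if "u \<in> ?S" for u
      using far[OF that uv0(2)] by linarith
    then have bS: "bdd_above ?S" "bdd_below ?S" by (meson bdd_aboveI bdd_belowI)+
    have "u0 - ?m \<le> v \<and> v \<le> u0 + ?m" if "v \<in> ?T" for v
      using far[OF uv0(1) that] by linarith
    then have bT: "bdd_above ?T" "bdd_below ?T" by (meson bdd_aboveI bdd_belowI)+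
    \<comment> \<open>This bound and its mirror image add up to \<open>2 * ?m\<close> for the total
      length of the two spanning intervals, whereas the fibre measures make that total exceed
      \<open>2 * \<bar>s\<bar> + 2 * \<bar>t\<bar>\<close>.\<close>
    have "Sup ?S - Inf ?T \<le> ?m"
    proof -
      have "u - ?m \<le> Inf ?T" if "u \<in> ?S" for u
      proof (rule cInf_greatest)
        show "u - ?m \<le> v" if "v \<in> ?T" for v using far[OF \<open>u \<in> ?S\<close> that] by linarith
      qed (rule nonempty)
      then have "Sup ?S \<le> Inf ?T + ?m"
        using nonempty by (intro cSup_least) (auto simp: diff_le_eq)
      then show ?thesis by simp
    qed
    moreover have "Sup ?T - Inf ?S \<le> ?m"
    proof -
      have "v - ?m \<le> Inf ?S" if "v \<in> ?T" for v
      proof (rule cInf_greatest)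
        show "v - ?m \<le> u" if "u \<in> ?S" for u using far[OF that \<open>v \<in> ?T\<close>] by linarith
      qed (rule nonempty)
      then have "Sup ?T \<le> Inf ?S + ?m"
        using nonempty by (intro cSup_least) (auto simp: diff_le_eq)
      then show ?thesis by simp
    qed
    moreover have "2 * \<bar>s\<bar> < Sup ?S - Inf ?S"
    proof -
      have "?S \<subseteq> {Inf ?S..Sup ?S}" using bS by (auto intro: cInf_lower cSup_upper)
      then have "emeasure lborel ?S \<le> emeasure lborel {Inf ?S..Sup ?S}" by (intro emeasure_mono) auto
      also have "\<dots> = ennreal (Sup ?S - Inf ?S)"
        using nonempty bS by (intro emeasure_lborel_Icc cInf_le_cSup)
      finally show ?thesis using S
        by (metis abs_ge_zero ennreal_less_iff less_le_trans mult_nonneg_nonneg zero_le_numeral)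
    qed
    moreover have "2 * \<bar>t\<bar> < Sup ?T - Inf ?T"
    proof -
      have "?T \<subseteq> {Inf ?T..Sup ?T}" using bT by (auto intro: cInf_lower cSup_upper)
      then have "emeasure lborel ?T \<le> emeasure lborel {Inf ?T..Sup ?T}" by (intro emeasure_mono) auto
      also have "\<dots> = ennreal (Sup ?T - Inf ?T)"
        using nonempty bT by (intro emeasure_lborel_Icc cInf_le_cSup)
      finally show ?thesis using T
        by (metis abs_ge_zero ennreal_less_iff less_le_trans mult_nonneg_nonneg zero_le_numeral)
    qed
    ultimately show False by linarith
  qed
  then obtain u v where uv: "u \<in> ?S" "v \<in> ?T" "\<bar>s - t\<bar> \<le> \<bar>u - v\<bar>" by auto
  have "(dist x y)\<^sup>2 \<le> (dist (x + (u - s) *\<^sub>R b) (y + (v - t) *\<^sub>R b))\<^sup>2"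
    using uv(3) by (simp add: dist2 abs_le_square_iff)
  then have "dist x y \<le> dist (x + (u - s) *\<^sub>R b) (y + (v - t) *\<^sub>R b)"
    by (rule power2_le_imp_le) simp
  also have "\<dots> \<le> d" using uv(1,2) by (intro A) (auto simp: fibre_def s_def t_def)
  finally show ?thesis .
qed

lemma exists_symmetrization:
  fixes A B :: "'a::euclidean_space set"
  assumes A: "A \<in> sets borel" "\<And>x y. x \<in> A \<Longrightarrow> y \<in> A \<Longrightarrow> dist x y \<le> d"
    and "finite B" "B \<subseteq> Basis"
  shows "\<exists>A'\<in>sets borel. emeasure lborel A' = emeasure lborel A \<and>
    (\<forall>x\<in>A'. \<forall>y\<in>A'. dist x y \<le> d) \<and> (\<forall>b\<in>B. \<forall>x. reflect b x \<in> A' \<longleftrightarrow> x \<in> A')"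
  using assms(3,4)
proof (induction B)
  case empty
  show ?case using A by auto
next
  case (insert b B)
  then obtain A' :: "'a set" where A': "A' \<in> sets borel" "emeasure lborel A' = emeasure lborel A"
    "\<And>x y. x \<in> A' \<Longrightarrow> y \<in> A' \<Longrightarrow> dist x y \<le> d" "\<And>c x. c \<in> B \<Longrightarrow> reflect c x \<in> A' \<longleftrightarrow> x \<in> A'"
    by auto
  have b: "b \<in> Basis" using insert by auto
  show ?case
  proof (intro bexI[where x="steiner b A'"] conjI ballI allI)
    fix c x assume "c \<in> insert b B"
    then consider "c = b" | "c \<in> B" "c \<in> Basis" "b \<noteq> c" using insert.hyps insert.prems by auto
    then show "reflect c x \<in> steiner b A' \<longleftrightarrow> x \<in> steiner b A'"
    proof cases
      case 1
      then show ?thesis using reflect_steiner[OF b] by simp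
    next
      case 2
      then show ?thesis by (intro reflect_steiner_other[OF b] A'(4))
    qed
  next
    fix x y assume "x \<in> steiner b A'" "y \<in> steiner b A'"
    then show "dist x y \<le> d" using dist_steiner_le[OF b A'(3)] by blast
  qed (use A' b in \<open>auto simp: emeasure_steiner\<close>)
qed

text \<open>A set of diameter \<open>d\<close> need not fit into a ball of radius
  \<open>d / 2\<close>, but a centrally symmetric one does: \<open>x\<close> and \<open>- x\<close>
  are at distance \<open>2 * norm x\<close>. Symmetrizing in all coordinate directions produces this
  symmetry while keeping the volume and the diameter bound.\<close>

theorem isodiametric_inequality:
  fixes A :: "'a::euclidean_space set"
  assumes A: "A \<in> sets borel" "\<And>x y. x \<in> A \<Longrightarrow> y \<in> A \<Longrightarrow> dist x y \<le> d" and d: "0 \<le> d"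
  shows "emeasure lborel A \<le> ennreal (unit_ball_vol (real DIM('a)) * (d / 2) ^ DIM('a))"
proof -
  have "\<exists>A'\<in>sets (borel :: 'a measure). emeasure lborel A' = emeasure lborel A \<and>
    (\<forall>x\<in>A'. \<forall>y\<in>A'. dist x y \<le> d) \<and> (\<forall>b\<in>Basis. \<forall>x. reflect b x \<in> A' \<longleftrightarrow> x \<in> A')"
    by (rule exists_symmetrization[OF A]) auto
  then obtain A' :: "'a set" where A': "A' \<in> sets borel" "emeasure lborel A' = emeasure lborel A"
    and A'_diam: "\<forall>x\<in>A'. \<forall>y\<in>A'. dist x y \<le> d"
    and A'_refl: "\<forall>b\<in>Basis. \<forall>x. reflect b x \<in> A' \<longleftrightarrow> x \<in> A'"
    by auto
  \<comment> \<open>Successive reflections along \<open>B\<close> subtract twice the projection to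
    the span of \<open>B\<close>; for \<open>B = Basis\<close> the result is
    \<open>- x\<close>.\<close>
  have refl: "x - 2 *\<^sub>R (\<Sum>b\<in>B. (x \<bullet> b) *\<^sub>R b) \<in> A'" if "finite B" "B \<subseteq> Basis" "x \<in> A'" for B x
    using that
  proof (induction B)
    case (insert b B)
    let ?z = "x - 2 *\<^sub>R (\<Sum>b\<in>B. (x \<bullet> b) *\<^sub>R b)"
    have "(\<Sum>c\<in>B. (x \<bullet> c) *\<^sub>R c) \<bullet> b = (\<Sum>c\<in>B. 0)"
      unfolding inner_sum_left
    proof (rule sum.cong[OF refl])
      fix c assume "c \<in> B"
      then have "c \<noteq> b" "c \<in> Basis" "b \<in> Basis" using insert by auto
      then show "(x \<bullet> c) *\<^sub>R c \<bullet> b = 0" by (simp add: inner_not_same_Basis)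
    qed
    then have "reflect b ?z = x - 2 *\<^sub>R (\<Sum>b\<in>insert b B. (x \<bullet> b) *\<^sub>R b)"
      using insert by (simp add: reflect_def inner_simps algebra_simps)
    moreover have "?z \<in> A'" "b \<in> Basis" using insert by auto
    then have "reflect b ?z \<in> A'" using A'_refl by blast
    ultimately show ?case by (simp only:)
  qed simp
  have neg: "- x \<in> A'" if "x \<in> A'" for x
  proof -
    have "x - 2 *\<^sub>R x = - x" by (simp add: scaleR_2)
    then show ?thesis using refl[of Basis x] that by (simp add: euclidean_representation)
  qed
  have "A' \<subseteq> cball 0 (d / 2)"
  proof
    fix x assume x: "x \<in> A'"
    have "dist x (- x) = 2 * norm x"
      by (metis dist_norm diff_minus_eq_add norm_scaleR abs_numeral scaleR_2)
    then show "x \<in> cball 0 (d / 2)" using bspec[OF bspec[OF A'_diam x] neg[OF x]] by simp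
  qed
  then have "emeasure lborel A \<le> emeasure lborel (cball (0::'a) (d/2))"
    unfolding A'(2)[symmetric] by (rule emeasure_mono) simp
  then show ?thesis using d by (simp add: emeasure_cball)
qed

section \<open>Hausdorff measure of top dimension\<close>

text \<open>By the isodiametric inequality every covering set weighs at least as much as the volume
  of its closure. Closures are measurable and have the same diameter, whereas the covering sets
  themselves are arbitrary. The bound holds at every scale, so mesh 1 suffices.\<close>

lemma lborel_le_hausdorff_outer:
  fixes A :: "'a::euclidean_space set"
  assumes "A \<in> sets borel"
  shows "emeasure lborel A \<le> hausdorff_outer DIM('a) A"
proof -
  have "emeasure lborel A \<le> hausdorff_pre DIM('a) 1 A"
  proof (rule hausdorff_pre_geI)
    fix C :: "nat \<Rightarrow> 'a set"
    assume C: "A \<subseteq> (\<Union>i. C i)" "\<And>i. bounded (C i)"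
    have w: "emeasure lborel (closure (C i)) \<le> hausdorff_weight DIM('a) (C i)" for i
    proof (cases "C i = {}")
      case False
      have "emeasure lborel (closure (C i))
          \<le> ennreal (unit_ball_vol (real DIM('a)) * (diameter (C i) / 2) ^ DIM('a))"
      proof (rule isodiametric_inequality)
        fix x y assume "x \<in> closure (C i)" "y \<in> closure (C i)"
        then show "dist x y \<le> diameter (C i)"
          using diameter_bounded_bound[of "closure (C i)" x y] C(2)[of i]
          by (simp add: diameter_closure bounded_closure)
      qed (use C in \<open>auto intro: diameter_ge_0\<close>)
      then show ?thesis using False by (simp add: hausdorff_weight_def)
    qed simp
    have "A \<subseteq> (\<Union>i. closure (C i))" using C(1) closure_subset by blast
    then have "emeasure lborel A \<le> emeasure lborel (\<Union>i. closure (C i))"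
      by (rule emeasure_mono) (auto intro: borel_closed)
    also have "\<dots> \<le> (\<Sum>i. emeasure lborel (closure (C i)))"
      by (intro emeasure_subadditive_countably) auto
    also have "\<dots> \<le> (\<Sum>i. hausdorff_weight DIM('a) (C i))"
      by (intro suminf_le w) auto
    finally show "emeasure lborel A \<le> (\<Sum>i. hausdorff_weight DIM('a) (C i))" .
  qed
  also have "\<dots> \<le> hausdorff_outer DIM('a) A" by (rule hausdorff_pre_le_outer) simp
  finally show ?thesis .
qed

lemma hausdorff_weight_cball:
  assumes "0 < r"
  shows "hausdorff_weight DIM('a) (cball (a :: 'a::euclidean_space) r) = emeasure lborel (cball a r)"
  using assms by (simp add: hausdorff_weight_def emeasure_cball diameter_cball)

text \<open>Used with \<open>k = 5\<close> for the Vitali enlargement and with \<open>k = 1\<close>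
  for the balls themselves: the volumes of the disjoint balls sum to at most that of
  \<open>U\<close>, and enlarging them costs the factor \<open>k ^ DIM('a)\<close>.\<close>

lemma hausdorff_pre_UN_cball_le:
  fixes a :: "'i \<Rightarrow> 'a::euclidean_space"
  assumes C: "countable C" "\<And>i. i \<in> C \<Longrightarrow> 0 < r i" and k: "1 \<le> k" "0 < \<delta>"
    and disj: "pairwise (\<lambda>i j. disjnt (cball (a i) (r i)) (cball (a j) (r j))) C"
    and sub: "\<And>i. i \<in> C \<Longrightarrow> cball (a i) (r i) \<subseteq> U" and U: "open U"
    and small: "\<And>i. i \<in> C \<Longrightarrow> 2 * (k * r i) \<le> \<delta>"
  shows "hausdorff_pre DIM('a) \<delta> (\<Union>i\<in>C. cball (a i) (k * r i)) \<le> ennreal (k ^ DIM('a)) * emeasure lborel U"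
proof -
  \<comment> \<open>Covers are sequences, so a countable family is padded with empty sets of weight
    0. \<open>D k\<close> is the cover, \<open>D 1\<close> the disjoint family.\<close>
  define D where "D c n = (if n \<in> to_nat_on C ` C then
      cball (a (from_nat_into C n)) (c * r (from_nat_into C n)) else {})" for c :: real and n
  have D: "D c (to_nat_on C i) = cball (a i) (c * r i)" if "i \<in> C" for c i
    using that C(1) by (simp add: D_def)
  have Dcases: "D c n = {} \<or> (\<exists>i\<in>C. n = to_nat_on C i)" for c n
    by (auto simp: D_def)
  have w: "hausdorff_weight DIM('a) (D k n) = ennreal (k ^ DIM('a)) * emeasure lborel (D 1 n)" for n
  proof (cases "n \<in> to_nat_on C ` C")
    case True
    then obtain i where i: "i \<in> C" "n = to_nat_on C i" by auto
    have "hausdorff_weight DIM('a) (D k n) = emeasure lborel (cball (a i) (k * r i))"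
      using i k C(2)[of i] by (simp add: D hausdorff_weight_cball)
    also have "\<dots> = ennreal (k ^ DIM('a)) * emeasure lborel (cball (a i) (r i))"
      using i k C(2)[of i] by (simp add: emeasure_cball ennreal_mult'[symmetric] power_mult_distrib mult_ac less_imp_le)
    finally show ?thesis using i by (simp add: D)
  qed (simp add: D_def)
  have "hausdorff_pre DIM('a) \<delta> (\<Union>i\<in>C. cball (a i) (k * r i)) \<le> (\<Sum>n. hausdorff_weight DIM('a) (D k n))"
  proof (rule hausdorff_pre_leI[OF _ _ _ order_refl])
    show "(\<Union>i\<in>C. cball (a i) (k * r i)) \<subseteq> (\<Union>n. D k n)"
      using D by blast
    fix n show "bounded (D k n)" by (auto simp: D_def)
    show "diameter (D k n) \<le> \<delta>"
    proof (cases "n \<in> to_nat_on C ` C")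
      case True
      then obtain i where i: "i \<in> C" "n = to_nat_on C i" by auto
      then show ?thesis using small[of i] C(2)[of i] k by (simp add: D diameter_cball)
    qed (use k in \<open>simp add: D_def\<close>)
  qed
  also have "\<dots> = ennreal (k ^ DIM('a)) * (\<Sum>n. emeasure lborel (D 1 n))"
    unfolding w by simp
  also have "(\<Sum>n. emeasure lborel (D 1 n)) = emeasure lborel (\<Union>n. D 1 n)"
  proof (rule suminf_emeasure)
    show "disjoint_family (D 1)"
      unfolding disjoint_family_on_def
    proof (intro ballI impI)
      fix m n :: nat assume mn: "m \<noteq> n"
      show "D 1 m \<inter> D 1 n = {}"
      proof (cases "D 1 m = {} \<or> D 1 n = {}")
        case False
        then obtain i j where ij: "i \<in> C" "j \<in> C" "m = to_nat_on C i" "n = to_nat_on C j"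
          using Dcases by blast
        then have "i \<noteq> j" using mn by auto
        then show ?thesis using pairwiseD[OF disj ij(1,2)] ij by (simp add: D disjnt_def)
      qed auto
    qed
  qed (auto simp: D_def)
  also have "emeasure lborel (\<Union>n. D 1 n) \<le> emeasure lborel U"
  proof (rule emeasure_mono)
    show "(\<Union>n. D 1 n) \<subseteq> U" using Dcases[of 1] D[of _ 1] sub by fastforce
  qed (use U in auto)
  finally show ?thesis by (simp add: mult_left_mono)
qed

text \<open>A crude bound that avoids a circle: the sharp Vitali theorem leaves a Lebesgue null set
  uncovered, and the content of such a set must first be shown to vanish. For this the constant is
  harmless.\<close>

lemma hausdorff_pre_le_5_open:
  fixes U :: "'a::euclidean_space set"
  assumes U: "open U" and \<delta>: "0 < \<delta>"
  shows "hausdorff_pre DIM('a) \<delta> U \<le> ennreal (5 ^ DIM('a)) * emeasure lborel U"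
proof -
  \<comment> \<open>Radii up to \<open>\<delta> / 10\<close> keep the fivefold balls within diameter
    \<delta>.\<close>
  define K where "K = {(x, r). 0 < r \<and> r \<le> \<delta> / 10 \<and> cball x r \<subseteq> U}"
  obtain C where C: "countable C" "C \<subseteq> K"
    "pairwise (\<lambda>i j. disjnt (cball (fst i) (snd i)) (cball (fst j) (snd j))) C"
    "(\<Union>i\<in>K. cball (fst i) (snd i)) \<subseteq> (\<Union>i\<in>C. cball (fst i) (5 * snd i))"
  proof (rule Vitali_covering_lemma_cballs[where S="\<Union>i\<in>K. cball (fst i) (snd i)" and K=K and a=fst and r=snd and B="\<delta>/10"])
    show "0 < snd i \<and> snd i \<le> \<delta>/10" if "i \<in> K" for i using that by (auto simp: K_def)
  qed (rule order_refl)
  have CK: "0 < snd i" "snd i \<le> \<delta> / 10" "cball (fst i) (snd i) \<subseteq> U" if "i \<in> C" for i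
    using subsetD[OF C(2) that] by (auto simp: K_def)
  have "U \<subseteq> (\<Union>i\<in>K. cball (fst i) (snd i))"
  proof
    fix x assume "x \<in> U"
    then obtain e where e: "0 < e" "cball x e \<subseteq> U" using U open_contains_cball by blast
    have "(x, min e (\<delta>/10)) \<in> K" using e \<delta> by (auto simp: K_def)
    moreover have "x \<in> cball x (min e (\<delta>/10))" using e \<delta> by simp
    ultimately show "x \<in> (\<Union>i\<in>K. cball (fst i) (snd i))" by force
  qed
  then have "hausdorff_pre DIM('a) \<delta> U \<le> hausdorff_pre DIM('a) \<delta> (\<Union>i\<in>C. cball (fst i) (5 * snd i))"
    using C(4) by (intro hausdorff_pre_mono) blast
  also have "\<dots> \<le> ennreal (5 ^ DIM('a)) * emeasure lborel U"
    using CK by (intro hausdorff_pre_UN_cball_le[OF C(1) _ _ \<delta> C(3) _ U]) fastforce+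
  finally show ?thesis .
qed

lemma hausdorff_pre_negligible:
  fixes N :: "'a::euclidean_space set"
  assumes N: "negligible N" and \<delta>: "0 < \<delta>"
  shows "hausdorff_pre DIM('a) \<delta> N = 0"
proof -
  obtain N' where N': "N' \<in> null_sets lborel" "N \<subseteq> N'"
    using N unfolding negligible_iff_null_sets null_sets_completion_iff2 by auto
  have "hausdorff_pre DIM('a) \<delta> N \<le> 0 + ennreal e" if e: "0 < e" for e
  proof -
    have e': "0 < e / 5 ^ DIM('a)" using e by simp
    obtain U where U: "open U" "N' \<subseteq> U" "emeasure lborel (U - N') < ennreal (e / 5 ^ DIM('a))"
      using outer_regular_lborel[OF _ e', of N'] N' by (auto simp: null_sets_def)
    have "emeasure lborel U = emeasure lborel (U - N')"
      using U N' by (intro emeasure_Diff_null_set[symmetric]) auto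
    then have "emeasure lborel U \<le> ennreal (e / 5 ^ DIM('a))" using U by simp
    have "hausdorff_pre DIM('a) \<delta> N \<le> hausdorff_pre DIM('a) \<delta> U"
      using N' U by (intro hausdorff_pre_mono) auto
    also have "\<dots> \<le> ennreal (5 ^ DIM('a)) * emeasure lborel U"
      by (rule hausdorff_pre_le_5_open[OF U(1) \<delta>])
    also have "\<dots> \<le> ennreal (5 ^ DIM('a)) * ennreal (e / 5 ^ DIM('a))"
      by (intro mult_left_mono) (fact, simp)
    also have "\<dots> = ennreal e" using e by (simp add: ennreal_mult[symmetric])
    finally show ?thesis by simp
  qed
  then have "hausdorff_pre DIM('a) \<delta> N \<le> 0" by (rule ennreal_le_epsilon)
  then show ?thesis by simp
qed

text \<open>Disjoint small balls exhaust \<open>U\<close> up to a negligible set, and the weight of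
  a ball is exactly its volume.\<close>

lemma hausdorff_outer_le_open:
  fixes U :: "'a::euclidean_space set"
  assumes U: "open U"
  shows "hausdorff_outer DIM('a) U \<le> emeasure lborel U"
proof (rule hausdorff_outer_leI)
  fix \<delta> :: real assume \<delta>: "0 < \<delta>"
  define K where "K = {(x, r). 0 < r \<and> r \<le> \<delta> / 2 \<and> cball x r \<subseteq> U}"
  obtain C where C: "countable C" "C \<subseteq> K"
    "pairwise (\<lambda>i j. disjnt (cball (fst i) (snd i)) (cball (fst j) (snd j))) C"
    "negligible (U - (\<Union>i\<in>C. cball (fst i) (snd i)))"
  proof (rule Vitali_covering_theorem_cballs[where K=K and r=snd and S=U and a=fst])
    fix x d assume x: "x \<in> U" and d: "(0::real) < d"
    then obtain e where e: "0 < e" "cball x e \<subseteq> U" using U open_contains_cball by blast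
    have "(x, min e (min (\<delta>/2) (d/2))) \<in> K" using e \<delta> d by (auto simp: K_def)
    then show "\<exists>i. i \<in> K \<and> x \<in> cball (fst i) (snd i) \<and> snd i < d"
      using e \<delta> d by (intro exI[of _ "(x, min e (min (\<delta>/2) (d/2)))"]) auto
  next
    show "0 < snd i" if "i \<in> K" for i using that by (auto simp: K_def)
  qed
  have CK: "0 < snd i" "snd i \<le> \<delta> / 2" "cball (fst i) (snd i) \<subseteq> U" if "i \<in> C" for i
    using subsetD[OF C(2) that] by (auto simp: K_def)
  have "U \<subseteq> (\<Union>i\<in>C. cball (fst i) (1 * snd i)) \<union> (U - (\<Union>i\<in>C. cball (fst i) (snd i)))" by auto
  then have "hausdorff_pre DIM('a) \<delta> U \<le> hausdorff_pre DIM('a) \<delta> ((\<Union>i\<in>C. cball (fst i) (1 * snd i)) \<union> (U - (\<Union>i\<in>C. cball (fst i) (snd i))))"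
    by (rule hausdorff_pre_mono)
  also have "\<dots> \<le> hausdorff_pre DIM('a) \<delta> (\<Union>i\<in>C. cball (fst i) (1 * snd i)) + hausdorff_pre DIM('a) \<delta> (U - (\<Union>i\<in>C. cball (fst i) (snd i)))"
    by (rule hausdorff_pre_Un_le[OF \<delta>])
  also have "hausdorff_pre DIM('a) \<delta> (U - (\<Union>i\<in>C. cball (fst i) (snd i))) = 0"
    by (rule hausdorff_pre_negligible[OF C(4) \<delta>])
  also have "hausdorff_pre DIM('a) \<delta> (\<Union>i\<in>C. cball (fst i) (1 * snd i)) \<le> ennreal (1 ^ DIM('a)) * emeasure lborel U"
    using CK by (intro hausdorff_pre_UN_cball_le[OF C(1) _ _ \<delta> C(3) _ U]) fastforce+
  finally show "hausdorff_pre DIM('a) \<delta> U \<le> emeasure lborel U" by simp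
qed

theorem hausdorff_outer_eq_lborel:
  fixes A :: "'a::euclidean_space set"
  assumes A: "A \<in> sets borel"
  shows "hausdorff_outer DIM('a) A = emeasure lborel A"
proof (rule antisym)
  show "hausdorff_outer DIM('a) A \<le> emeasure lborel A"
  proof (rule ennreal_le_epsilon)
    fix e :: real assume e: "0 < e"
    obtain U where U: "open U" "A \<subseteq> U" "emeasure lborel (U - A) < ennreal e"
      using outer_regular_lborel[OF A e] by blast
    have "hausdorff_outer DIM('a) A \<le> hausdorff_outer DIM('a) U" by (rule hausdorff_outer_mono) fact
    also have "\<dots> \<le> emeasure lborel U" by (rule hausdorff_outer_le_open) fact
    also have "\<dots> = emeasure lborel (A \<union> (U - A))" using U by (simp add: Un_absorb1)
    also have "\<dots> \<le> emeasure lborel A + emeasure lborel (U - A)"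
      using A U by (intro emeasure_subadditive) auto
    also have "\<dots> \<le> emeasure lborel A + ennreal e" using U by (intro add_left_mono) auto
    finally show "hausdorff_outer DIM('a) A \<le> emeasure lborel A + ennreal e" .
  qed
qed (rule lborel_le_hausdorff_outer[OF A])

section \<open>Isometries, dilations and flat cones\<close>

lemma emeasure_lborel_isometry:
  fixes L :: "'a::euclidean_space \<Rightarrow> 'b::euclidean_space"
  assumes dim: "DIM('a) = DIM('b)" and L: "linear L" "\<And>x. norm (L x) = norm x"
    and A: "A \<in> sets borel" and LA: "L ` A \<in> sets borel"
  shows "emeasure lborel (L ` A) = emeasure lborel A"
proof -
  have d: "dist (L x) (L y) = dist x y" for x y
    by (metis L dist_norm linear_diff)
  then have inj: "inj L" by (metis dist_eq_0_iff injI)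
  \<comment> \<open>The Hausdorff outer measure depends on distances only, so it is transported
    between different Euclidean types; both \<open>L\<close> and its inverse on the image have
    Lipschitz constant 1.\<close>
  have "hausdorff_outer DIM('b) (L ` A) \<le> ennreal (1 ^ DIM('b)) * hausdorff_outer DIM('b) A"
    by (rule hausdorff_outer_Lipschitz_image) (auto simp: d)
  moreover have "hausdorff_outer DIM('b) (inv L ` L ` A) \<le> ennreal (1 ^ DIM('b)) * hausdorff_outer DIM('b) (L ` A)"
    by (rule hausdorff_outer_Lipschitz_image) (auto simp: d inj)
  moreover have "inv L ` L ` A = A" using inj by (simp add: image_inv_f_f)
  ultimately have "hausdorff_outer DIM('b) (L ` A) = hausdorff_outer DIM('a) A"
    by (simp add: dim)
  then show ?thesis by (simp add: hausdorff_outer_eq_lborel A LA)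
qed

lemma emeasure_lborel_scale:
  fixes A :: "'a::euclidean_space set"
  assumes A: "A \<in> sets borel" and c: "0 < c"
  shows "emeasure lborel {x. x /\<^sub>R c \<in> A} = ennreal (c ^ DIM('a)) * emeasure lborel A"
proof -
  have [measurable]: "A \<in> sets borel" by fact
  have m: "{x. x /\<^sub>R c \<in> A} \<in> sets borel"
    using measurable_sets[of "\<lambda>x. x /\<^sub>R c" "borel :: 'a measure" borel A] by (simp add: vimage_def)
  have "emeasure (lborel :: 'a measure) {x. x /\<^sub>R c \<in> A} =
    emeasure (density (distr lborel borel (\<lambda>x. 0 + c *\<^sub>R x)) (\<lambda>_. \<bar>c\<bar> ^ DIM('a))) {x. x /\<^sub>R c \<in> A}"
    using c by (subst lborel_affine[of c 0]) auto
  also have "\<dots> = ennreal (\<bar>c\<bar> ^ DIM('a)) * emeasure (distr lborel borel (\<lambda>x. 0 + c *\<^sub>R x)) {x. x /\<^sub>R c \<in> A}"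
    using m by (subst emeasure_density_const) (auto simp: ennreal_power)
  also have "emeasure (distr lborel borel (\<lambda>x. 0 + c *\<^sub>R x)) {x. x /\<^sub>R c \<in> A} = emeasure lborel A"
    using m c by (subst emeasure_distr) (auto simp: vimage_def)
  finally show ?thesis using c by simp
qed

text \<open>The cone has its apex at the origin and its base \<open>F\<close> at height
  \<open>h\<close>. Its slice at height \<open>t\<close> is \<open>F\<close> scaled by
  \<open>t / h\<close>, and integrating \<open>(t / h) ^ DIM('b)\<close> gives the factor.\<close>

lemma emeasure_lborel_flat_cone:
  fixes F :: "'b::euclidean_space set"
  assumes F: "F \<in> sets borel" and h: "0 < h"
  shows "emeasure lborel {(y :: 'b, t). 0 < t \<and> t \<le> h \<and> (h / t) *\<^sub>R y \<in> F} =
    ennreal (h / real (Suc DIM('b))) * emeasure lborel F"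
proof -
  let ?K = "{(y :: 'b, t). 0 < t \<and> t \<le> h \<and> (h / t) *\<^sub>R y \<in> F}"
  have [measurable]: "F \<in> sets borel" by fact
  have K: "?K \<in> sets (lborel \<Otimes>\<^sub>M lborel)"
  proof -
    have "Measurable.pred (lborel \<Otimes>\<^sub>M lborel) (\<lambda>(y :: 'b, t). 0 < t \<and> t \<le> h \<and> (h / t) *\<^sub>R y \<in> F)"
      by measurable
    then show ?thesis by (simp add: pred_def space_pair_measure)
  qed
  have sec: "emeasure lborel ((\<lambda>y. (y, t)) -` ?K) =
      ennreal ((t / h) ^ DIM('b)) * emeasure lborel F * indicator {0..h} t" if "t \<noteq> 0" for t
  proof (cases "0 < t \<and> t \<le> h")
    case True
    then have "(\<lambda>y. (y, t)) -` ?K = {y. y /\<^sub>R (t / h) \<in> F}" by auto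
    then show ?thesis using True h emeasure_lborel_scale[OF F, of "t/h"] by simp
  next
    case False
    then have "(\<lambda>y. (y, t)) -` ?K = {}" by auto
    then show ?thesis using False that by (auto simp: indicator_def)
  qed
  have "emeasure lborel ?K = emeasure (lborel \<Otimes>\<^sub>M lborel) ?K"
    by (subst lborel_prod) simp
  also have "\<dots> = (\<integral>\<^sup>+t. emeasure lborel ((\<lambda>y. (y, t)) -` ?K) \<partial>lborel)"
    by (rule lborel_pair.emeasure_pair_measure_alt2[OF K])
  also have "\<dots> = (\<integral>\<^sup>+t. (ennreal ((t / h) ^ DIM('b)) * indicator {0..h} t) * emeasure lborel F \<partial>lborel)"
    by (rule nn_integral_cong_AE, rule AE_mp[OF AE_lborel_singleton[of "0::real"]], intro AE_I2 impI)
       (subst sec, assumption, simp only: mult_ac)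
  also have "\<dots> = (\<integral>\<^sup>+t. ennreal ((t / h) ^ DIM('b)) * indicator {0..h} t \<partial>lborel) * emeasure lborel F"
    by (rule nn_integral_multc) measurable
  also have "(\<integral>\<^sup>+t. ennreal ((t / h) ^ DIM('b)) * indicator {0..h} t \<partial>lborel) =
      ennreal (h / real (Suc DIM('b)) * (h / h) ^ Suc DIM('b) - h / real (Suc DIM('b)) * (0 / h) ^ Suc DIM('b))"
  proof (rule nn_integral_FTC_Icc)
    fix t :: real
    have "((\<lambda>t. (t / h) ^ Suc DIM('b)) has_real_derivative (1 + real DIM('b)) * (1 / h * (t / h) ^ DIM('b))) (at t)"
      by (rule DERIV_power_Suc) (use h in \<open>auto intro!: derivative_eq_intros\<close>)
    from DERIV_cmult[OF this, of "h / real (Suc DIM('b))"]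
    show "((\<lambda>t. h / real (Suc DIM('b)) * (t / h) ^ Suc DIM('b)) has_real_derivative (t / h) ^ DIM('b)) (at t)"
      by (rule DERIV_cong) (use h in simp)
  qed (use h in auto)
  finally show ?thesis using h by simp
qed

text \<open>Orthonormal coordinates with \<open>u\<close> as the last axis. They carry the flat cone
  formula to cones over pieces of an arbitrary hyperplane.\<close>

lemma exists_isometry_prod:
  fixes u :: "'a::euclidean_space"
  assumes dim: "DIM('a) = Suc DIM('b::euclidean_space)" and u: "norm u = 1"
  obtains L :: "'b::euclidean_space \<times> real \<Rightarrow> 'a" where "linear L" "\<And>z. norm (L z) = norm z" "bij L"
    "\<And>y t. L (y, t) \<bullet> u = t"
proof -
  have d: "dim {x. u \<bullet> x = 0} = DIM('b)"
    using dim u by (subst dim_hyperplane) auto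
  obtain f :: "'b \<Rightarrow> 'a" where f: "linear f" "range f = {x. u \<bullet> x = 0}" "\<And>x. norm (f x) = norm x"
  proof (rule isometries_subspaces[of "UNIV :: 'b set" "{x. u \<bullet> x = 0}"])
    fix f :: "'b \<Rightarrow> 'a" and g
    assume *: "linear f" "range f = {x. u \<bullet> x = 0}" "\<And>x. x \<in> UNIV \<Longrightarrow> norm (f x) = norm x"
    show thesis using *(3) by (intro that[OF *(1,2)]) simp
  qed (simp_all add: subspace_hyperplane d)
  define L where "L z = f (fst z) + snd z *\<^sub>R u" for z
  have fu: "f y \<bullet> u = 0" for y using f(2) by (auto simp: inner_commute)
  have uu: "u \<bullet> u = 1" using u by (simp add: norm_eq_1)
  show ?thesis
  proof
    show lin: "linear L" unfolding L_def
      by (intro linearI) (simp_all add: linear_add[OF f(1)] linear_scale[OF f(1)] algebra_simps)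
    show n: "norm (L z) = norm z" for z
    proof -
      have "u \<bullet> f y = 0" for y using fu by (simp add: inner_commute)
      then have "L z \<bullet> L z = f (fst z) \<bullet> f (fst z) + (snd z)\<^sup>2"
        by (simp add: L_def inner_simps fu uu power2_eq_square)
      then have "(norm (L z))\<^sup>2 = (norm (f (fst z)))\<^sup>2 + (snd z)\<^sup>2"
        by (simp only: power2_norm_eq_inner)
      also have "\<dots> = (norm z)\<^sup>2" by (cases z) (simp add: f(3) norm_Pair)
      finally show ?thesis by simp
    qed
    show "L (y, t) \<bullet> u = t" for y t by (simp add: L_def inner_simps fu uu)
    have "inj L"
      using lin n by (metis linear_injective_0 norm_eq_zero)
    moreover have "surj L"
    proof
      show "UNIV \<subseteq> range L"
      proof
        fix x
        have "u \<bullet> (x - (x \<bullet> u) *\<^sub>R u) = 0" by (simp add: inner_simps uu inner_commute)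
        then obtain y where "f y = x - (x \<bullet> u) *\<^sub>R u" using f(2) by (metis (mono_tags, lifting) imageE mem_Collect_eq)
        then have "L (y, x \<bullet> u) = x" by (simp add: L_def)
        then show "x \<in> range L" by (metis rangeI)
      qed
    qed simp
    ultimately show "bij L" by (rule bijI)
  qed
qed

section \<open>Gauges and the area of their unit level\<close>

text \<open>The gradient is given axiomatically by Euler's identity and the subgradient inequality;
  both can be read off from a maximiser in a dual norm, and differentiability is then a consequence.
  Homogeneity is only positive, so \<open>N\<close> may be asymmetric.\<close>

locale smooth_gauge =
  fixes N :: "'a::euclidean_space \<Rightarrow> real" and g :: "'a \<Rightarrow> 'a"
  assumes Euler: "x \<noteq> 0 \<Longrightarrow> g x \<bullet> x = N x"
    and subgradient: "x \<noteq> 0 \<Longrightarrow> g x \<bullet> y \<le> N y"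
    and continuous_g: "continuous_on (UNIV - {0}) g"
    and pos: "x \<noteq> 0 \<Longrightarrow> 0 < N x"
    and scale: "0 \<le> t \<Longrightarrow> N (t *\<^sub>R x) = t * N x"
begin

lemma N_zero [simp]: "N 0 = 0"
  using scale[of 0 0] by simp

lemma nonneg: "0 \<le> N x"
  by (cases "x = 0") (auto dest: pos)

lemma N_eq_zero_iff [simp]: "N x = 0 \<longleftrightarrow> x = 0"
  by (metis N_zero less_irrefl pos)

lemma continuous_N_off_0: "continuous_on (UNIV - {0}) N"
proof -
  have "continuous_on (UNIV - {0}) (\<lambda>x. g x \<bullet> x)"
    by (intro continuous_intros continuous_g)
  then show ?thesis
    by (rule continuous_on_eq) (simp add: Euler)
qed

lemma bounds:
  obtains m M where "0 < m" "0 < M" "\<And>x. m * norm x \<le> N x" "\<And>x. N x \<le> M * norm x"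
proof -
  let ?S = "sphere (0::'a) 1"
  have ne: "?S \<noteq> {}" by simp
  have cont: "continuous_on ?S N"
    by (rule continuous_on_subset[OF continuous_N_off_0]) auto
  obtain a where a: "a \<in> ?S" "\<And>y. y \<in> ?S \<Longrightarrow> N a \<le> N y"
    using continuous_attains_inf[OF compact_sphere ne cont] by auto
  obtain b where b: "b \<in> ?S" "\<And>y. y \<in> ?S \<Longrightarrow> N y \<le> N b"
    using continuous_attains_sup[OF compact_sphere ne cont] by auto
  have sgn_eq: "N x = norm x * N (sgn x)" for x
  proof (cases "x = 0")
    case False
    then show ?thesis using scale[of "norm x" "sgn x"] by (simp add: sgn_div_norm)
  qed simp
  have "N a * norm x \<le> N x \<and> N x \<le> N b * norm x" for x
  proof (cases "x = 0")
    case False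
    then have "sgn x \<in> ?S" by (simp add: norm_sgn)
    then show ?thesis using a(2)[of "sgn x"] b(2)[of "sgn x"] False
      by (subst (1 2) sgn_eq) (simp add: mult.commute mult_left_mono)
  qed simp
  moreover have "0 < N a" "0 < N b" using a(1) b(1) by (auto intro!: pos)
  ultimately show ?thesis using that by blast
qed

lemma continuous_N: "continuous_on UNIV N"
proof -
  obtain m M where M: "0 < M" "\<And>x. N x \<le> M * norm x" by (rule bounds) blast
  have "isCont N x" for x
  proof (cases "x = 0")
    case False
    then show ?thesis
      using continuous_N_off_0 by (simp add: continuous_on_eq_continuous_at open_Diff)
  next
    case True
    have "(N \<longlongrightarrow> 0) (at 0)"
    proof (rule tendsto_sandwich[of "\<lambda>_. 0" _ _ "\<lambda>x. M * norm x"])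
      show "((\<lambda>x. M * norm x) \<longlongrightarrow> 0) (at 0)"
        by (auto intro!: tendsto_eq_intros)
    qed (auto simp: nonneg M)
    then show ?thesis using True by (simp add: isCont_def)
  qed
  then show ?thesis by (simp add: continuous_at_imp_continuous_on)
qed

lemma borel_measurable_N [measurable]: "N \<in> borel_measurable borel"
  using continuous_N by (rule borel_measurable_continuous_onI)

text \<open>The value \<open>g 0\<close> is arbitrary and is patched in as a single point.\<close>

lemma borel_measurable_g [measurable]: "g \<in> borel_measurable borel"
proof -
  have "(\<lambda>x. indicator (UNIV - {0}) x *\<^sub>R g x + indicator {0} x *\<^sub>R g 0) \<in> borel_measurable borel"
    by (intro borel_measurable_add borel_measurable_continuous_on_indicator continuous_g
        borel_measurable_scaleR) auto
  also have "(\<lambda>x. indicator (UNIV - {0}) x *\<^sub>R g x + indicator {0} x *\<^sub>R g 0) = g"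
    by (auto simp: indicator_def)
  finally show ?thesis .
qed

text \<open>The subgradient inequalities at \<open>x\<close> and at \<open>y\<close> squeeze the
  remainder between 0 and \<open>(g y - g x) \<bullet> (y - x)\<close>, so continuity of
  \<open>g\<close> finishes the argument.\<close>

lemma N_has_derivative:
  assumes x: "x \<noteq> 0"
  shows "(N has_derivative (\<lambda>h. g x \<bullet> h)) (at x)"
  unfolding has_derivative_at2
proof (intro conjI bounded_linear_inner_right)
  have "((\<lambda>y. norm (g y - g x)) \<longlongrightarrow> 0) (at x)"
  proof -
    have "isCont g x" using continuous_g x by (simp add: continuous_on_eq_continuous_at open_Diff)
    then have "((\<lambda>y. g y - g x) \<longlongrightarrow> 0) (at x)" by (simp add: isCont_def LIM_zero)
    then show ?thesis by (rule tendsto_norm_zero)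
  qed
  then show "((\<lambda>y. (1 / norm (y - x)) *\<^sub>R (N y - (N x + g x \<bullet> (y - x)))) \<longlongrightarrow> 0) (at x)"
  proof (rule Lim_null_comparison[rotated])
    have "\<forall>\<^sub>F y in at x. y \<in> UNIV - {0} - {x}"
      using x by (intro eventually_at_in_open) auto
    then show "\<forall>\<^sub>F y in at x. norm ((1 / norm (y - x)) *\<^sub>R (N y - (N x + g x \<bullet> (y - x)))) \<le> norm (g y - g x)"
    proof eventually_elim
      fix y assume y: "y \<in> UNIV - {0} - {x}"
      have 1: "0 \<le> N y - (N x + g x \<bullet> (y - x))"
        using subgradient[OF x, of y] Euler[OF x] by (simp add: inner_diff_right)
      have "N y - (N x + g x \<bullet> (y - x)) \<le> (g y - g x) \<bullet> (y - x)"
        using subgradient[of y x] Euler[of y] y by (simp add: inner_diff_right inner_diff_left)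
      also have "\<dots> \<le> norm (g y - g x) * norm (y - x)" by (rule norm_cauchy_schwarz)
      finally show "norm ((1 / norm (y - x)) *\<^sub>R (N y - (N x + g x \<bullet> (y - x)))) \<le> norm (g y - g x)"
        using 1 y by (simp add: divide_le_eq)
    qed
  qed
qed

lemma grad_N: "x \<noteq> 0 \<Longrightarrow> grad N x = g x"
  unfolding grad_def frechet_derivative_at[OF N_has_derivative, symmetric]
  by (rule euclidean_representation)

text \<open>The subgradient inequality is tested on \<open>y = g x\<close>.\<close>

lemma norm_g_le:
  assumes "\<And>x. N x \<le> M * norm x" "x \<noteq> 0"
  shows "norm (g x) \<le> M"
proof (cases "g x = 0")
  case True
  have "0 < M * norm x" using pos[OF assms(2)] assms(1)[of x] by linarith
  then show ?thesis using True by (simp add: zero_less_mult_iff)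
next
  case False
  have "norm (g x) * norm (g x) = g x \<bullet> g x" by (simp add: norm_eq_sqrt_inner)
  also have "\<dots> \<le> M * norm (g x)" using subgradient[OF assms(2)] assms(1) by (rule order_trans)
  finally show ?thesis using False by simp
qed

text \<open>For \<open>E\<close> in the unit level this is the union of the segments from the origin
  to \<open>E\<close>, without the origin. Its volume times \<open>DIM('a)\<close> is the cone
  measure, with which the weighted area is compared.\<close>

definition radial_cone :: "'a set \<Rightarrow> 'a set" where
  "radial_cone E = {z. z \<noteq> 0 \<and> N z \<le> 1 \<and> z /\<^sub>R N z \<in> E}"

lemma borel_radial_cone [measurable]:
  assumes [measurable]: "E \<in> sets borel"
  shows "radial_cone E \<in> sets borel"
  unfolding radial_cone_def by measurable

text \<open>The pieces \<open>E\<close> are those on which the gradient is almost constant. For \<open>x, x' \<in> E\<close> the subgradient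
  inequality at both points bounds the component of \<open>x - x'\<close> along \<open>g x0\<close>, without any mean value
  argument; hence the radial projection \<open>\<theta>\<close> of \<open>E\<close> to the tangent hyperplane is almost isometric.\<close>

lemma local_area_bounds:
  assumes dim: "DIM('a) = Suc DIM('b::euclidean_space)"
    and x0: "N x0 = 1" and \<eta>: "0 < \<eta>" "\<eta> < 1/2"
    and E [measurable]: "E \<in> sets borel" and E1: "\<And>x. x \<in> E \<Longrightarrow> N x = 1"
    and R: "\<And>x. N x = 1 \<Longrightarrow> norm x \<le> R"
    and near: "\<And>x. x \<in> E \<Longrightarrow> norm (g x - g x0) * R \<le> \<eta>"
  defines "\<Lambda> \<equiv> (1 / (1 - 2 * \<eta>)) ^ (2 * DIM('a))"
  shows "hausdorff_outer DIM('b) E \<le> ennreal (\<Lambda> * (real DIM('a) * norm (g x0))) * emeasure lborel (radial_cone E)"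
    and "ennreal (real DIM('a) * norm (g x0)) * emeasure lborel (radial_cone E) \<le> ennreal \<Lambda> * hausdorff_outer DIM('b) E"
proof -
  define g0 where "g0 = g x0"
  \<comment> \<open>Distance from the origin to the tangent hyperplane
    \<open>{z. z \<bullet> g0 = 1}\<close> at \<open>x0\<close>.\<close>
  define h where "h = 1 / norm g0"
  \<comment> \<open>One constant for both directions of the Lipschitz comparison: the estimates
    produce \<open>1 / (1 - \<eta>)\<^sup>2\<close> and
    \<open>(1 - \<eta>) / (1 - 2 * \<eta>)\<close>, and \<kappa> dominates both.\<close>
  define \<kappa> where "\<kappa> = 1 / (1 - 2 * \<eta>)"
  have \<kappa>: "1 \<le> \<kappa>" using \<eta> by (simp add: \<kappa>_def)
  have x0': "x0 \<noteq> 0" using x0 by auto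
  have "g0 \<noteq> 0" using Euler[OF x0'] x0 by (auto simp: g0_def)
  then have g0: "0 < norm g0" by simp
  then have h: "0 < h" by (simp add: h_def)
  obtain L :: "'b \<times> real \<Rightarrow> 'a" where L: "linear L" "\<And>z. norm (L z) = norm z" "bij L"
    and Lu: "\<And>y t. L (y, t) \<bullet> (g0 /\<^sub>R norm g0) = t"
    using exists_isometry_prod[OF dim, of "g0 /\<^sub>R norm g0"] g0 by auto
  have Lg0: "L (y, t) \<bullet> g0 = t / h" for y t
    using Lu[of y t] g0 by (simp add: h_def field_simps)
  have contL: "continuous_on X L" for X
    using L(1) by (rule linear_continuous_on[OF linear_conv_bounded_linear[THEN iffD1]])
  have [measurable]: "L \<in> borel_measurable borel"
    by (rule borel_measurable_continuous_onI[OF contL])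
  \<comment> \<open>\<open>P\<close> parametrizes the tangent hyperplane isometrically. Below,
    \<psi> projects it radially to the unit level, and \<open>F\<close> is the flat counterpart of
    \<open>E\<close>.\<close>
  define P where "P y = L (y, h)" for y
  have Pg0: "P y \<bullet> g0 = 1" for y using h by (simp add: P_def Lg0)
  then have P0: "P y \<noteq> 0" for y by (metis inner_zero_left zero_neq_one)
  have distP: "dist (P y) (P y') = dist y y'" for y y'
  proof -
    have "dist (P y) (P y') = norm (L (y - y', 0))"
      unfolding P_def dist_norm using linear_diff[OF L(1), of "(y, h)" "(y', h)"] by simp
    then show ?thesis by (simp add: L(2) norm_Pair dist_norm)
  qed
  have Pex: "\<exists>y. P y = z" if "z \<bullet> g0 = 1" for z
  proof -
    obtain y t where yt: "L (y, t) = z" using L(3) by (metis bij_pointE surj_pair)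
    then have "t = h" using that Lg0[of y t] h by simp
    then show ?thesis using yt by (auto simp: P_def)
  qed
  define \<psi> where "\<psi> y = P y /\<^sub>R N (P y)" for y
  define F where "F = {y. \<psi> y \<in> E}"
  have [measurable]: "P \<in> borel_measurable borel"
  proof (rule borel_measurable_continuous_onI)
    have "continuous_on UNIV (L \<circ> (\<lambda>y. (y, h)))"
      by (intro continuous_on_compose continuous_intros contL)
    then show "continuous_on UNIV P" by (simp add: P_def[abs_def] comp_def)
  qed
  have F: "F \<in> sets borel" unfolding F_def \<psi>_def by measurable
  \<comment> \<open>The inverse of \<psi> on \<open>E\<close>. The choice is meaningful where
    \<open>x \<bullet> g0 \<noteq> 0\<close>, which the next bounds ensure on
    \<open>E\<close>.\<close>
  define \<theta> where "\<theta> x = (SOME y. P y = x /\<^sub>R (x \<bullet> g0))" for x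
  have P\<theta>: "P (\<theta> x) = x /\<^sub>R (x \<bullet> g0)" if "x \<bullet> g0 \<noteq> 0" for x
    unfolding \<theta>_def by (rule someI_ex, rule Pex) (use that in simp)
  \<comment> \<open>\<open>E\<close> lies in a thin slab below the tangent hyperplane: the lower
    bound combines Euler's identity at \<open>x\<close> with the closeness of the gradients, the
    upper one is the subgradient inequality at \<open>x0\<close>.\<close>
  have a: "1 - \<eta> \<le> x \<bullet> g0" "x \<bullet> g0 \<le> 1" if "x \<in> E" for x
  proof -
    have x: "x \<noteq> 0" "N x = 1" using E1[OF that] by auto
    have "x \<bullet> (g x - g0) \<le> norm x * norm (g x - g0)" by (rule norm_cauchy_schwarz)
    also have "\<dots> \<le> R * norm (g x - g0)" using R[OF x(2)] by (intro mult_right_mono) auto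
    also have "\<dots> \<le> \<eta>" using near[OF that] by (simp add: g0_def mult.commute)
    finally show "1 - \<eta> \<le> x \<bullet> g0" using Euler[OF x(1)] x by (simp add: inner_diff_right inner_commute)
    show "x \<bullet> g0 \<le> 1" using subgradient[OF x0', of x] x by (simp add: g0_def inner_commute)
  qed
  have a0: "0 < x \<bullet> g0" if "x \<in> E" for x using a(1)[OF that] \<eta> by linarith
  have \<psi>\<theta>: "\<psi> (\<theta> x) = x" if "x \<in> E" for x
    using that a0[OF that] E1[OF that] scale[of "inverse (x \<bullet> g0)" x] P\<theta>[of x]
    by (simp add: \<psi>_def)
  have \<theta>\<psi>: "\<theta> (\<psi> y) = y" for y
  proof -
    have "\<psi> y \<bullet> g0 = inverse (N (P y))" by (simp add: \<psi>_def Pg0)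
    then have "P (\<theta> (\<psi> y)) = P y" using P\<theta>[of "\<psi> y"] P0[of y] by (simp add: \<psi>_def)
    then show ?thesis using distP by (metis dist_eq_0_iff)
  qed
  have \<psi>F: "\<psi> ` F = E"
  proof
    show "E \<subseteq> \<psi> ` F"
    proof
      fix x assume x: "x \<in> E"
      then have "\<theta> x \<in> F" by (simp add: F_def \<psi>\<theta>)
      then have "\<psi> (\<theta> x) \<in> \<psi> ` F" by (rule imageI)
      then show "x \<in> \<psi> ` F" using x by (simp add: \<psi>\<theta>)
    qed
  qed (auto simp: F_def)
  have \<theta>E: "\<theta> ` E = F"
    unfolding \<psi>F[symmetric] image_image \<theta>\<psi> by simp
  have diff: "\<bar>x \<bullet> g0 - x' \<bullet> g0\<bar> * norm x' \<le> \<eta> * dist x x'" if "x \<in> E" "x' \<in> E" for x x'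
  proof -
    have *: "x \<bullet> g0 - x' \<bullet> g0 \<le> norm (g x' - g0) * dist x x'" if "x \<in> E" "x' \<in> E" for x x'
    proof -
      have "N x = 1" "N x' = 1" using E1 that by auto
      moreover from this have "x' \<noteq> 0" by auto
      ultimately have "g x' \<bullet> (x - x') \<le> 0"
        using subgradient[of x' x] Euler[of x'] by (simp add: inner_diff_right)
      then have "x \<bullet> g0 - x' \<bullet> g0 \<le> (g0 - g x') \<bullet> (x - x')"
        by (simp add: inner_diff_left inner_diff_right inner_commute)
      also have "\<dots> \<le> norm (g0 - g x') * norm (x - x')" by (rule norm_cauchy_schwarz)
      finally show ?thesis by (simp add: dist_norm norm_minus_commute)
    qed
    have R': "norm (g y - g0) * norm z \<le> \<eta>" if "y \<in> E" "z \<in> E" for y z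
    proof -
      have "norm (g y - g0) * norm z \<le> norm (g y - g0) * R"
        using R E1 that by (intro mult_left_mono) auto
      then show ?thesis using near[OF that(1)] by (simp add: g0_def)
    qed
    have "\<bar>x \<bullet> g0 - x' \<bullet> g0\<bar> \<le> max (norm (g x - g0)) (norm (g x' - g0)) * dist x x'"
    proof -
      have "norm (g x' - g0) * dist x x' \<le> max (norm (g x - g0)) (norm (g x' - g0)) * dist x x'"
        "norm (g x - g0) * dist x x' \<le> max (norm (g x - g0)) (norm (g x' - g0)) * dist x x'"
        by (intro mult_right_mono; simp)+
      then show ?thesis using *[OF that] *[OF that(2,1)] by (simp add: dist_commute)
    qed
    then have "\<bar>x \<bullet> g0 - x' \<bullet> g0\<bar> * norm x' \<le> (max (norm (g x - g0)) (norm (g x' - g0)) * dist x x') * norm x'"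
      by (rule mult_right_mono) simp
    also have "\<dots> = (max (norm (g x - g0)) (norm (g x' - g0)) * norm x') * dist x x'" by simp
    also have "\<dots> \<le> \<eta> * dist x x'"
      using R'[OF that(1,2)] R'[OF that(2,2)] by (intro mult_right_mono) (auto simp: max_def)
    finally show ?thesis .
  qed
  have lip: "dist (\<theta> x) (\<theta> x') \<le> \<kappa> * dist x x' \<and> dist x x' \<le> \<kappa> * dist (\<theta> x) (\<theta> x')"
    if xx: "x \<in> E" "x' \<in> E" for x x'
  proof -
    define b b' D Q where "b = x \<bullet> g0" and "b' = x' \<bullet> g0" and "D = dist x x'" and "Q = dist (\<theta> x) (\<theta> x')"
    have b: "0 < b" "1 - \<eta> \<le> b" "b \<le> 1" and b': "0 < b'" "1 - \<eta> \<le> b'" "b' \<le> 1"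
      using a a0 xx by (auto simp: b_def b'_def)
    have D0: "0 \<le> D" "0 \<le> Q" by (simp_all add: D_def Q_def)
    have Q: "Q = norm (x /\<^sub>R b - x' /\<^sub>R b')"
      using b b' P\<theta>[of x] P\<theta>[of x'] distP[of "\<theta> x" "\<theta> x'"]
      by (simp add: Q_def b_def b'_def dist_norm)
    \<comment> \<open>Both comparisons of \<open>D\<close> with \<open>Q\<close> split off the part
      caused by the different heights \<open>b\<close> and \<open>b'\<close>; this bound makes that
      part a small multiple of \<open>D\<close>.\<close>
    have df: "\<bar>b - b'\<bar> * norm x' \<le> \<eta> * D"
      using diff[OF xx] by (simp add: b_def b'_def D_def)
    have "x /\<^sub>R b - x' /\<^sub>R b' = (x - x') /\<^sub>R b + ((b' - b) / (b * b')) *\<^sub>R x'"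
    proof -
      have eq: "(b' - b) / (b * b') = inverse b - inverse b'" using b b' by (simp add: field_simps)
      show ?thesis unfolding eq by (simp add: algebra_simps)
    qed
    then have "Q \<le> norm ((x - x') /\<^sub>R b) + norm (((b' - b) / (b * b')) *\<^sub>R x')"
      unfolding Q by (metis norm_triangle_ineq)
    also have "\<dots> = D / b + (\<bar>b - b'\<bar> * norm x') / (b * b')"
      using b b' by (simp add: D_def dist_norm abs_minus_commute divide_inverse abs_mult)
    also have "\<dots> \<le> D / (1 - \<eta>) + (\<eta> * D) / ((1 - \<eta>) * (1 - \<eta>))"
    proof (intro add_mono frac_le df)
      show "(1 - \<eta>) * (1 - \<eta>) \<le> b * b'" using b b' \<eta> by (intro mult_mono) auto
    qed (use b b' \<eta> D0 in auto)
    also have "\<dots> = D / ((1 - \<eta>) * (1 - \<eta>))"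
    proof -
      have "D / q + (1 - q) * D / (q * q) = D / (q * q)" if "0 < q" for q
        using that by (simp add: field_simps)
      from this[of "1 - \<eta>"] show ?thesis using \<eta> by simp
    qed
    also have "\<dots> \<le> D / (1 - 2 * \<eta>)"
    proof -
      have "1 - 2 * \<eta> \<le> (1 - \<eta>) * (1 - \<eta>)"
        using zero_le_square[of \<eta>] by (simp add: algebra_simps)
      then show ?thesis using D0 \<eta> by (intro frac_le) auto
    qed
    finally have 1: "Q \<le> \<kappa> * D" by (simp add: \<kappa>_def)
    have "x - x' = b *\<^sub>R (x /\<^sub>R b - x' /\<^sub>R b') + ((b - b') / b') *\<^sub>R x'"
    proof -
      have eq: "(b - b') / b' = b * inverse b' - 1" using b' by (simp add: field_simps)
      show ?thesis unfolding eq using b by (simp add: algebra_simps)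
    qed
    then have "D \<le> norm (b *\<^sub>R (x /\<^sub>R b - x' /\<^sub>R b')) + norm (((b - b') / b') *\<^sub>R x')"
      unfolding D_def dist_norm by (metis norm_triangle_ineq)
    also have "\<dots> = b * Q + (\<bar>b - b'\<bar> * norm x') / b'"
      using b b' by (simp add: Q abs_divide)
    also have "\<dots> \<le> 1 * Q + (\<eta> * D) / (1 - \<eta>)"
      using b b' \<eta> D0 by (intro add_mono frac_le df mult_right_mono) auto
    finally have "D * (1 - \<eta>) \<le> Q * (1 - \<eta>) + \<eta> * D" using \<eta> by (simp add: field_simps)
    then have "D * (1 - 2 * \<eta>) \<le> Q * (1 - \<eta>)" by (simp add: algebra_simps)
    also have "\<dots> \<le> Q * 1" using D0 \<eta> by (intro mult_left_mono) auto
    finally have 2: "D \<le> \<kappa> * Q" using \<eta> by (simp add: \<kappa>_def field_simps)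
    show ?thesis using 1 2 by (simp add: D_def Q_def)
  qed
  let ?H = "hausdorff_outer DIM('b)" and ?F = "emeasure lborel F" and ?V = "emeasure lborel (radial_cone E)"
  have HF: "?H F = ?F" by (rule hausdorff_outer_eq_lborel[OF F])
  have HE: "?H E \<le> ennreal (\<kappa> ^ DIM('b)) * ?F"
  proof -
    have "?H (\<psi> ` F) \<le> ennreal (\<kappa> ^ DIM('b)) * ?H F"
    proof (rule hausdorff_outer_Lipschitz_image)
      fix y y' assume "y \<in> F" "y' \<in> F"
      then have "\<psi> y \<in> E" "\<psi> y' \<in> E" by (auto simp: F_def)
      from lip[OF this] show "dist (\<psi> y) (\<psi> y') \<le> \<kappa> * dist y y'" by (simp add: \<theta>\<psi>)
    qed (use \<kappa> in simp)
    then show ?thesis by (simp add: \<psi>F HF)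
  qed
  have FH: "?F \<le> ennreal (\<kappa> ^ DIM('b)) * ?H E"
  proof -
    have "?H (\<theta> ` E) \<le> ennreal (\<kappa> ^ DIM('b)) * ?H E"
      by (rule hausdorff_outer_Lipschitz_image) (use \<kappa> lip in auto)
    then show ?thesis by (simp add: \<theta>E HF)
  qed
  \<comment> \<open>The same rays as in \<open>radial_cone E\<close>, but cut off by the tangent
    hyperplane instead of the unit level; hence an isometric copy of a flat cone.\<close>
  define Z where "Z = {z. 0 < z \<bullet> g0 \<and> z \<bullet> g0 \<le> 1 \<and> z /\<^sub>R N z \<in> E}"
  have Z [measurable]: "Z \<in> sets borel" unfolding Z_def by measurable
  let ?K = "{(y :: 'b, t). 0 < t \<and> t \<le> h \<and> (h / t) *\<^sub>R y \<in> F}"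
  have K: "?K = L -` Z"
  proof (intro set_eqI)
    fix v :: "'b \<times> real"
    obtain y t where v: "v = (y, t)" by (cases v)
    have "(h / t) *\<^sub>R y \<in> F \<longleftrightarrow> L v /\<^sub>R N (L v) \<in> E" if t: "0 < t"
    proof -
      have "P ((h / t) *\<^sub>R y) = (h / t) *\<^sub>R L v"
        using linear_scale[OF L(1), of "h/t" v] t by (simp add: P_def v)
      then have "\<psi> ((h / t) *\<^sub>R y) = L v /\<^sub>R N (L v)"
        using scale[of "h/t" "L v"] t h by (simp add: \<psi>_def inverse_eq_divide)
      then show ?thesis by (simp add: F_def)
    qed
    moreover have "0 < L v \<bullet> g0 \<longleftrightarrow> 0 < t" "L v \<bullet> g0 \<le> 1 \<longleftrightarrow> t \<le> h"
      using h by (simp_all add: v Lg0 zero_less_divide_iff)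
    ultimately show "v \<in> ?K \<longleftrightarrow> v \<in> L -` Z"
      by (auto simp: Z_def v)
  qed
  have LK: "L ` ?K = Z" unfolding K using L(3) by (simp add: bij_is_surj surj_image_vimage_eq)
  have Kb: "?K \<in> sets borel" unfolding K using measurable_sets[of L borel borel Z] by simp
  have eZ: "emeasure lborel Z = ennreal (h / real DIM('a)) * ?F"
    using emeasure_lborel_isometry[of L ?K] L dim Kb Z emeasure_lborel_flat_cone[OF F h]
    by (simp add: LK)
  have zc: "z \<bullet> g0 = N z * ((z /\<^sub>R N z) \<bullet> g0)" if "z \<noteq> 0" for z using that by simp
  have "radial_cone E \<subseteq> Z"
  proof
    fix z assume "z \<in> radial_cone E"
    then have z: "z \<noteq> 0" "N z \<le> 1" "z /\<^sub>R N z \<in> E" by (auto simp: radial_cone_def)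
    have "N z * ((z /\<^sub>R N z) \<bullet> g0) \<le> 1 * 1"
      using z a[OF z(3)] a0[OF z(3)] pos[of z] by (intro mult_mono) auto
    moreover have "0 < N z * ((z /\<^sub>R N z) \<bullet> g0)"
      using z a0[OF z(3)] pos[of z] by (intro mult_pos_pos) auto
    ultimately have "0 < z \<bullet> g0" "z \<bullet> g0 \<le> 1" by (simp_all only: zc[OF z(1), symmetric] mult_1)
    then show "z \<in> Z" using z by (simp add: Z_def)
  qed
  then have VZ: "?V \<le> ennreal (h / real DIM('a)) * ?F"
    unfolding eZ[symmetric] by (rule emeasure_mono) simp
  \<comment> \<open>On \<open>Z\<close> the gauge is at most \<open>1 / (1 - \<eta>)\<close>, so
    shrinking by \<kappa> moves the flat cone into the curved one.\<close>
  have "Z \<subseteq> {z. z /\<^sub>R \<kappa> \<in> radial_cone E}"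
  proof
    fix z assume "z \<in> Z"
    then have z: "0 < z \<bullet> g0" "z \<bullet> g0 \<le> 1" "z /\<^sub>R N z \<in> E" by (auto simp: Z_def)
    then have z0: "z \<noteq> 0" by auto
    have "N z * (1 - \<eta>) \<le> N z * ((z /\<^sub>R N z) \<bullet> g0)"
      using a[OF z(3)] nonneg by (intro mult_left_mono) auto
    then have "N z * (1 - \<eta>) \<le> z \<bullet> g0" by (simp only: zc[OF z0, symmetric])
    then have "N z * (1 - \<eta>) \<le> 1" using z(2) by linarith
    moreover have "N z * (1 - 2 * \<eta>) \<le> N z * (1 - \<eta>)" using nonneg \<eta> by (intro mult_left_mono) auto
    ultimately have "N z * (1 - 2 * \<eta>) \<le> 1" by linarith
    then have "inverse \<kappa> * N z \<le> 1" using \<eta> by (simp add: \<kappa>_def mult.commute)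
    moreover have N\<kappa>: "N (z /\<^sub>R \<kappa>) = inverse \<kappa> * N z"
      using \<kappa> by (intro scale) simp
    moreover have "(z /\<^sub>R \<kappa>) /\<^sub>R N (z /\<^sub>R \<kappa>) = z /\<^sub>R N z"
    proof -
      have "inverse (inverse \<kappa> * N z) * inverse \<kappa> = inverse (N z)" using \<kappa> by simp
      then show ?thesis unfolding N\<kappa> by (simp only: scaleR_scaleR)
    qed
    moreover have "z /\<^sub>R \<kappa> \<noteq> 0" using z0 \<kappa> by simp
    ultimately show "z \<in> {z. z /\<^sub>R \<kappa> \<in> radial_cone E}"
      using z(3) unfolding radial_cone_def mem_Collect_eq by metis
  qed
  then have "emeasure lborel Z \<le> emeasure lborel {z. z /\<^sub>R \<kappa> \<in> radial_cone E}"
    by (rule emeasure_mono) simp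
  also have "\<dots> = ennreal (\<kappa> ^ DIM('a)) * ?V"
    by (rule emeasure_lborel_scale) (use \<kappa> in auto)
  finally have ZV: "ennreal (h / real DIM('a)) * ?F \<le> ennreal (\<kappa> ^ DIM('a)) * ?V"
    by (simp add: eZ)
  let ?c = "real DIM('a) * norm g0"
  have c: "0 < ?c" "?c * (h / real DIM('a)) = 1" using g0 by (auto simp: h_def)
  then have cF: "ennreal ?c * (ennreal (h / real DIM('a)) * ?F) = ?F"
    using h by (simp add: mult.assoc[symmetric] ennreal_mult'[symmetric])
  \<comment> \<open>The Lipschitz comparison contributes \<open>DIM('b)\<close> factors \<kappa> and
    the shrinking of the cone \<open>DIM('a)\<close>; the exponent \<open>2 * DIM('a)\<close>
    absorbs both.\<close>
  have \<Lambda>: "\<kappa> ^ DIM('b) * \<kappa> ^ DIM('a) \<le> \<Lambda>" "\<kappa> ^ DIM('b) \<le> \<Lambda>" "0 \<le> \<Lambda>"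
  proof -
    have \<Lambda>: "\<Lambda> = \<kappa> ^ (2 * DIM('a))" by (simp only: \<Lambda>_def \<kappa>_def)
    show "\<kappa> ^ DIM('b) * \<kappa> ^ DIM('a) \<le> \<Lambda>" "\<kappa> ^ DIM('b) \<le> \<Lambda>"
      unfolding \<Lambda> power_add[symmetric] using \<kappa> dim by (auto intro!: power_increasing simp del: power_Suc)
    show "0 \<le> \<Lambda>" unfolding \<Lambda> using \<kappa> by simp
  qed
  have "?H E \<le> ennreal (\<kappa> ^ DIM('b)) * (ennreal ?c * (ennreal (\<kappa> ^ DIM('a)) * ?V))"
    using order_trans[OF HE mult_left_mono[OF order_trans[OF eq_refl[OF cF[symmetric]] mult_left_mono[OF ZV]]]]
    by simp
  also have "\<dots> = ennreal (\<kappa> ^ DIM('b) * \<kappa> ^ DIM('a) * ?c) * ?V"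
    using c \<kappa> by (simp add: ennreal_mult mult_ac)
  also have "\<dots> \<le> ennreal (\<Lambda> * ?c) * ?V"
    using c \<Lambda> by (intro mult_right_mono ennreal_leI mult_right_mono) auto
  finally show "?H E \<le> ennreal (\<Lambda> * (real DIM('a) * norm (g x0))) * ?V" by (simp add: g0_def)
  have "ennreal ?c * ?V \<le> ?F"
    using mult_left_mono[OF VZ, of "ennreal ?c"] by (simp add: cF)
  also note FH
  also have "ennreal (\<kappa> ^ DIM('b)) * ?H E \<le> ennreal \<Lambda> * ?H E"
    using \<Lambda> by (intro mult_right_mono ennreal_leI) auto
  finally show "ennreal (real DIM('a) * norm (g x0)) * ?V \<le> ennreal \<Lambda> * ?H E" by (simp add: g0_def)
qed

end

text \<open>An index type with one element less than \<open>'n\<close>, so that \<open>real ^ 'n minus1\<close> parametrizes the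
  hyperplanes of \<open>real ^ 'n\<close>. For a one-element \<open>'n\<close>, where the type would be empty, it is junk.\<close>

typedef 'n minus1 = "if CARD('n) = 1 then UNIV else UNIV - {SOME x :: 'n. True}"
proof (cases "CARD('n) = 1")
  case False
  have "UNIV \<noteq> {SOME x :: 'n. True}"
  proof
    assume "UNIV = {SOME x :: 'n. True}"
    then have "CARD('n) = card {SOME x :: 'n. True}" by simp
    then show False using False by simp
  qed
  then show ?thesis using False by auto
qed simp

instance minus1 :: (finite) finite
proof
  have "finite (range (Rep_minus1 :: 'a minus1 \<Rightarrow> 'a))" by (rule finite)
  then show "finite (UNIV :: 'a minus1 set)"
    by (rule finite_imageD) (simp add: inj_on_def Rep_minus1_inject)
qed

lemma card_minus1:
  assumes "CARD('n::finite) \<noteq> 1"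
  shows "CARD('n) = Suc CARD('n minus1)"
proof -
  have "CARD('n minus1) = card (UNIV - {SOME x :: 'n. True})"
    using type_definition.card[OF type_definition_minus1[where 'n='n]] assms by simp
  also have "\<dots> = CARD('n) - 1" by (subst card_Diff_singleton) auto
  finally show ?thesis using zero_less_card_finite[where 'a='n] by linarith
qed

section \<open>Area of the whole unit level\<close>

context smooth_gauge
begin

lemma compact_level: "compact {x. N x = 1}"
proof -
  obtain m M where m: "0 < m" "\<And>x. m * norm x \<le> N x" by (rule bounds) blast
  have "closed (N -` {1})" using continuous_N by (intro closed_vimage) auto
  moreover have "bounded {x. N x = 1}"
  proof (rule boundedI)
    fix x assume "x \<in> {x. N x = 1}"
    then show "norm x \<le> 1 / m" using m(1) m(2)[of x] by (simp add: field_simps)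
  qed
  ultimately show ?thesis by (simp add: compact_eq_bounded_closed vimage_def)
qed

text \<open>Compactness of the set of gradients gives finitely many pieces with nearly constant
  gradient. The density \<open>1 / norm (g x)\<close> cancels the factor \<open>norm (g c)\<close>
  of the local bounds up to one further factor \<open>1 / (1 - 2 * \<eta>)\<close>; this accounts
  for the \<open>Suc\<close> in the exponent.\<close>

lemma area_comparison:
  assumes dim: "DIM('a) = Suc DIM('b::euclidean_space)" and \<eta>: "0 < \<eta>" "\<eta> < 1/2"
  defines "\<Lambda> \<equiv> (1 / (1 - 2 * \<eta>)) ^ Suc (2 * DIM('a))"
  defines "\<mu> \<equiv> \<lambda>E. ennreal (real DIM('a)) * emeasure lborel (radial_cone E)"
  defines "\<nu> \<equiv> \<lambda>E. \<integral>\<^sup>+x. ennreal (1 / norm (g x)) * indicator E x \<partial>hausdorff DIM('b)"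
  shows "\<mu> {x. N x = 1} \<le> ennreal \<Lambda> * \<nu> {x. N x = 1}" "\<nu> {x. N x = 1} \<le> ennreal \<Lambda> * \<mu> {x. N x = 1}"
proof -
  let ?S = "{x. N x = 1}"
  have S [measurable]: "?S \<in> sets borel" using compact_level by (simp add: borel_compact)
  obtain R0 where "\<forall>x\<in>?S. norm x \<le> R0"
    using compact_imp_bounded[OF compact_level] bounded_iff by blast
  then have R0: "norm x \<le> R0" if "N x = 1" for x using that by auto
  define R where "R = max R0 1"
  have R: "norm x \<le> R" if "N x = 1" for x using R0[OF that] by (simp add: R_def)
  have Rpos: "0 < R" by (simp add: R_def)
  \<comment> \<open>This lower bound on the gradient converts the absolute closeness on a piece into
    the relative one needed in \<open>cmp\<close>.\<close>
  have ginv: "1 \<le> norm (g x) * R" if "N x = 1" for x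
  proof -
    have x: "x \<noteq> 0" using that by auto
    have "1 = g x \<bullet> x" using Euler[OF x] that by simp
    also have "\<dots> \<le> norm (g x) * norm x" by (rule norm_cauchy_schwarz)
    also have "\<dots> \<le> norm (g x) * R" using R[OF that] by (intro mult_left_mono) auto
    finally show ?thesis .
  qed
  have gpos: "0 < norm (g x)" if "N x = 1" for x using ginv[OF that] by (metis less_eq_real_def mult_zero_left norm_ge_zero not_one_le_zero)
  let ?k = "1 / (1 - 2 * \<eta>)"
  have k: "1 + \<eta> \<le> ?k" "1 \<le> ?k" using \<eta> by (simp_all add: field_simps)
  define piece where "piece c = {x. norm (g x - g c) * R < \<eta>}" for c
  have piece [measurable]: "piece c \<in> sets borel" for c
    unfolding piece_def by measurable
  have cpt: "compact (g ` ?S)"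
    by (rule compact_continuous_image[OF continuous_on_subset[OF continuous_g] compact_level]) auto
  have sub: "g ` ?S \<subseteq> (\<Union>c\<in>?S. ball (g c) (\<eta> / R))" using \<eta> Rpos by force
  obtain F where F: "F \<subseteq> ?S" "finite F" "g ` ?S \<subseteq> (\<Union>c\<in>F. ball (g c) (\<eta> / R))"
    by (rule compactE_image[OF cpt _ sub], simp, rule that)
  have cover: "?S \<subseteq> (\<Union>c\<in>F. piece c)"
  proof
    fix x assume "x \<in> ?S"
    then obtain c where "c \<in> F" "dist (g c) (g x) < \<eta> / R" using F(3) by fastforce
    then have "x \<in> piece c" using Rpos
      by (simp add: piece_def dist_norm norm_minus_commute pos_less_divide_eq)
    then show "x \<in> (\<Union>c\<in>F. piece c)" using \<open>c \<in> F\<close> by auto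
  qed
  have \<mu>_Un: "\<mu> (A \<union> B) = \<mu> A + \<mu> B" if "A \<inter> B = {}" "A \<in> sets borel" "B \<in> sets borel" for A B
  proof -
    have "radial_cone (A \<union> B) = radial_cone A \<union> radial_cone B" "radial_cone A \<inter> radial_cone B = {}"
      using that(1) by (auto simp: radial_cone_def)
    then show ?thesis using that
      by (simp add: \<mu>_def plus_emeasure[symmetric] distrib_left)
  qed
  have \<nu>_Un: "\<nu> (A \<union> B) = \<nu> A + \<nu> B" if "A \<inter> B = {}" "A \<in> sets borel" "B \<in> sets borel" for A B
  proof -
    have [measurable]: "A \<in> sets borel" "B \<in> sets borel" by fact+
    have "\<nu> (A \<union> B) = (\<integral>\<^sup>+x. ennreal (1 / norm (g x)) * indicator A x + ennreal (1 / norm (g x)) * indicator B x \<partial>hausdorff DIM('b))"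
      unfolding \<nu>_def using that(1) by (intro nn_integral_cong) (auto simp: indicator_def)
    also have "\<dots> = \<nu> A + \<nu> B" unfolding \<nu>_def by (rule nn_integral_add) measurable
    finally show ?thesis .
  qed
  have loc: "\<mu> E \<le> ennreal \<Lambda> * \<nu> E \<and> \<nu> E \<le> ennreal \<Lambda> * \<mu> E"
    if c: "N c = 1" and E [measurable]: "E \<in> sets borel" and ES: "E \<subseteq> ?S" "E \<subseteq> piece c" for c E
  proof -
    let ?G = "norm (g c)" and ?H = "hausdorff_outer DIM('b) E" and ?V = "emeasure lborel (radial_cone E)"
    let ?L = "?k ^ (2 * DIM('a))"
    have near: "norm (g x - g c) * R \<le> \<eta>" if "x \<in> E" for x
      using ES(2) that by (auto simp: piece_def less_imp_le)
    have bounds1: "?H \<le> ennreal (?L * (real DIM('a) * ?G)) * ?V"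
      and bounds2: "ennreal (real DIM('a) * ?G) * ?V \<le> ennreal ?L * ?H"
      using local_area_bounds[OF dim c \<eta> E _ R near] ES(1) by auto
    have G: "0 < ?G" by (rule gpos[OF c])
    have cmp: "norm (g x) \<le> ?k * ?G" "?G \<le> ?k * norm (g x)" if "x \<in> E" for x
    proof -
      have x1: "N x = 1" using ES that by auto
      have "norm (g x - g c) * R \<le> \<eta> * (?G * R)"
        using near[OF that] mult_left_mono[OF ginv[OF c], of \<eta>] \<eta> by linarith
      then have a: "norm (g x - g c) \<le> \<eta> * ?G" using Rpos by simp
      have "norm (g x - g c) * R \<le> \<eta> * (norm (g x) * R)"
        using near[OF that] mult_left_mono[OF ginv[OF x1], of \<eta>] \<eta> by linarith
      then have b: "norm (g x - g c) \<le> \<eta> * norm (g x)" using Rpos by simp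
      have "norm (g x) \<le> (1 + \<eta>) * ?G"
        using norm_triangle_sub[of "g x" "g c"] a by (simp add: algebra_simps)
      also have "\<dots> \<le> ?k * ?G" using k by (intro mult_right_mono) auto
      finally show "norm (g x) \<le> ?k * ?G" .
      have "?G \<le> (1 + \<eta>) * norm (g x)"
        using norm_triangle_sub[of "g c" "g x"] b by (simp add: algebra_simps norm_minus_commute)
      also have "\<dots> \<le> ?k * norm (g x)" using k by (intro mult_right_mono) auto
      finally show "?G \<le> ?k * norm (g x)" .
    qed
    have int: "(\<integral>\<^sup>+x. ennreal w * indicator E x \<partial>hausdorff DIM('b)) = ennreal w * ?H" for w
      by (subst nn_integral_cmult_indicator) (auto simp: emeasure_hausdorff)
    have up: "\<nu> E \<le> ennreal (?k / ?G) * ?H"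
      unfolding \<nu>_def int[symmetric]
    proof (rule nn_integral_mono)
      fix x
      have "1 / norm (g x) \<le> ?k / ?G" if "x \<in> E"
      proof -
        have "1 / a \<le> c / b" if "b \<le> c * a" "0 < a" "0 < b" for a b c :: real
          using that by (simp add: field_simps)
        from this[OF cmp(2)[OF that] _ G] show ?thesis using gpos[of x] ES(1) that by auto
      qed
      then show "ennreal (1 / norm (g x)) * indicator E x \<le> ennreal (?k / ?G) * indicator E x"
        by (cases "x \<in> E") (auto intro: ennreal_leI)
    qed
    have low: "ennreal (1 / (?k * ?G)) * ?H \<le> \<nu> E"
      unfolding \<nu>_def int[symmetric]
    proof (rule nn_integral_mono)
      fix x
      have "1 / (?k * ?G) \<le> 1 / norm (g x)" if "x \<in> E"
        using cmp(1)[OF that] gpos[of x] ES(1) that by (intro divide_left_mono mult_pos_pos) (use G k \<eta> in auto)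
      then show "ennreal (1 / (?k * ?G)) * indicator E x \<le> ennreal (1 / norm (g x)) * indicator E x"
        by (cases "x \<in> E") (auto intro: ennreal_leI)
    qed
    have L: "0 < ?L" "\<Lambda> = ?k * ?L" using \<eta> by (simp_all add: \<Lambda>_def)
    define n where "n = real DIM('a)"
    have n: "0 < n" by (simp add: n_def)
    have kk: "0 < ?k" using k by linarith
    have emul: "ennreal a * (ennreal b * X) = ennreal (a * b) * X" if "0 \<le> a" "0 \<le> b" for a b X
      using that by (simp add: ennreal_mult mult.assoc)
    have "\<nu> E \<le> ennreal (?k / ?G) * (ennreal (?L * (n * ?G)) * ?V)"
      using up bounds1 unfolding n_def by (meson mult_left_mono order_trans zero_le)
    also have "\<dots> = ennreal (?k / ?G * (?L * (n * ?G))) * ?V"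
      by (rule emul) (use L G n kk in auto)
    also have "?k / ?G * (?L * (n * ?G)) = \<Lambda> * n" using G L by simp
    finally have 1: "\<nu> E \<le> ennreal \<Lambda> * \<mu> E"
      unfolding \<mu>_def n_def[symmetric] by (subst emul) (use L n kk in auto)
    have "\<mu> E = ennreal (1 / ?G) * (ennreal (n * ?G) * ?V)"
      using G n by (simp add: \<mu>_def n_def ennreal_mult'[symmetric] mult.assoc[symmetric])
    also have "\<dots> \<le> ennreal (1 / ?G) * (ennreal ?L * ?H)"
      using bounds2 unfolding n_def by (intro mult_left_mono) auto
    also have "\<dots> = ennreal \<Lambda> * (ennreal (1 / (?k * ?G)) * ?H)"
      using G L kk by (simp add: mult.assoc[symmetric] ennreal_mult'[symmetric])
    also have "\<dots> \<le> ennreal \<Lambda> * \<nu> E" by (intro mult_left_mono low) auto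
    finally show ?thesis using 1 by simp
  qed
  \<comment> \<open>The pieces overlap. Peeling them off one at a time keeps the parts disjoint, so
    that \<mu> and \<nu> add up; the induction therefore runs over arbitrary Borel parts of the
    level.\<close>
  have "\<mu> E \<le> ennreal \<Lambda> * \<nu> E \<and> \<nu> E \<le> ennreal \<Lambda> * \<mu> E"
    if "finite F" "F \<subseteq> ?S" "E \<in> sets borel" "E \<subseteq> ?S" "E \<subseteq> (\<Union>c\<in>F. piece c)" for F E
    using that
  proof (induction F arbitrary: E)
    case empty
    then have "E = {}" by auto
    moreover have "radial_cone {} = {}" by (simp add: radial_cone_def)
    ultimately show ?case by (simp add: \<mu>_def \<nu>_def)
  next
    case (insert c F)
    have [measurable]: "E \<in> sets borel" using insert by simp
    let ?A = "E \<inter> piece c" and ?B = "E - piece c"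
    have 1: "\<mu> ?A \<le> ennreal \<Lambda> * \<nu> ?A \<and> \<nu> ?A \<le> ennreal \<Lambda> * \<mu> ?A"
      using insert by (intro loc[of c]) auto
    have 2: "\<mu> ?B \<le> ennreal \<Lambda> * \<nu> ?B \<and> \<nu> ?B \<le> ennreal \<Lambda> * \<mu> ?B"
      using insert.prems by (intro insert.IH) auto
    have E: "?A \<union> ?B = E" "?A \<inter> ?B = {}" by auto
    have "\<mu> E = \<mu> ?A + \<mu> ?B" "\<nu> E = \<nu> ?A + \<nu> ?B"
      using \<mu>_Un[OF E(2)] \<nu>_Un[OF E(2)] by (simp_all add: E(1))
    then show ?case using 1 2 by (simp add: distrib_left add_mono)
  qed
  from this[OF F(2,1) S order_refl cover]
  show "\<mu> ?S \<le> ennreal \<Lambda> * \<nu> ?S" "\<nu> ?S \<le> ennreal \<Lambda> * \<mu> ?S" by auto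
qed

lemma emeasure_gauge_ball_finite: "emeasure lborel {x. N x \<le> t} < \<infinity>"
proof -
  obtain m M where m: "0 < m" "\<And>x. m * norm x \<le> N x" by (rule bounds) blast
  have "{x. N x \<le> t} \<subseteq> cball 0 (t / m)"
  proof
    fix x assume "x \<in> {x. N x \<le> t}"
    then show "x \<in> cball 0 (t / m)" using m(1) m(2)[of x] by (simp add: field_simps)
  qed
  then have "emeasure lborel {x. N x \<le> t} \<le> emeasure lborel (cball (0::'a) (t / m))"
    by (rule emeasure_mono) simp
  also have "\<dots> < \<infinity>" by (rule emeasure_lborel_cball_finite)
  finally show ?thesis .
qed

definition volume :: real where
  "volume = measure lborel {x. N x \<le> 1}"

lemma emeasure_unit_ball: "emeasure lborel {x. N x \<le> 1} = ennreal volume"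
  unfolding volume_def using emeasure_gauge_ball_finite[of 1] by (simp add: emeasure_eq_ennreal_measure less_top[symmetric])

lemma volume_nonneg: "0 \<le> volume" by (simp add: volume_def)

text \<open>The two sides of \<open>area_comparison\<close> do not depend on \<eta>, while the
  constant tends to 1 as \<eta> tends to 0. The single value \<open>1/4\<close> already shows that
  the integral is finite, which permits passing to real numbers.\<close>

theorem surface_integral_eq:
  assumes dim: "DIM('a) = Suc DIM('b::euclidean_space)"
  shows "(LINT x:{x. N x = 1}|hausdorff DIM('b). 1 / norm (grad N x)) = real DIM('a) * volume"
proof -
  let ?S = "{x. N x = 1}"
  have S [measurable]: "?S \<in> sets borel" using compact_level by (simp add: borel_compact)
  define v where "v = real DIM('a) * volume"
  have v: "0 \<le> v" by (simp add: v_def volume_nonneg)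
  define W where "W = (\<integral>\<^sup>+x. ennreal (1 / norm (g x)) * indicator ?S x \<partial>hausdorff DIM('b))"
  have "radial_cone ?S = {x. N x \<le> 1} - {0}"
    using scale[of "inverse (N x)" x for x] pos by (auto simp: radial_cone_def less_imp_le)
  then have "emeasure lborel (radial_cone ?S) = emeasure lborel {x. N x \<le> 1}"
    by (simp add: emeasure_Diff_null_set finite_imp_null_set_lborel)
  then have \<mu>: "ennreal (real DIM('a)) * emeasure lborel (radial_cone ?S) = ennreal v"
    by (simp add: emeasure_unit_ball v_def ennreal_mult' volume_nonneg)
  define \<Lambda> where "\<Lambda> \<eta> = (1 / (1 - 2 * \<eta>)) ^ Suc (2 * DIM('a))" for \<eta> :: real
  have cmp: "ennreal v \<le> ennreal (\<Lambda> \<eta>) * W" "W \<le> ennreal (\<Lambda> \<eta>) * ennreal v" if "0 < \<eta>" "\<eta> < 1/2" for \<eta>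
    using area_comparison[OF dim that] by (simp_all add: \<mu> \<Lambda>_def W_def)
  have "W < \<infinity>" using cmp(2)[of "1/4"] by (simp add: ennreal_mult''[symmetric] v order_le_less_trans)
  then obtain w where w: "0 \<le> w" "W = ennreal w" by (cases W) auto
  have ev: "\<forall>\<^sub>F \<eta> in at_right 0. 0 < \<eta> \<and> \<eta> < (1/2::real)"
    by (auto simp: eventually_at_right_field intro: exI[of _ "1/2"])
  have \<Lambda>pos: "0 \<le> \<Lambda> \<eta>" if "\<eta> < 1/2" for \<eta> using that by (simp add: \<Lambda>_def)
  have lim: "((\<lambda>\<eta>. \<Lambda> \<eta> * c) \<longlongrightarrow> c) (at_right 0)" for c
    unfolding \<Lambda>_def by (auto intro!: tendsto_eq_intros)
  have "v \<le> w"
  proof (rule tendsto_lowerbound[OF lim])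
    show "\<forall>\<^sub>F \<eta> in at_right 0. v \<le> \<Lambda> \<eta> * w"
      using ev
    proof eventually_elim
      case (elim \<eta>)
      then have "ennreal v \<le> ennreal (\<Lambda> \<eta> * w)"
        using cmp(1)[of \<eta>] w \<Lambda>pos by (simp add: ennreal_mult)
      then show ?case using elim w \<Lambda>pos by (simp add: ennreal_le_iff)
    qed
  qed simp
  moreover have "w \<le> v"
  proof (rule tendsto_lowerbound[OF lim])
    show "\<forall>\<^sub>F \<eta> in at_right 0. w \<le> \<Lambda> \<eta> * v"
      using ev
    proof eventually_elim
      case (elim \<eta>)
      then have "ennreal w \<le> ennreal (\<Lambda> \<eta> * v)"
        using cmp(2)[of \<eta>] w v \<Lambda>pos by (simp add: ennreal_mult)
      then show ?case using elim v \<Lambda>pos by (simp add: ennreal_le_iff)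
    qed
  qed simp
  ultimately have "W = ennreal v" using w by simp
  have "(LINT x:?S|hausdorff DIM('b). 1 / norm (grad N x)) = (LINT x|hausdorff DIM('b). indicator ?S x * (1 / norm (g x)))"
    unfolding set_lebesgue_integral_def
  proof (rule Bochner_Integration.integral_cong[OF refl])
    fix x
    have "x \<noteq> 0" if "N x = 1" using that by auto
    then show "indicator ?S x *\<^sub>R (1 / norm (grad N x)) = indicator ?S x * (1 / norm (g x))"
      by (cases "N x = 1") (simp_all add: grad_N)
  qed
  also have "\<dots> = enn2real (\<integral>\<^sup>+x. ennreal (indicator ?S x * (1 / norm (g x))) \<partial>hausdorff DIM('b))"
    by (rule integral_eq_nn_integral) auto
  also have "(\<integral>\<^sup>+x. ennreal (indicator ?S x * (1 / norm (g x))) \<partial>hausdorff DIM('b)) = W"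
    unfolding W_def by (intro nn_integral_cong) (auto simp: indicator_def)
  finally show ?thesis using \<open>W = ennreal v\<close> v by (simp add: v_def)
qed

section \<open>Polar coordinates for the gauge\<close>

lemma emeasure_gauge_ball:
  assumes "0 \<le> t"
  shows "emeasure lborel {x. N x \<le> t} = ennreal (t ^ DIM('a) * volume)"
proof (cases "t = 0")
  case True
  then have "{x. N x \<le> t} = {0}" using pos by (auto simp: not_less[symmetric])
  then show ?thesis using True by (simp add: zero_power)
next
  case False
  then have t: "0 < t" using assms by simp
  have "{x. N x \<le> t} = {x. x /\<^sub>R t \<in> {x. N x \<le> 1}}"
  proof -
    have "N (x /\<^sub>R t) = N x / t" for x
      using scale[of "inverse t" x] t by (simp add: divide_inverse mult.commute)
    then show ?thesis using t by (simp add: pos_divide_le_eq)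
  qed
  then have "emeasure lborel {x. N x \<le> t} = emeasure lborel {x. x /\<^sub>R t \<in> {x. N x \<le> 1}}" by simp
  also have "\<dots> = ennreal (t ^ DIM('a)) * emeasure lborel {x. N x \<le> 1}"
    by (rule emeasure_lborel_scale) (use t in auto)
  finally show ?thesis using t by (simp add: emeasure_unit_ball ennreal_mult volume_nonneg)
qed

text \<open>The image of Lebesgue measure under \<open>N\<close> is determined by the volumes of the
  gauge balls, and its density is their derivative in the radius. No surface measure is
  involved.\<close>

lemma distr_N:
  "distr lborel borel N =
    density lborel (\<lambda>t. ennreal (real DIM('a) * volume * t ^ (DIM('a) - 1)) * indicator {0..} t)" (is "?L = ?R")
proof (rule measure_eqI_generator_eq)
  let ?E = "range (\<lambda>a::real. {..a})"
  show "Int_stable ?E"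
  proof (rule Int_stableI)
    fix a b assume "a \<in> ?E" "b \<in> ?E"
    then show "a \<inter> b \<in> ?E" by auto
  qed
  show "?E \<subseteq> Pow UNIV" by simp
  show "sets ?L = sigma_sets UNIV ?E" "sets ?R = sigma_sets UNIV ?E"
    by (simp_all add: borel_eq_atMost)
  let ?A = "\<lambda>i::nat. {..real i}"
  show "range ?A \<subseteq> ?E" by auto
  show "(\<Union>i. ?A i) = UNIV" using real_arch_simple by (auto simp: set_eq_iff)
  have L: "emeasure ?L {..a} = emeasure lborel {x. N x \<le> a}" for a
    by (subst emeasure_distr) (auto simp: vimage_def)
  show "emeasure ?L (?A i) \<noteq> \<infinity>" for i
    using emeasure_gauge_ball_finite[of "real i"] unfolding L by simp
  fix X assume "X \<in> ?E"
  then obtain a where X: "X = {..a}" by auto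
  have R: "emeasure ?R {..a} = (\<integral>\<^sup>+t. ennreal (real DIM('a) * volume * t ^ (DIM('a) - 1)) * indicator {0..a} t \<partial>lborel)"
    by (subst emeasure_density) (auto intro!: nn_integral_cong simp: indicator_def)
  show "emeasure ?L X = emeasure ?R X"
  proof (cases "0 \<le> a")
    case True
    have "(\<integral>\<^sup>+t. ennreal (real DIM('a) * volume * t ^ (DIM('a) - 1)) * indicator {0..a} t \<partial>lborel)
        = ennreal (volume * a ^ DIM('a) - volume * 0 ^ DIM('a))"
    proof (rule nn_integral_FTC_Icc)
      fix t :: real
      have "((\<lambda>t. t ^ DIM('a)) has_real_derivative real DIM('a) * t ^ (DIM('a) - Suc 0)) (at t)"
        by (rule DERIV_pow)
      from DERIV_cmult[OF this, of volume]
      show "((\<lambda>t. volume * t ^ DIM('a)) has_real_derivative real DIM('a) * volume * t ^ (DIM('a) - 1)) (at t)"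
        by (rule DERIV_cong) simp
    qed (use True volume_nonneg in auto)
    then show ?thesis unfolding X L R by (simp add: emeasure_gauge_ball True mult.commute zero_power)
  next
    case False
    then have "{x. N x \<le> a} = {}" using nonneg by (auto simp: not_le) (meson less_le_trans not_less)
    moreover have "{0..a} = {}" using False by simp
    ultimately show ?thesis unfolding X L R by simp
  qed
qed

lemma nn_integral_N:
  assumes f: "f \<in> borel_measurable borel"
  shows "(\<integral>\<^sup>+x. f (N x) \<partial>lborel) =
    (\<integral>\<^sup>+t. ennreal (real DIM('a) * volume * t ^ (DIM('a) - 1)) * indicator {0..} t * f t \<partial>lborel)"
proof -
  have "(\<integral>\<^sup>+x. f (N x) \<partial>lborel) = (\<integral>\<^sup>+t. f t \<partial>distr lborel borel N)"
    by (subst nn_integral_distr) (use f in auto)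
  also have "\<dots> = (\<integral>\<^sup>+t. ennreal (real DIM('a) * volume * t ^ (DIM('a) - 1)) * indicator {0..} t * f t \<partial>lborel)"
    unfolding distr_N by (subst nn_integral_density) (use f in auto)
  finally show ?thesis .
qed

lemma nn_integral_tail_finite:
  assumes c: "0 < c" and a: "real DIM('a) < a"
  shows "(\<integral>\<^sup>+x. ennreal (N x powr (- a)) * indicator {c..} (N x) \<partial>lborel) < \<infinity>"
proof -
  define b where "b = a - real DIM('a)"
  have b: "0 < b" using a by (simp add: b_def)
  let ?n = "real DIM('a)"
  have "(\<integral>\<^sup>+x. ennreal (N x powr (- a)) * indicator {c..} (N x) \<partial>lborel) =
    (\<integral>\<^sup>+t. ennreal (?n * volume * t ^ (DIM('a) - 1)) * indicator {0..} t * (ennreal (t powr (- a)) * indicator {c..} t) \<partial>lborel)"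
    by (rule nn_integral_N[of "\<lambda>t. ennreal (t powr (- a)) * indicator {c..} t"]) measurable
  also have "\<dots> = (\<integral>\<^sup>+t. ennreal (?n * volume * t powr (- b - 1)) * indicator {c..} t \<partial>lborel)"
  proof (intro nn_integral_cong)
    fix t :: real
    show "ennreal (?n * volume * t ^ (DIM('a) - 1)) * indicator {0..} t * (ennreal (t powr (- a)) * indicator {c..} t)
      = ennreal (?n * volume * t powr (- b - 1)) * indicator {c..} t"
    proof (cases "c \<le> t")
      case True
      then have t: "0 < t" using c by simp
      have "t ^ (DIM('a) - 1) * t powr (- a) = t powr (- b - 1)"
      proof -
        have "real (DIM('a) - 1) + - a = - b - 1" by (simp add: b_def of_nat_diff Suc_leI)
        then show ?thesis by (simp only: powr_realpow[symmetric, OF t] powr_add[symmetric])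
      qed
      then show ?thesis using True t volume_nonneg
        by (simp add: ennreal_mult'[symmetric] mult.assoc)
    qed simp
  qed
  also have "\<dots> = ennreal (0 - (- (?n * volume / b) * c powr (- b)))"
  proof (rule nn_integral_FTC_atLeast)
    fix t :: real assume t: "c \<le> t"
    then have t0: "0 < t" using c by simp
    have "((\<lambda>t. t powr (- b)) has_real_derivative (- b) * t powr (- b - 1)) (at t)"
      by (rule has_real_derivative_powr[OF t0])
    from DERIV_cmult[OF this, of "- (?n * volume / b)"]
    show "((\<lambda>t. - (?n * volume / b) * t powr (- b)) has_real_derivative ?n * volume * t powr (- b - 1)) (at t)"
      by (rule DERIV_cong) (use b in simp)
    show "0 \<le> ?n * volume * t powr (- b - 1)" using volume_nonneg by simp
  next
    have "((\<lambda>t::real. t powr (- b)) \<longlongrightarrow> 0) at_top"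
      by (rule tendsto_neg_powr[OF _ filterlim_ident]) (use b in simp)
    from tendsto_mult_left[OF this, of "- (?n * volume / b)"]
    show "((\<lambda>t. - (?n * volume / b) * t powr (- b)) \<longlongrightarrow> 0) at_top" by simp
  qed measurable
  finally show ?thesis by simp
qed

end

section \<open>The dual of an anisotropic norm\<close>

lemma anisotropic_norm_ck2:
  assumes "anisotropic_norm H" "x \<noteq> 0"
  shows "H differentiable (at x)" "(\<lambda>x. frechet_derivative H (at x) v) differentiable (at x)"
  using assms by (auto simp: anisotropic_norm_def numeral_2_eq_2)

lemma differentiable_unit_normal:
  fixes H :: "'a::euclidean_space \<Rightarrow> real"
  assumes H: "anisotropic_norm H" and x: "x \<noteq> 0" and g: "grad H x \<noteq> 0"
  shows "unit_normal H differentiable (at x)"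
proof -
  have gr: "grad H differentiable (at x)"
    unfolding grad_def[abs_def]
  proof (intro differentiable_sum finite_Basis ballI)
    fix b :: 'a
    show "(\<lambda>x. frechet_derivative H (at x) b *\<^sub>R b) differentiable (at x)"
    proof -
      obtain D where "((\<lambda>x. frechet_derivative H (at x) b) has_derivative D) (at x)"
        using anisotropic_norm_ck2(2)[OF H x, of b] unfolding differentiable_def by blast
      from has_derivative_scaleR_left[OF this, of b] show ?thesis
        unfolding differentiable_def by blast
    qed
  qed
  moreover have "(\<lambda>x. norm (grad H x)) differentiable (at x)"
    using differentiable_chain_at[OF gr, of norm] g
    by (simp add: comp_def differentiable_norm_at)
  ultimately show ?thesis
    unfolding unit_normal_def[abs_def] using g
    by (intro differentiable_scaleR differentiable_inverse) auto
qed

locale aniso =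
  fixes H :: "'a::euclidean_space \<Rightarrow> real"
  assumes H: "anisotropic_norm H"
begin

abbreviation "H0 \<equiv> dual_norm H"

lemma convex_H: "convex_on UNIV H"
  and H_scale_pos: "0 < t \<Longrightarrow> H (t *\<^sub>R x) = t * H x"
  and H_pos: "x \<noteq> 0 \<Longrightarrow> 0 < H x"
  using H by (auto simp: anisotropic_norm_def)

lemma continuous_H: "continuous_on UNIV H"
  by (rule convex_on_continuous[OF open_UNIV convex_H])

lemma H_zero [simp]: "H 0 = 0"
  using H_scale_pos[of 2 0] by simp

lemma H_nonneg: "0 \<le> H x"
  using H_pos[of x] by (cases "x = 0") auto

lemma H_bounds:
  obtains m where "0 < m" "\<And>x. m * norm x \<le> H x"
proof -
  let ?S = "sphere (0::'a) 1"
  have ne: "?S \<noteq> {}" by simp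
  have cont: "continuous_on ?S H" by (rule continuous_on_subset[OF continuous_H]) auto
  obtain a where a: "a \<in> ?S" "\<And>y. y \<in> ?S \<Longrightarrow> H a \<le> H y"
    using continuous_attains_inf[OF compact_sphere ne cont] by auto
  have "H a * norm x \<le> H x" for x
  proof (cases "x = 0")
    case False
    then have "H x = norm x * H (sgn x)" using H_scale_pos[of "norm x" "sgn x"] by (simp add: sgn_div_norm)
    moreover have "H a \<le> H (sgn x)" using False by (intro a) (simp add: norm_sgn)
    ultimately show ?thesis
      using mult_left_mono[of "H a" "H (sgn x)" "norm x"] by (simp add: mult.commute)
  qed simp
  moreover have "0 < H a" using a(1) by (intro H_pos) auto
  ultimately show ?thesis using that by blast
qed

lemma compact_unit_level: "compact {\<xi>. H \<xi> = 1}"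
proof -
  obtain m where m: "0 < m" "\<And>x. m * norm x \<le> H x" by (rule H_bounds) blast
  have "closed (H -` {1})"
    using continuous_H by (intro closed_vimage) auto
  moreover have "bounded {\<xi>. H \<xi> = 1}"
  proof (rule boundedI)
    fix x assume "x \<in> {\<xi>. H \<xi> = 1}"
    then show "norm x \<le> 1 / m" using m(1) m(2)[of x] by (simp add: field_simps)
  qed
  ultimately show ?thesis by (simp add: compact_eq_bounded_closed vimage_def)
qed

lemma unit_level_nonempty: "{\<xi>. H \<xi> = 1} \<noteq> {}"
proof -
  obtain b :: 'a where "b \<in> Basis" using nonempty_Basis by blast
  then have "b \<noteq> 0" by (auto simp: nonzero_Basis)
  then have "H (b /\<^sub>R H b) = 1" using H_pos[of b] H_scale_pos[of "inverse (H b)" b] by simp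
  then show ?thesis by auto
qed

lemma attains: "\<exists>\<xi>. H \<xi> = 1 \<and> \<zeta> \<bullet> \<xi> = H0 \<zeta>" and dual_upper: "H \<xi> = 1 \<Longrightarrow> \<zeta> \<bullet> \<xi> \<le> H0 \<zeta>"
proof -
  have "continuous_on {\<xi>. H \<xi> = 1} (\<lambda>y. \<zeta> \<bullet> y)" by (intro continuous_intros)
  from continuous_attains_sup[OF compact_unit_level unit_level_nonempty this]
  obtain a where a: "H a = 1" "\<And>y. H y = 1 \<Longrightarrow> \<zeta> \<bullet> y \<le> \<zeta> \<bullet> a" by blast
  then have eq: "H0 \<zeta> = \<zeta> \<bullet> a"
    unfolding dual_norm_def by (intro cSup_eq_maximum) auto
  then show "\<exists>\<xi>. H \<xi> = 1 \<and> \<zeta> \<bullet> \<xi> = H0 \<zeta>" "H \<xi> = 1 \<Longrightarrow> \<zeta> \<bullet> \<xi> \<le> H0 \<zeta>" using a by auto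
qed

lemma dual_inner_le: "\<zeta> \<bullet> y \<le> H0 \<zeta> * H y"
proof (cases "y = 0")
  case False
  then have "H (y /\<^sub>R H y) = 1" using H_pos[of y] H_scale_pos[of "inverse (H y)" y] by simp
  from dual_upper[OF this, of \<zeta>] show ?thesis using H_pos[OF False] by (simp add: field_simps)
qed simp

lemma dual_pos:
  assumes "\<zeta> \<noteq> 0"
  shows "0 < H0 \<zeta>"
proof -
  have "0 < \<zeta> \<bullet> \<zeta>" using assms by simp
  also have "\<dots> \<le> H0 \<zeta> * H \<zeta>" by (rule dual_inner_le)
  finally show ?thesis using H_pos[OF assms] by (simp add: zero_less_mult_iff)
qed

text \<open>Two maximisers would span a segment of the unit level on which the gradient of \<open>H\<close> equals
  \<open>\<zeta> / H0 \<zeta>\<close>, so the Gauss map would be constant along it: a vanishing principal curvature.\<close>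

lemma maximizer_unique:
  assumes \<zeta>: "\<zeta> \<noteq> 0" and a: "H a = 1" "\<zeta> \<bullet> a = H0 \<zeta>" and b: "H b = 1" "\<zeta> \<bullet> b = H0 \<zeta>"
  shows "a = b"
proof (rule ccontr)
  assume ab: "a \<noteq> b"
  define M where "M = H0 \<zeta>"
  have M: "0 < M" using dual_pos[OF \<zeta>] by (simp add: M_def)
  define u where "u = b - a"
  \<comment> \<open>At the midpoint the segment extends to both sides, so a derivative along
    \<open>u\<close> can be evaluated there.\<close>
  define x where "x = a + (1/2) *\<^sub>R u"
  \<comment> \<open>Convexity gives \<open>H \<le> 1\<close> on the segment and duality gives
    \<open>H \<ge> 1\<close>. Moreover \<open>H y - \<zeta> \<bullet> y / M\<close> is nonnegative
    everywhere and zero on the segment, so its derivative vanishes there.\<close>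
  have seg: "H (x + s *\<^sub>R u) = 1 \<and> x + s *\<^sub>R u \<noteq> 0 \<and> grad H (x + s *\<^sub>R u) = \<zeta> /\<^sub>R M" if s: "\<bar>s\<bar> < 1/2" for s
  proof -
    define z where "z = x + s *\<^sub>R u"
    have z: "z = (1 - (1/2 + s)) *\<^sub>R a + (1/2 + s) *\<^sub>R b"
      by (simp add: z_def x_def u_def algebra_simps) (simp add: scaleR_add_left[symmetric])
    have "H z \<le> (1 - (1/2 + s)) * H a + (1/2 + s) * H b"
      unfolding z by (rule convex_onD[OF convex_H]) (use s in auto)
    then have Hz1: "H z \<le> 1" using a b by simp
    have zM: "\<zeta> \<bullet> z = M" by (simp add: z inner_add_right a b M_def algebra_simps)
    have "M \<le> M * H z" using dual_inner_le[of \<zeta> z] zM by (simp add: M_def)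
    then have Hz: "H z = 1" using M Hz1 by simp
    then have z0: "z \<noteq> 0" by auto
    let ?D = "frechet_derivative H (at z)"
    have D: "(H has_derivative ?D) (at z)"
      using anisotropic_norm_ck2(1)[OF H z0] by (simp add: frechet_derivative_works)
    have "((\<lambda>y. H y - \<zeta> \<bullet> y / M) has_derivative (\<lambda>v. ?D v - \<zeta> \<bullet> v / M)) (at z)"
      by (intro derivative_eq_intros D refl) (use M D in auto)
    moreover have "H z - \<zeta> \<bullet> z / M \<le> H y - \<zeta> \<bullet> y / M" for y
      using dual_inner_le[of \<zeta> y] M zM Hz by (simp add: M_def field_simps)
    ultimately have "(\<lambda>v. ?D v - \<zeta> \<bullet> v / M) = (\<lambda>v. 0)"
      by (intro differential_zero_maxmin[of z UNIV]) auto
    then have "?D v = \<zeta> \<bullet> v / M" for v by (metis eq_iff_diff_eq_0)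
    then have "grad H z = (\<Sum>b\<in>Basis. ((\<zeta> /\<^sub>R M) \<bullet> b) *\<^sub>R b)"
      by (simp add: grad_def divide_inverse mult.commute)
    then have "grad H z = \<zeta> /\<^sub>R M" by (simp only: euclidean_representation)
    then show ?thesis using Hz z0 by (simp add: z_def)
  qed
  have x: "H x = 1" "x \<noteq> 0" "grad H x = \<zeta> /\<^sub>R M" using seg[of 0] by auto
  define D where "D = frechet_derivative (unit_normal H) (at x)"
  have "unit_normal H differentiable (at x)"
    by (rule differentiable_unit_normal[OF H x(2)]) (use x \<zeta> M in auto)
  then have D: "(unit_normal H has_derivative D) (at x)"
    by (simp add: D_def frechet_derivative_works)
  have "((\<lambda>s. x + s *\<^sub>R u) has_derivative (\<lambda>s. s *\<^sub>R u)) (at (0::real))"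
    by (auto intro!: derivative_eq_intros)
  then have "((unit_normal H \<circ> (\<lambda>s. x + s *\<^sub>R u)) has_derivative D \<circ> (\<lambda>s. s *\<^sub>R u)) (at (0::real))"
    by (rule diff_chain_at) (use D in simp)
  moreover have "((unit_normal H \<circ> (\<lambda>s. x + s *\<^sub>R u)) has_derivative (\<lambda>s. 0)) (at (0::real))"
  proof (rule has_derivative_transform_within_open[of "\<lambda>s. unit_normal H x" _ _ _ "{-1/2<..<1/2}"])
    show "unit_normal H x = (unit_normal H \<circ> (\<lambda>s. x + s *\<^sub>R u)) s" if "s \<in> {-1/2<..<1/2::real}" for s
    proof -
      have "\<bar>s\<bar> < 1/2" using that by (auto simp: abs_if)
      from seg[OF this] x(3) show ?thesis by (simp add: unit_normal_def)
    qed
  qed auto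
  ultimately have "D \<circ> (\<lambda>s. s *\<^sub>R u) = (\<lambda>s::real. 0)" by (rule has_derivative_unique)
  then have "(D \<circ> (\<lambda>s. s *\<^sub>R u)) 1 = 0" by (rule fun_cong)
  then have Du: "D u = 0" by simp
  have "principal_curvature H x 0"
    unfolding principal_curvature_def
  proof (intro exI conjI)
    show "u \<noteq> 0" using ab by (simp add: u_def)
    show "u \<bullet> grad H x = 0" using a b by (simp add: x u_def inner_diff_left inner_diff_right inner_commute)
    show "frechet_derivative (unit_normal H) (at x) u = 0 *\<^sub>R u" using Du by (simp add: D_def)
  qed
  moreover have "x \<in> frontier {y. H y < 1}"
  proof -
    have "x \<in> closure {y. H y < 1}"
    proof (rule closed_sequentially[OF closed_closure])
      show "(1 - inverse (real (Suc n))) *\<^sub>R x \<in> closure {y. H y < 1}" for n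
      proof (rule subsetD[OF closure_subset])
        show "(1 - inverse (real (Suc n))) *\<^sub>R x \<in> {y. H y < 1}"
        proof (cases "n = 0")
          case False
          then have "0 < 1 - inverse (real (Suc n))" by (simp add: inverse_less_1_iff)
          then show ?thesis using H_scale_pos[of "1 - inverse (real (Suc n))" x] x by simp
        qed simp
      qed
      have "(\<lambda>n. (1 - inverse (real (Suc n))) *\<^sub>R x) \<longlonglongrightarrow> (1 - 0) *\<^sub>R x"
        by (intro tendsto_intros LIMSEQ_inverse_real_of_nat)
      then show "(\<lambda>n. (1 - inverse (real (Suc n))) *\<^sub>R x) \<longlonglongrightarrow> x" by simp
    qed
    moreover have "x \<notin> interior {y. H y < 1}" using interior_subset[of "{y. H y < 1}"] x by auto
    ultimately show ?thesis by (simp add: frontier_def)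
  qed
  ultimately show False
    using H unfolding anisotropic_norm_def unif_convex_unit_ball_def by fastforce
qed

section \<open>The maximiser as gradient of the dual norm\<close>

definition maximizer :: "'a \<Rightarrow> 'a" where
  "maximizer \<zeta> = (SOME \<xi>. H \<xi> = 1 \<and> \<zeta> \<bullet> \<xi> = H0 \<zeta>)"

lemma maximizer: "H (maximizer \<zeta>) = 1" "\<zeta> \<bullet> maximizer \<zeta> = H0 \<zeta>"
  using someI_ex[OF attains[of \<zeta>]] by (auto simp: maximizer_def)

text \<open>Closed graph theorem with a compact target: by uniqueness, the closed conditions of
  maximality describe exactly the graph.\<close>

lemma continuous_maximizer: "continuous_on (UNIV - {0}) maximizer"
proof -
  let ?S = "UNIV - {0 :: 'a}" and ?T = "{\<xi>. H \<xi> = 1}"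
  have graph: "(\<lambda>\<zeta>. (\<zeta>, maximizer \<zeta>)) ` ?S =
      (?S \<times> ?T) \<inter> (\<Inter>y\<in>?T. {z. fst z \<bullet> y \<le> fst z \<bullet> snd z})"
  proof (intro set_eqI iffI)
    fix z assume "z \<in> (\<lambda>\<zeta>. (\<zeta>, maximizer \<zeta>)) ` ?S"
    then show "z \<in> (?S \<times> ?T) \<inter> (\<Inter>y\<in>?T. {z. fst z \<bullet> y \<le> fst z \<bullet> snd z})"
      by (auto simp: maximizer dual_upper)
  next
    fix z assume z: "z \<in> (?S \<times> ?T) \<inter> (\<Inter>y\<in>?T. {z. fst z \<bullet> y \<le> fst z \<bullet> snd z})"
    then have "\<forall>y\<in>?T. fst z \<bullet> y \<le> fst z \<bullet> snd z" by blast
    then have "fst z \<bullet> maximizer (fst z) \<le> fst z \<bullet> snd z" using maximizer(1) by blast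
    moreover have "fst z \<noteq> 0" "H (snd z) = 1" using z by auto
    ultimately have 1: "fst z \<noteq> 0" "H (snd z) = 1" "fst z \<bullet> maximizer (fst z) \<le> fst z \<bullet> snd z"
      by blast+
    then have "fst z \<bullet> snd z = H0 (fst z)"
      using dual_upper[OF 1(2), of "fst z"] by (simp add: maximizer)
    then have "snd z = maximizer (fst z)" using maximizer_unique 1 maximizer by blast
    then show "z \<in> (\<lambda>\<zeta>. (\<zeta>, maximizer \<zeta>)) ` ?S" using 1
      by (intro image_eqI[of _ _ "fst z"]) (auto simp: prod_eq_iff)
  qed
  have "closed (\<Inter>y\<in>?T. {z :: 'a \<times> 'a. fst z \<bullet> y \<le> fst z \<bullet> snd z})"
    by (intro closed_INT ballI closed_Collect_le continuous_intros)
  then have "closedin (top_of_set (?S \<times> ?T)) ((\<lambda>\<zeta>. (\<zeta>, maximizer \<zeta>)) ` ?S)"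
    unfolding graph by (rule closedin_closed_Int)
  then show ?thesis
    using continuous_closed_graph_eq[OF compact_unit_level, of maximizer ?S] maximizer by auto
qed

text \<open>The gradient of the dual norm is the maximiser; the reflection in
  \<open>dual_norm_hat\<close> puts one minus sign into the argument and, by the chain rule, another
  in front.\<close>

definition hat_grad :: "'a \<Rightarrow> 'a" where
  "hat_grad x = - maximizer (- x)"

lemma H_hat_grad: "H (- hat_grad x) = 1"
  by (simp add: hat_grad_def maximizer)

lemma smooth_gauge_hat: "smooth_gauge (dual_norm_hat H) hat_grad"
proof
  fix x :: 'a assume x: "x \<noteq> 0"
  show "hat_grad x \<bullet> x = dual_norm_hat H x"
    using maximizer(2)[of "- x"] by (simp add: hat_grad_def dual_norm_hat_def inner_commute)
  show "hat_grad x \<bullet> y \<le> dual_norm_hat H y" for y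
    using dual_upper[OF maximizer(1)[of "- x"], of "- y"]
    by (simp add: hat_grad_def dual_norm_hat_def inner_commute)
  show "0 < dual_norm_hat H x" using dual_pos[of "- x"] x by (simp add: dual_norm_hat_def)
next
  have "continuous_on (UNIV - {0}) (maximizer \<circ> uminus)"
  proof (rule continuous_on_compose)
    have "uminus ` (UNIV - {0 :: 'a}) \<subseteq> UNIV - {0}" by auto
    then show "continuous_on (uminus ` (UNIV - {0 :: 'a})) maximizer"
      by (rule continuous_on_subset[OF continuous_maximizer])
  qed (intro continuous_intros)
  then show "continuous_on (UNIV - {0}) hat_grad"
    by (simp add: hat_grad_def[abs_def] comp_def continuous_on_minus)
next
  fix t :: real and x :: 'a assume t: "0 \<le> t"
  have "H0 (t *\<^sub>R \<zeta>) = t * H0 \<zeta>" for \<zeta>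
  proof (rule antisym)
    show "H0 (t *\<^sub>R \<zeta>) \<le> t * H0 \<zeta>"
      using maximizer(2)[of "t *\<^sub>R \<zeta>"] dual_upper[OF maximizer(1)[of "t *\<^sub>R \<zeta>"], of \<zeta>] t
      by (metis inner_scaleR_left mult_left_mono)
    show "t * H0 \<zeta> \<le> H0 (t *\<^sub>R \<zeta>)"
      using dual_upper[OF maximizer(1)[of \<zeta>], of "t *\<^sub>R \<zeta>"] by (simp add: maximizer(2))
  qed
  from this[of "- x"] show "dual_norm_hat H (t *\<^sub>R x) = t * dual_norm_hat H x"
    by (simp add: dual_norm_hat_def)
qed

end

section \<open>Integrals of radial profiles\<close>

lemma lborel_integral_scale:
  fixes f :: "'a::euclidean_space \<Rightarrow> real"
  assumes s: "0 < s" and f [measurable]: "f \<in> borel_measurable borel"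
  shows "integral\<^sup>L lborel f = s ^ DIM('a) * (LINT x|lborel. f (s *\<^sub>R x))"
proof -
  have "integral\<^sup>L lborel f = integral\<^sup>L (density (distr lborel borel (\<lambda>x. 0 + s *\<^sub>R x)) (\<lambda>_. ennreal (\<bar>s\<bar> ^ DIM('a)))) f"
    using s by (subst lborel_affine[of s 0]) (auto simp: ennreal_power)
  also have "\<dots> = integral\<^sup>L (distr lborel borel (\<lambda>x. 0 + s *\<^sub>R x)) (\<lambda>x. s ^ DIM('a) * f x)"
    using s by (subst integral_density) auto
  also have "\<dots> = (LINT x|lborel. s ^ DIM('a) * f (s *\<^sub>R x))"
    by (subst integral_distr) auto
  finally show ?thesis by simp
qed

lemma
  fixes f :: "'a::euclidean_space \<Rightarrow> real"
  assumes [measurable]: "f \<in> borel_measurable borel" "S \<in> sets borel"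
  shows set_integrable_lebesgue_iff: "set_integrable lebesgue S f \<longleftrightarrow> set_integrable lborel S f"
    and set_lebesgue_integral_eq_lborel: "(LINT x:S|lebesgue. f x) = (LINT x:S|lborel. f x)"
  unfolding set_integrable_def set_lebesgue_integral_def
  by (auto intro!: integrable_completion integral_completion)

text \<open>A divergent integral has the value 0 here, so the identity is purely formal; convergence
  is recorded separately by \<open>in_Lp\<close>.\<close>

lemma Lp_norm_powr:
  assumes "p \<noteq> 0"
  shows "Lp_norm p S f powr p = (LINT x:S|lebesgue. \<bar>f x\<bar> powr p)"
proof -
  have "0 \<le> (LINT x:S|lebesgue. \<bar>f x\<bar> powr p)"
    unfolding set_lebesgue_integral_def by (rule Bochner_Integration.integral_nonneg) (auto simp: indicator_def)
  then show ?thesis using assms by (simp add: Lp_norm_def powr_powr)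
qed

text \<open>A Bernoulli inequality for negative exponents, from \<open>ln (1 + u) \<le> u\<close>
  and \<open>1 + x \<le> exp x\<close>. It measures how far the borderline profile stays below a
  pure power.\<close>

lemma one_plus_powr_neg_ge:
  fixes u k :: real
  assumes "0 \<le> u" "0 \<le> k"
  shows "1 - k * u \<le> (1 + u) powr (- k)"
proof -
  have "1 - k * u \<le> 1 + (- k * ln (1 + u))"
    using mult_left_mono[OF ln_add_one_self_le_self[OF assms(1)] assms(2)] by simp
  also have "\<dots> \<le> exp (- k * ln (1 + u))" by (rule exp_ge_add_one_self)
  also have "\<dots> = (1 + u) powr (- k)" using assms by (simp add: powr_def)
  finally show ?thesis .
qed

section \<open>Estimates uniform in \<epsilon>\<close>

context smooth_gauge
begin

lemma volume_pos: "0 < volume"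
proof -
  obtain m M where M: "0 < M" "\<And>x. N x \<le> M * norm x" by (rule bounds) blast
  have "ball 0 (1 / M) \<subseteq> {x. N x \<le> 1}"
  proof
    fix x :: 'a assume "x \<in> ball 0 (1 / M)"
    then have "M * norm x \<le> 1" using M(1) by (simp add: field_simps)
    then show "x \<in> {x. N x \<le> 1}" using M(2)[of x] by simp
  qed
  then have "emeasure lborel (ball (0::'a) (1 / M)) \<le> ennreal volume"
    unfolding emeasure_unit_ball[symmetric] by (rule emeasure_mono) simp
  moreover have "0 < emeasure lborel (ball (0::'a) (1 / M))"
    using M by (simp add: emeasure_ball)
  ultimately have "0 < ennreal volume" by (rule less_le_trans[rotated])
  then show ?thesis by simp
qed

text \<open>Common core of the expansions with a power as main term. \<open>f \<epsilon>\<close> is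
  the radial profile and \<open>F \<epsilon>\<close> the integrand with the cut-off;
  \<open>a\<close> is the decay rate of the profile and \<open>b\<close> its exponent under the
  dilation by \<open>\<epsilon> powr (1 / q)\<close>. Since \<open>a\<close> exceeds the dimension
  and \<open>C\<close> does not depend on \<epsilon>, the tail integrals are bounded
  uniformly.\<close>

lemma truncation_estimate:
  fixes f :: "real \<Rightarrow> real \<Rightarrow> real" and F :: "real \<Rightarrow> 'a \<Rightarrow> real"
  assumes a: "real DIM('a) < a" and \<rho>: "0 < \<rho>" and CK: "0 \<le> C" "0 \<le> K"
    and \<Omega> [measurable]: "\<Omega> \<in> sets borel" and fin: "emeasure lborel \<Omega> < \<infinity>"
    and sub: "{x. N x \<le> \<rho>} \<subseteq> \<Omega>"
    and fm [measurable]: "\<And>\<epsilon>. f \<epsilon> \<in> borel_measurable borel" and f0: "\<And>\<epsilon> t. 0 \<le> f \<epsilon> t"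
    and fB: "\<And>t. 0 \<le> t \<Longrightarrow> f 1 t \<le> B"
    and tail: "\<And>\<epsilon> t. 0 < \<epsilon> \<Longrightarrow> 0 < t \<Longrightarrow> f \<epsilon> t \<le> C * t powr (- a)"
    and scaling: "\<And>\<epsilon> t. 0 < \<epsilon> \<Longrightarrow> 0 \<le> t \<Longrightarrow> f \<epsilon> (\<epsilon> powr (1 / q) * t) = \<epsilon> powr (- b) * f 1 t"
    and Fm: "\<And>\<epsilon>. 0 < \<epsilon> \<Longrightarrow> F \<epsilon> \<in> borel_measurable borel"
    and Fin: "\<And>\<epsilon> x. 0 < \<epsilon> \<Longrightarrow> x \<noteq> 0 \<Longrightarrow> N x \<le> \<rho> \<Longrightarrow> F \<epsilon> x = f \<epsilon> (N x)"
    and Fout: "\<And>\<epsilon> x. 0 < \<epsilon> \<Longrightarrow> x \<in> \<Omega> \<Longrightarrow> \<rho> < N x \<Longrightarrow> 0 \<le> F \<epsilon> x \<and> F \<epsilon> x \<le> K"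
  shows "integrable lborel (\<lambda>x. f 1 (N x))"
    and "\<And>\<epsilon>. 0 < \<epsilon> \<Longrightarrow> set_integrable lborel \<Omega> (F \<epsilon>)"
    and "(\<lambda>\<epsilon>. (LINT x:\<Omega>|lborel. F \<epsilon> x)
        - \<epsilon> powr (real DIM('a) / q - b) * (LINT x|lborel. f 1 (N x))) \<in> O[at_right 0](\<lambda>_. 1)"
proof -
  let ?D = "{x. N x \<le> \<rho>}" and ?T = "\<lambda>x. N x powr (- a) * indicator {\<rho>..} (N x)"
  have D [measurable]: "?D \<in> sets borel" by measurable
  have Dfin: "emeasure lborel ?D < \<infinity>" by (rule emeasure_gauge_ball_finite)
  have T: "integrable lborel ?T"
  proof (rule integrableI_nonneg)
    have "(\<integral>\<^sup>+x. ennreal (?T x) \<partial>lborel) = (\<integral>\<^sup>+x. ennreal (N x powr (- a)) * indicator {\<rho>..} (N x) \<partial>lborel)"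
      by (intro nn_integral_cong) (auto simp: indicator_def)
    then show "(\<integral>\<^sup>+x. ennreal (?T x) \<partial>lborel) < \<infinity>"
      using nn_integral_tail_finite[OF \<rho> a] by simp
  qed (auto simp: indicator_def)
  have fbound: "f \<epsilon> t \<le> \<epsilon> powr (- b) * B" if "0 < \<epsilon>" "0 \<le> t" for \<epsilon> t
  proof -
    define u where "u = t / \<epsilon> powr (1 / q)"
    have u: "0 \<le> u" "t = \<epsilon> powr (1 / q) * u" using that by (simp_all add: u_def)
    then show ?thesis using scaling[OF that(1) u(1)] fB[OF u(1)] by (simp add: mult_left_mono)
  qed
  have intD: "integrable lborel (\<lambda>x. (\<epsilon> powr (- b) * B) * indicator ?D x)" for \<epsilon>
    using Dfin by (intro integrable_mult_right integrable_real_indicator) auto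
  have intf: "integrable lborel (\<lambda>x. f \<epsilon> (N x))" if \<epsilon>: "0 < \<epsilon>" for \<epsilon>
  proof (rule Bochner_Integration.integrable_bound)
    show "integrable lborel (\<lambda>x. (\<epsilon> powr (- b) * B) * indicator ?D x + C * ?T x)"
      by (intro Bochner_Integration.integrable_add intD integrable_mult_right T)
    show "AE x in lborel. norm (f \<epsilon> (N x)) \<le> norm ((\<epsilon> powr (- b) * B) * indicator ?D x + C * ?T x)"
    proof (intro AE_I2)
      fix x
      have B0: "0 \<le> \<epsilon> powr (- b) * B" using fbound[OF \<epsilon>, of 0] f0[of \<epsilon> 0] by simp
      show "norm (f \<epsilon> (N x)) \<le> norm ((\<epsilon> powr (- b) * B) * indicator ?D x + C * ?T x)"
      proof (cases "N x \<le> \<rho>")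
        case True
        have "0 \<le> C * ?T x" using CK by (auto simp: indicator_def)
        then show ?thesis using True B0 fbound[OF \<epsilon> nonneg, of x] f0[of \<epsilon> "N x"] by simp
      next
        case False
        then show ?thesis using tail[OF \<epsilon>, of "N x"] \<rho> f0[of \<epsilon> "N x"] by simp
      qed
    qed
  qed measurable
  then show "integrable lborel (\<lambda>x. f 1 (N x))" by simp
  have intOut: "integrable lborel (\<lambda>x. indicator (\<Omega> - ?D) x * F \<epsilon> x)" if \<epsilon>: "0 < \<epsilon>" for \<epsilon>
  proof (rule Bochner_Integration.integrable_bound)
    have [measurable]: "F \<epsilon> \<in> borel_measurable borel" by (rule Fm[OF \<epsilon>])
    show "integrable lborel (\<lambda>x. K * indicator \<Omega> x :: real)"
      using fin by (intro integrable_mult_right integrable_real_indicator) auto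
    show "AE x in lborel. norm (indicator (\<Omega> - ?D) x * F \<epsilon> x) \<le> norm (K * indicator \<Omega> x)"
      using Fout[OF \<epsilon>] CK by (intro AE_I2) (auto simp: indicator_def)
    show "(\<lambda>x. indicator (\<Omega> - ?D) x * F \<epsilon> x) \<in> borel_measurable lborel" by measurable
  qed
  have intIn: "integrable lborel (\<lambda>x. indicator ?D x * f \<epsilon> (N x))"
    and intTail: "integrable lborel (\<lambda>x. indicator (- ?D) x * f \<epsilon> (N x))" if \<epsilon>: "0 < \<epsilon>" for \<epsilon>
    using integrable_mult_indicator[OF _ intf[OF \<epsilon>]] by auto
  \<comment> \<open>Only almost everywhere, since \<open>Fin\<close> says nothing at the origin,
    where a gradient may fail to exist.\<close>
  have Feq: "AE x in lborel. indicator \<Omega> x * F \<epsilon> x = indicator ?D x * f \<epsilon> (N x) + indicator (\<Omega> - ?D) x * F \<epsilon> x"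
    if \<epsilon>: "0 < \<epsilon>" for \<epsilon>
    by (rule AE_mp[OF AE_lborel_singleton[of 0]], intro AE_I2 impI)
       (use Fin[OF \<epsilon>] sub in \<open>auto simp: indicator_def\<close>)
  have Fmeas: "(\<lambda>x. indicator \<Omega> x * F \<epsilon> x) \<in> borel_measurable lborel" if "0 < \<epsilon>" for \<epsilon>
  proof -
    have [measurable]: "F \<epsilon> \<in> borel_measurable borel" by (rule Fm[OF that])
    show ?thesis by measurable
  qed
  have sumint: "integrable lborel (\<lambda>x. indicator ?D x * f \<epsilon> (N x) + indicator (\<Omega> - ?D) x * F \<epsilon> x)" if "0 < \<epsilon>" for \<epsilon>
    by (intro Bochner_Integration.integrable_add intIn intOut that)
  show "set_integrable lborel \<Omega> (F \<epsilon>)" if \<epsilon>: "0 < \<epsilon>" for \<epsilon>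
    unfolding set_integrable_def real_scaleR_def
    by (rule integrable_cong_AE_imp[OF sumint[OF \<epsilon>] Fmeas[OF \<epsilon>] AE_symmetric[OF Feq[OF \<epsilon>]]])
  \<comment> \<open>The dilation turns the main term into the integral of
    \<open>f \<epsilon>\<close> over the whole space. The parts over the gauge ball
    \<open>?D\<close> then cancel, and only the two outer integrals remain.\<close>
  have decomp: "(LINT x:\<Omega>|lborel. F \<epsilon> x) - \<epsilon> powr (real DIM('a) / q - b) * (LINT x|lborel. f 1 (N x))
      = (LINT x|lborel. indicator (\<Omega> - ?D) x * F \<epsilon> x) - (LINT x|lborel. indicator (- ?D) x * f \<epsilon> (N x))"
    if \<epsilon>: "0 < \<epsilon>" for \<epsilon>
  proof -
    define s where "s = \<epsilon> powr (1 / q)"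
    have s: "0 < s" using \<epsilon> by (simp add: s_def)
    have "(LINT x|lborel. f \<epsilon> (N x)) = s ^ DIM('a) * (LINT x|lborel. f \<epsilon> (N (s *\<^sub>R x)))"
      by (rule lborel_integral_scale[OF s]) measurable
    also have "(\<lambda>x. f \<epsilon> (N (s *\<^sub>R x))) = (\<lambda>x. \<epsilon> powr (- b) * f 1 (N x))"
      using s scaling[OF \<epsilon> nonneg] by (simp add: scale less_imp_le s_def)
    also have "s ^ DIM('a) * (LINT x|lborel. \<epsilon> powr (- b) * f 1 (N x))
        = (s ^ DIM('a) * \<epsilon> powr (- b)) * (LINT x|lborel. f 1 (N x))" by simp
    also have "s ^ DIM('a) * \<epsilon> powr (- b) = \<epsilon> powr (real DIM('a) / q - b)"
      using \<epsilon> by (simp add: s_def powr_realpow[symmetric] powr_powr powr_add[symmetric])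
    finally have sc: "\<epsilon> powr (real DIM('a) / q - b) * (LINT x|lborel. f 1 (N x)) = (LINT x|lborel. f \<epsilon> (N x))" ..
    have "(LINT x|lborel. f \<epsilon> (N x)) = (LINT x|lborel. indicator ?D x * f \<epsilon> (N x) + indicator (- ?D) x * f \<epsilon> (N x))"
      by (intro Bochner_Integration.integral_cong refl) (auto simp: indicator_def)
    also have "\<dots> = (LINT x|lborel. indicator ?D x * f \<epsilon> (N x)) + (LINT x|lborel. indicator (- ?D) x * f \<epsilon> (N x))"
      by (intro Bochner_Integration.integral_add intIn intTail \<epsilon>)
    finally have 1: "(LINT x|lborel. f \<epsilon> (N x)) = (LINT x|lborel. indicator ?D x * f \<epsilon> (N x)) + (LINT x|lborel. indicator (- ?D) x * f \<epsilon> (N x))" .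
    have "(LINT x:\<Omega>|lborel. F \<epsilon> x) = (LINT x|lborel. indicator ?D x * f \<epsilon> (N x) + indicator (\<Omega> - ?D) x * F \<epsilon> x)"
      unfolding set_lebesgue_integral_def real_scaleR_def
      by (rule integral_cong_AE) (use Fmeas[OF \<epsilon>] sumint[OF \<epsilon>] Feq[OF \<epsilon>] in auto)
    also have "\<dots> = (LINT x|lborel. indicator ?D x * f \<epsilon> (N x)) + (LINT x|lborel. indicator (\<Omega> - ?D) x * F \<epsilon> x)"
      by (intro Bochner_Integration.integral_add intIn intOut \<epsilon>)
    finally show ?thesis unfolding sc 1 by simp
  qed
  define c1 c2 where "c1 = (LINT x|lborel. K * indicator \<Omega> x)" and "c2 = (LINT x|lborel. C * ?T x)"
  have bound: "\<bar>(LINT x:\<Omega>|lborel. F \<epsilon> x) - \<epsilon> powr (real DIM('a) / q - b) * (LINT x|lborel. f 1 (N x))\<bar> \<le> c1 + c2"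
    if \<epsilon>: "0 < \<epsilon>" for \<epsilon>
  proof -
    let ?A = "LINT x|lborel. indicator (\<Omega> - ?D) x * F \<epsilon> x" and ?B = "LINT x|lborel. indicator (- ?D) x * f \<epsilon> (N x)"
    have "0 \<le> ?A" by (rule Bochner_Integration.integral_nonneg) (use Fout[OF \<epsilon>] in \<open>auto simp: indicator_def\<close>)
    moreover have "0 \<le> ?B" by (rule Bochner_Integration.integral_nonneg) (use f0 in \<open>auto simp: indicator_def\<close>)
    moreover have "?A \<le> c1" unfolding c1_def
    proof (rule integral_mono[OF intOut[OF \<epsilon>]])
      show "integrable lborel (\<lambda>x. K * indicator \<Omega> x :: real)"
        using fin by (intro integrable_mult_right integrable_real_indicator) auto
      show "indicator (\<Omega> - ?D) x * F \<epsilon> x \<le> K * indicator \<Omega> x" for x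
        using Fout[OF \<epsilon>, of x] CK by (auto simp: indicator_def)
    qed
    moreover have "?B \<le> c2" unfolding c2_def
    proof (rule integral_mono[OF intTail[OF \<epsilon>]])
      show "integrable lborel (\<lambda>x. C * ?T x)" by (intro integrable_mult_right T)
      show "indicator (- ?D) x * f \<epsilon> (N x) \<le> C * ?T x" for x
        using tail[OF \<epsilon>, of "N x"] \<rho> CK by (auto simp: indicator_def)
    qed
    ultimately show ?thesis unfolding decomp[OF \<epsilon>] by linarith
  qed
  show "(\<lambda>\<epsilon>. (LINT x:\<Omega>|lborel. F \<epsilon> x)
        - \<epsilon> powr (real DIM('a) / q - b) * (LINT x|lborel. f 1 (N x))) \<in> O[at_right 0](\<lambda>_. 1)"
    by (rule bigoI[of _ "c1 + c2"], rule eventually_mono[OF eventually_at_right_less[of 0]]) (use bound in simp)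
qed

text \<open>In the radial integral the terms \<epsilon> and \<open>t powr q\<close> balance at
  \<open>s = \<epsilon> powr (1 / q)\<close>. Beyond \<open>s\<close> the integrand is close to
  \<open>1 / t\<close>, and \<open>ln \<rho> - ln s\<close> is the logarithmic term
  \<open>\<bar>ln \<epsilon>\<bar> / q\<close> plus a constant.\<close>

lemma log_estimate:
  assumes q: "0 < q" and k: "0 \<le> k" and qk: "q * k = real DIM('a)" and \<rho>: "0 < \<rho>"
  shows "\<exists>C. \<forall>\<epsilon>. 0 < \<epsilon> \<and> \<epsilon> < 1 \<and> \<epsilon> < \<rho> powr q \<longrightarrow>
    \<bar>(LINT x:{x. N x \<le> \<rho>}|lborel. (\<epsilon> + N x powr q) powr (- k)) - real DIM('a) * volume / q * \<bar>ln \<epsilon>\<bar>\<bar> \<le> C"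
proof -
  let ?n = "real DIM('a)"
  \<comment> \<open>\<open>1 / ?n\<close> bounds the part of the radial integral below
    \<open>s\<close>, \<open>\<bar>ln \<rho>\<bar>\<close> comes from the outer radius, and
    \<open>k / q\<close> bounds the deviation from \<open>1 / t\<close> above
    \<open>s\<close>.\<close>
  define C where "C = 1 / ?n + \<bar>ln \<rho>\<bar> + k / q"
  have n: "0 < ?n" by simp
  have main: "\<bar>(LINT x:{x. N x \<le> \<rho>}|lborel. (\<epsilon> + N x powr q) powr (- k)) - ?n * volume / q * \<bar>ln \<epsilon>\<bar>\<bar> \<le> ?n * volume * C"
    if \<epsilon>: "0 < \<epsilon>" "\<epsilon> < 1" "\<epsilon> < \<rho> powr q" for \<epsilon>
  proof -
    define s where "s = \<epsilon> powr (1 / q)"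
    have s0: "0 < s" using \<epsilon> by (simp add: s_def)
    have sq: "s powr q = \<epsilon>" using \<epsilon> q by (simp add: s_def powr_powr)
    have s\<rho>: "s \<le> \<rho>"
    proof (rule ccontr)
      assume "\<not> s \<le> \<rho>"
      then have "\<rho> powr q \<le> s powr q" using \<rho> q by (intro powr_mono2) auto
      then show False using sq \<epsilon> by simp
    qed
    have lns: "ln s = - \<bar>ln \<epsilon>\<bar> / q" using \<epsilon> by (simp add: s_def ln_powr)
    \<comment> \<open>The integrand in polar coordinates, without the constant
      \<open>?n * volume\<close>.\<close>
    define h where "h t = t ^ (DIM('a) - 1) * (\<epsilon> + t powr q) powr (- k)" for t
    have hm [measurable]: "h \<in> borel_measurable borel" unfolding h_def by measurable
    have h0: "0 \<le> h t" if "0 \<le> t" for t using that by (simp add: h_def)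
    have pw: "t ^ (DIM('a) - 1) = t powr (?n - 1)" if "0 < t" for t
      using that by (simp add: powr_realpow[symmetric] of_nat_diff Suc_leI)
    have h1: "h t \<le> t ^ (DIM('a) - 1) * \<epsilon> powr (- k)" if "0 \<le> t" for t
      unfolding h_def using that \<epsilon> k
      by (intro mult_left_mono powr_mono2') auto
    have h_eq: "h t = t powr (- 1) * (1 + \<epsilon> * t powr (- q)) powr (- k)" if "0 < t" for t
    proof -
      have "\<epsilon> + t powr q = t powr q * (1 + \<epsilon> * t powr (- q))"
        using that by (simp add: algebra_simps powr_add[symmetric])
      then have "(\<epsilon> + t powr q) powr (- k) = t powr (- ?n) * (1 + \<epsilon> * t powr (- q)) powr (- k)"
        using that \<epsilon> qk by (simp add: powr_mult powr_powr)
      moreover have "t powr (?n - 1) * t powr (- ?n) = t powr (- 1)"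
      proof -
        have "?n - 1 + - ?n = - 1" by simp
        then show ?thesis by (simp only: powr_add[symmetric])
      qed
      ultimately show ?thesis by (simp only: h_def pw[OF that] mult.assoc[symmetric])
    qed
    have h2: "h t \<le> t powr (- 1)" if "0 < t" for t
    proof -
      have "(1 + \<epsilon> * t powr (- q)) powr (- k) \<le> 1 powr (- k)"
        using \<epsilon> k by (intro powr_mono2') auto
      then have "t powr (- 1) * (1 + \<epsilon> * t powr (- q)) powr (- k) \<le> t powr (- 1) * 1 powr (- k)"
        by (rule mult_left_mono) simp
      then show ?thesis unfolding h_eq[OF that] by (simp only: powr_one_eq_one mult_1_right)
    qed
    \<comment> \<open>The correction integrates over \<open>{s..\<rho>}\<close> to at most
      \<open>k * \<epsilon> / q * s powr (- q)\<close>, which is \<open>k / q\<close> because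
      \<open>s powr q = \<epsilon>\<close>.\<close>
    have h3: "t powr (- 1) \<le> h t + k * \<epsilon> * t powr (- q - 1)" if "0 < t" for t
    proof -
      have "t powr (- 1) * (1 - k * (\<epsilon> * t powr (- q))) \<le> h t"
        unfolding h_eq[OF that] using \<epsilon> k by (intro mult_left_mono one_plus_powr_neg_ge) auto
      moreover have "t powr (- 1) * t powr (- q) = t powr (- q - 1)"
      proof -
        have "- 1 + - q = - q - 1" by simp
        then show ?thesis by (simp only: powr_add[symmetric])
      qed
      moreover have "a \<le> h' + k * \<epsilon> * c" if "a * (1 - k * (\<epsilon> * b)) \<le> h'" "a * b = c" for a b c h' :: real
        using that by (auto simp: algebra_simps)
      ultimately show ?thesis by blast
    qed
    define J where "J = (\<integral>\<^sup>+t. ennreal (h t) * indicator {0..\<rho>} t \<partial>lborel)"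
    have int_inv: "(\<integral>\<^sup>+t. ennreal (t powr (- 1)) * indicator {s..\<rho>} t \<partial>lborel) = ennreal (ln \<rho> - ln s)"
    proof (rule nn_integral_FTC_Icc[where F=ln])
      fix t assume "t \<in> {s..\<rho>}"
      then have "0 < t" using s0 by simp
      then show "(ln has_real_derivative t powr (- 1)) (at t)"
        using DERIV_ln_divide[of t] by (simp add: powr_minus_divide)
    qed (use s\<rho> in auto)
    have "J \<le> (\<integral>\<^sup>+t. ennreal (t ^ (DIM('a) - 1) * \<epsilon> powr (- k)) * indicator {0..s} t
        + ennreal (t powr (- 1)) * indicator {s..\<rho>} t \<partial>lborel)"
      unfolding J_def
    proof (rule nn_integral_mono)
      fix t :: real
      show "ennreal (h t) * indicator {0..\<rho>} t \<le> ennreal (t ^ (DIM('a) - 1) * \<epsilon> powr (- k)) * indicator {0..s} t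
        + ennreal (t powr (- 1)) * indicator {s..\<rho>} t"
      proof (cases "0 \<le> t \<and> t \<le> \<rho>")
        case True
        show ?thesis
        proof (cases "t \<le> s")
          case True2: True
          have "ennreal (h t) * indicator {0..\<rho>} t \<le> ennreal (t ^ (DIM('a) - 1) * \<epsilon> powr (- k)) * indicator {0..s} t"
            using True True2 h1[of t] by (simp add: ennreal_leI)
          then show ?thesis by (rule order_trans) simp
        next
          case False
          then have "ennreal (h t) * indicator {0..\<rho>} t \<le> ennreal (t powr (- 1)) * indicator {s..\<rho>} t"
            using True h2[of t] s0 by (simp add: ennreal_leI)
          then show ?thesis by (rule order_trans) simp
        qed
      qed auto
    qed
    also have "\<dots> = (\<integral>\<^sup>+t. ennreal (t ^ (DIM('a) - 1) * \<epsilon> powr (- k)) * indicator {0..s} t \<partial>lborel)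
        + (\<integral>\<^sup>+t. ennreal (t powr (- 1)) * indicator {s..\<rho>} t \<partial>lborel)"
      by (rule nn_integral_add) measurable
    also have "(\<integral>\<^sup>+t. ennreal (t ^ (DIM('a) - 1) * \<epsilon> powr (- k)) * indicator {0..s} t \<partial>lborel)
        = ennreal (\<epsilon> powr (- k) / ?n * s ^ DIM('a) - \<epsilon> powr (- k) / ?n * 0 ^ DIM('a))"
    proof (rule nn_integral_FTC_Icc[where F="\<lambda>t. \<epsilon> powr (- k) / ?n * t ^ DIM('a)"])
      fix t :: real
      have "((\<lambda>t. t ^ DIM('a)) has_real_derivative ?n * t ^ (DIM('a) - Suc 0)) (at t)"
        by (rule DERIV_pow)
      from DERIV_cmult[OF this, of "\<epsilon> powr (- k) / ?n"]
      show "((\<lambda>t. \<epsilon> powr (- k) / ?n * t ^ DIM('a)) has_real_derivative t ^ (DIM('a) - 1) * \<epsilon> powr (- k)) (at t)"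
        by (rule DERIV_cong) simp
    qed (use s0 in auto)
    also have "\<epsilon> powr (- k) / ?n * s ^ DIM('a) - \<epsilon> powr (- k) / ?n * 0 ^ DIM('a) = 1 / ?n"
    proof -
      have "s ^ DIM('a) = s powr (q * k)" using s0 by (simp add: qk powr_realpow)
      also have "\<dots> = \<epsilon> powr k" by (simp add: powr_powr[symmetric] sq)
      finally have "\<epsilon> powr (- k) * s ^ DIM('a) = 1" using \<epsilon> by (simp add: powr_add[symmetric])
      then show ?thesis by simp
    qed
    also note int_inv
    finally have Jup: "J \<le> ennreal (1 / ?n + (ln \<rho> - ln s))"
      using s\<rho> s0 by (simp add: ennreal_plus[symmetric] del: ennreal_plus)
    then obtain j where j: "0 \<le> j" "J = ennreal j"
      by (cases J) (auto simp: top_unique)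
    have jup: "j \<le> 1 / ?n + ln \<rho> - ln s"
    proof -
      have "0 \<le> 1 / ?n + (ln \<rho> - ln s)" using s\<rho> s0 by simp
      from Jup[unfolded j(2)] ennreal_le_iff[OF this] have "j \<le> 1 / ?n + (ln \<rho> - ln s)" by blast
      then show ?thesis by simp
    qed
    have "ennreal (ln \<rho> - ln s) \<le> (\<integral>\<^sup>+t. ennreal (h t) * indicator {0..\<rho>} t
        + ennreal (k * \<epsilon> * t powr (- q - 1)) * indicator {s..\<rho>} t \<partial>lborel)"
      unfolding int_inv[symmetric]
    proof (rule nn_integral_mono)
      fix t :: real
      show "ennreal (t powr (- 1)) * indicator {s..\<rho>} t \<le> ennreal (h t) * indicator {0..\<rho>} t
        + ennreal (k * \<epsilon> * t powr (- q - 1)) * indicator {s..\<rho>} t"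
      proof (cases "s \<le> t \<and> t \<le> \<rho>")
        case True
        then have "0 < t" using s0 by linarith
        then show ?thesis using True h3[of t] h0[of t] k \<epsilon>
          by (simp add: ennreal_plus[symmetric] del: ennreal_plus)
      qed auto
    qed
    also have "\<dots> = J + (\<integral>\<^sup>+t. ennreal (k * \<epsilon> * t powr (- q - 1)) * indicator {s..\<rho>} t \<partial>lborel)"
      unfolding J_def by (rule nn_integral_add) measurable
    also have "(\<integral>\<^sup>+t. ennreal (k * \<epsilon> * t powr (- q - 1)) * indicator {s..\<rho>} t \<partial>lborel)
        = ennreal (- (k * \<epsilon> / q) * \<rho> powr (- q) - (- (k * \<epsilon> / q) * s powr (- q)))"
    proof (rule nn_integral_FTC_Icc[where F="\<lambda>t. - (k * \<epsilon> / q) * t powr (- q)"])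
      fix t assume "t \<in> {s..\<rho>}"
      then have "0 < t" using s0 by simp
      then have "((\<lambda>t. t powr (- q)) has_real_derivative (- q) * t powr (- q - 1)) (at t)"
        by (rule has_real_derivative_powr)
      from DERIV_cmult[OF this, of "- (k * \<epsilon> / q)"]
      show "((\<lambda>t. - (k * \<epsilon> / q) * t powr (- q)) has_real_derivative k * \<epsilon> * t powr (- q - 1)) (at t)"
        by (rule DERIV_cong) (use q in simp)
    qed (use s\<rho> k \<epsilon> in auto)
    also have "\<dots> \<le> ennreal (k / q)"
    proof (rule ennreal_leI)
      have "s powr (- q) = 1 / \<epsilon>" by (simp add: powr_minus_divide sq)
      moreover have "0 \<le> k * \<epsilon> / q * \<rho> powr (- q)" using k \<epsilon> q by simp
      ultimately show "- (k * \<epsilon> / q) * \<rho> powr (- q) - (- (k * \<epsilon> / q) * s powr (- q)) \<le> k / q"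
        using \<epsilon> by simp
    qed
    finally have "ennreal (ln \<rho> - ln s) \<le> J + ennreal (k / q)" by (simp add: add_left_mono)
    then have jlow: "ln \<rho> - ln s \<le> j + k / q"
      using j k q s\<rho> s0 by (simp add: ennreal_plus[symmetric] ennreal_le_iff del: ennreal_plus)
    have diff: "\<bar>j - \<bar>ln \<epsilon>\<bar> / q\<bar> \<le> C"
    proof -
      have "j \<le> 1 / ?n + ln \<rho> + \<bar>ln \<epsilon>\<bar> / q" using jup by (simp add: lns)
      moreover have "ln \<rho> + \<bar>ln \<epsilon>\<bar> / q \<le> j + k / q" using jlow by (simp add: lns)
      moreover have "0 \<le> k / q" "0 \<le> 1 / ?n" using k q by simp_all
      ultimately show ?thesis unfolding C_def by linarith
    qed
    let ?w = "\<lambda>x. indicator {x. N x \<le> \<rho>} x * (\<epsilon> + N x powr q) powr (- k)"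
    have "(\<integral>\<^sup>+x. ennreal (?w x) \<partial>lborel) =
        (\<integral>\<^sup>+x. (\<lambda>t. ennreal (indicator {..\<rho>} t * (\<epsilon> + t powr q) powr (- k))) (N x) \<partial>lborel)"
      by (intro nn_integral_cong) (auto simp: indicator_def)
    also have "\<dots> = (\<integral>\<^sup>+t. ennreal (?n * volume * t ^ (DIM('a) - 1)) * indicator {0..} t
        * ennreal (indicator {..\<rho>} t * (\<epsilon> + t powr q) powr (- k)) \<partial>lborel)"
      by (rule nn_integral_N) measurable
    also have "\<dots> = (\<integral>\<^sup>+t. ennreal (?n * volume) * (ennreal (h t) * indicator {0..\<rho>} t) \<partial>lborel)"
    proof (intro nn_integral_cong)
      fix t :: real
      show "ennreal (?n * volume * t ^ (DIM('a) - 1)) * indicator {0..} t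
        * ennreal (indicator {..\<rho>} t * (\<epsilon> + t powr q) powr (- k)) = ennreal (?n * volume) * (ennreal (h t) * indicator {0..\<rho>} t)"
      proof (cases "0 \<le> t \<and> t \<le> \<rho>")
        case True
        then show ?thesis using volume_nonneg
          by (simp add: h_def ennreal_mult'[symmetric] mult.assoc)
      qed auto
    qed
    also have "\<dots> = ennreal (?n * volume) * J"
      unfolding J_def by (rule nn_integral_cmult) measurable
    also have "\<dots> = ennreal (?n * volume * j)"
      using j volume_nonneg by (simp add: ennreal_mult)
    finally have nn: "(\<integral>\<^sup>+x. ennreal (?w x) \<partial>lborel) = ennreal (?n * volume * j)" .
    have "(LINT x:{x. N x \<le> \<rho>}|lborel. (\<epsilon> + N x powr q) powr (- k)) = enn2real (\<integral>\<^sup>+x. ennreal (?w x) \<partial>lborel)"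
      unfolding set_lebesgue_integral_def real_scaleR_def
      by (rule integral_eq_nn_integral) auto
    also have "\<dots> = ?n * volume * j" unfolding nn using j volume_nonneg by simp
    finally have "(LINT x:{x. N x \<le> \<rho>}|lborel. (\<epsilon> + N x powr q) powr (- k)) - ?n * volume / q * \<bar>ln \<epsilon>\<bar>
        = ?n * volume * (j - \<bar>ln \<epsilon>\<bar> / q)" by (simp add: algebra_simps)
    then show ?thesis using diff volume_nonneg by (simp add: abs_mult mult_left_mono)
  qed
  then show ?thesis by blast
qed

end

section \<open>The truncated extremals\<close>

lemma has_derivative_grad:
  fixes f :: "'a::euclidean_space \<Rightarrow> real"
  assumes "f differentiable (at x)"
  shows "(f has_derivative (\<lambda>h. grad f x \<bullet> h)) (at x)"
proof -
  let ?D = "frechet_derivative f (at x)"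
  have D: "(f has_derivative ?D) (at x)"
    using assms by (simp add: frechet_derivative_works)
  then have lin: "linear ?D" by (rule has_derivative_linear)
  have "?D h = grad f x \<bullet> h" for h
  proof -
    have "?D h = ?D (\<Sum>b\<in>Basis. (h \<bullet> b) *\<^sub>R b)" by (simp add: euclidean_representation)
    also have "\<dots> = (\<Sum>b\<in>Basis. (h \<bullet> b) * ?D b)"
      by (simp add: linear_sum[OF lin] linear_scale[OF lin])
    also have "\<dots> = (\<Sum>b\<in>Basis. ?D b * (b \<bullet> h))" by (simp add: inner_commute mult.commute)
    also have "\<dots> = grad f x \<bullet> h" by (simp add: grad_def inner_sum_left)
    finally show ?thesis .
  qed
  then have "?D = (\<lambda>h. grad f x \<bullet> h)" by (rule ext)
  with D show ?thesis by simp
qed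

lemma grad_eqI:
  fixes f :: "'a::euclidean_space \<Rightarrow> real"
  assumes "(f has_derivative (\<lambda>h. v \<bullet> h)) (at x)"
  shows "grad f x = v"
  unfolding grad_def frechet_derivative_at[OF assms, symmetric] by (rule euclidean_representation)

text \<open>The gradients below are computed off the origin; at the origin \<open>grad\<close> may
  be an unspecified value, and one point does not affect measurability.\<close>

lemma borel_measurable_off_point:
  fixes h h' :: "'a::euclidean_space \<Rightarrow> real"
  assumes [measurable]: "h' \<in> borel_measurable borel" and eq: "\<And>x. x \<noteq> a \<Longrightarrow> h x = h' x"
  shows "h \<in> borel_measurable borel"
proof -
  have "(\<lambda>x. if x = a then h a else h' x) \<in> borel_measurable borel" by measurable
  also have "(\<lambda>x. if x = a then h a else h' x) = h" using eq by auto
  finally show ?thesis .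
qed

context aniso
begin

sublocale gauge: smooth_gauge "dual_norm_hat H" hat_grad
  by (rule smooth_gauge_hat)

lemma H_upper:
  obtains M where "0 < M" "\<And>x. H x \<le> M * norm x"
proof -
  let ?S = "sphere (0::'a) 1"
  have ne: "?S \<noteq> {}" by simp
  have cont: "continuous_on ?S H" by (rule continuous_on_subset[OF continuous_H]) auto
  obtain a where a: "a \<in> ?S" "\<And>y. y \<in> ?S \<Longrightarrow> H y \<le> H a"
    using continuous_attains_sup[OF compact_sphere ne cont] by auto
  have "H x \<le> H a * norm x" for x
  proof (cases "x = 0")
    case False
    then have "H x = norm x * H (sgn x)" using H_scale_pos[of "norm x" "sgn x"] by (simp add: sgn_div_norm)
    moreover have "H (sgn x) \<le> H a" using False by (intro a) (simp add: norm_sgn)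
    ultimately show ?thesis
      using mult_left_mono[of "H (sgn x)" "H a" "norm x"] by (simp add: mult.commute)
  qed simp
  moreover have "0 < H a" using a(1) by (intro H_pos) auto
  ultimately show ?thesis using that by blast
qed

lemma borel_measurable_H [measurable]: "H \<in> borel_measurable borel"
  using continuous_H by (rule borel_measurable_continuous_onI)

end

section \<open>The radial profile: derivative, decay and scaling\<close>

locale bubble = aniso H for H :: "real^'n \<Rightarrow> real" +
  fixes p n :: real
  assumes n_def: "n = real CARD('n)" and p1: "1 < p" and pn: "p < n"
begin

abbreviation "N \<equiv> dual_norm_hat H"

definition "q = p / (p - 1)"
definition "k = (n - p) / p"

lemma q_pos: "0 < q" and k_pos: "0 < k" and inverse_q: "1 / q = (p - 1) / p"
  and q_minus_1: "q - 1 = 1 / (p - 1)" and q_gt_1: "1 < q"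
  using p1 pn by (auto simp: q_def k_def field_simps)

lemma n_pos: "0 < n" using p1 pn by simp

lemma dim: "real DIM(real^'n) = n" by (simp add: n_def)

definition w :: "real \<Rightarrow> real^'n \<Rightarrow> real" where
  "w \<epsilon> x = (\<epsilon> + N x powr q) powr (- k)"

text \<open>Minus the derivative of \<open>(\<epsilon> + t powr q) powr (- k)\<close> with respect
  to \<open>t > 0\<close>, so that \<open>H\<close> of the gradient of \<open>w \<epsilon>\<close>
  is \<open>slope \<epsilon> (N x)\<close> off the origin.\<close>

definition slope :: "real \<Rightarrow> real \<Rightarrow> real" where
  "slope \<epsilon> t = k * q * (t powr (q - 1) * (\<epsilon> + t powr q) powr (- k - 1))"

lemma borel_measurable_w [measurable]: "w \<epsilon> \<in> borel_measurable borel"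
  unfolding w_def[abs_def] by measurable

lemma borel_measurable_slope [measurable]: "slope \<epsilon> \<in> borel_measurable borel"
  unfolding slope_def[abs_def] by measurable

lemma w_nonneg: "0 \<le> w \<epsilon> x" by (simp add: w_def)

lemma slope_nonneg: "0 \<le> slope \<epsilon> t"
  using q_pos k_pos by (simp add: slope_def)

lemma eta_eq: "eta H p \<phi> \<epsilon> x = \<phi> x * w \<epsilon> x"
  by (simp add: eta_def w_def q_def k_def n_def[symmetric] dual_norm_hat_def powr_minus_divide)

lemma c_const_pos: "0 < c_const n p"
  using p1 pn by (simp add: c_const_def)

lemma U_ext_eq: "U_ext H p x = c_const n p powr k * w 1 x"
proof -
  have "0 \<le> 1 + N x powr q" by (simp add: add_nonneg_nonneg)
  then show ?thesis using c_const_pos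
    by (simp add: U_ext_def w_def q_def k_def n_def[symmetric] powr_minus_divide powr_divide)
qed

lemma w_has_derivative:
  assumes "0 < \<epsilon>" "x \<noteq> 0"
  shows "(w \<epsilon> has_derivative (\<lambda>h. (- slope \<epsilon> (N x) *\<^sub>R hat_grad x) \<bullet> h)) (at x)"
proof -
  have N: "0 < N x" using assms by (intro gauge.pos)
  have pos: "0 < \<epsilon> + N x powr q" using assms by (simp add: add_pos_nonneg)
  have "((\<lambda>t. \<epsilon> + t powr q) has_real_derivative q * N x powr (q - 1)) (at (N x))"
    using has_real_derivative_powr[OF N, of q] N by (auto intro!: derivative_eq_intros)
  from DERIV_chain'[OF this has_real_derivative_powr[OF pos, of "- k"]]
  have "((\<lambda>t. (\<epsilon> + t powr q) powr (- k)) has_real_derivative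
      - k * (\<epsilon> + N x powr q) powr (- k - 1) * (q * N x powr (q - 1))) (at (N x))" by (simp add: mult.commute)
  from DERIV_compose_FDERIV[OF this gauge.N_has_derivative[OF assms(2)]]
  show ?thesis
    unfolding w_def[abs_def] slope_def by (rule has_derivative_eq_rhs) (auto simp: mult_ac)
qed

lemma H_minus_hat_grad:
  assumes "0 \<le> t"
  shows "H (- t *\<^sub>R hat_grad x) = t"
proof (cases "t = 0")
  case False
  then show ?thesis using assms H_scale_pos[of t "- hat_grad x"] by (simp add: H_hat_grad)
qed simp

lemma q_k_1: "q * (k + 1) = n / (p - 1)"
  using p1 by (simp add: q_def k_def field_simps)

lemma base_powr_le:
  assumes "0 < \<epsilon>" "0 < t" "0 \<le> e"
  shows "(\<epsilon> + t powr q) powr (- e) \<le> t powr (- (q * e))"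
proof -
  have "(\<epsilon> + t powr q) powr (- e) \<le> (t powr q) powr (- e)"
    using assms by (intro powr_mono2') auto
  then show ?thesis by (simp add: powr_powr)
qed

text \<open>Dropping \<epsilon> from the base leaves the exponent
  \<open>q - 1 - q * (k + 1) = - ((n - 1) / (p - 1))\<close>. Its \<open>p\<close>-th power decays
  faster than \<open>t powr (- n)\<close> precisely because \<open>p < n\<close>.\<close>

lemma slope_le:
  assumes "0 < \<epsilon>" "0 < t"
  shows "slope \<epsilon> t \<le> k * q * t powr (- ((n - 1) / (p - 1)))"
proof -
  have "(\<epsilon> + t powr q) powr (- k - 1) \<le> t powr (- (q * (k + 1)))"
    using base_powr_le[OF assms, of "k + 1"] k_pos by simp
  then have "t powr (q - 1) * (\<epsilon> + t powr q) powr (- k - 1) \<le> t powr (q - 1) * t powr (- (q * (k + 1)))"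
    by (rule mult_left_mono) simp
  also have "\<dots> = t powr (- ((n - 1) / (p - 1)))"
    by (simp add: powr_add[symmetric] q_k_1 q_minus_1 diff_divide_distrib)
  finally show ?thesis unfolding slope_def using q_pos k_pos by (intro mult_left_mono) auto
qed

lemma slope_1_le:
  assumes "0 \<le> t"
  shows "slope 1 t \<le> k * q"
proof -
  consider "t = 0" | "0 < t" "t \<le> 1" | "1 < t" using assms by linarith
  then show ?thesis
  proof cases
    case 1
    then show ?thesis using q_pos k_pos by (simp add: slope_def)
  next
    case 2
    have "t powr (q - 1) \<le> 1 powr (q - 1)" using 2 q_gt_1 by (intro powr_mono2) auto
    moreover have "(1 + t powr q) powr (- k - 1) \<le> 1 powr (- k - 1)"
      using k_pos by (intro powr_mono2') auto
    ultimately have "t powr (q - 1) * (1 + t powr q) powr (- k - 1) \<le> 1 * 1"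
      by (intro mult_mono) auto
    then show ?thesis using q_pos k_pos by (simp add: slope_def)
  next
    case 3
    have "t powr (- ((n - 1) / (p - 1))) \<le> 1 powr (- ((n - 1) / (p - 1)))"
      using 3 p1 pn by (intro powr_mono2') auto
    then have "k * q * t powr (- ((n - 1) / (p - 1))) \<le> k * q * 1"
      using q_pos k_pos by (intro mult_left_mono) auto
    then show ?thesis using slope_le[of 1 t] 3 by simp
  qed
qed

lemma base_scaling:
  assumes "0 < \<epsilon>" "0 \<le> t"
  shows "(\<epsilon> + (\<epsilon> powr (1 / q) * t) powr q) powr e = \<epsilon> powr e * (1 + t powr q) powr e"
proof -
  have "(\<epsilon> powr (1 / q) * t) powr q = \<epsilon> * t powr q"
    using assms q_pos by (simp add: powr_mult powr_powr)
  then have "\<epsilon> + (\<epsilon> powr (1 / q) * t) powr q = \<epsilon> * (1 + t powr q)" by (simp add: algebra_simps)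
  then show ?thesis using assms by (simp add: powr_mult add_nonneg_nonneg)
qed

lemma slope_scaling:
  assumes "0 < \<epsilon>" "0 \<le> t"
  shows "slope \<epsilon> (\<epsilon> powr (1 / q) * t) = \<epsilon> powr (- ((n - 1) / p)) * slope 1 t"
proof -
  have "(1 / q) * (q - 1) = 1 / p"
    using p1 by (simp add: q_def field_simps)
  then have "(\<epsilon> powr (1 / q) * t) powr (q - 1) = \<epsilon> powr (1 / p) * t powr (q - 1)"
    using assms by (simp add: powr_mult powr_powr)
  moreover have "\<epsilon> powr (1 / p) * \<epsilon> powr (- k - 1) = \<epsilon> powr (- ((n - 1) / p))"
  proof -
    have "1 / p + (- k - 1) = - ((n - 1) / p)" using p1 by (simp add: k_def field_simps)
    then show ?thesis by (simp only: powr_add[symmetric])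
  qed
  ultimately show ?thesis
    unfolding slope_def base_scaling[OF assms] by (simp add: mult_ac)
qed

lemma volume_pos: "0 < gauge.volume" by (rule gauge.volume_pos)

lemma omega_eq: "omega H = n * gauge.volume"
proof -
  \<comment> \<open>\<open>1 < p < n\<close> excludes dimension one, where \<open>'n minus1\<close>
    would have the wrong cardinality.\<close>
  have "CARD('n) \<noteq> 1" using p1 pn by (auto simp: n_def)
  then have "CARD('n) = Suc CARD('n minus1)" by (rule card_minus1)
  then have "DIM(real^'n) = Suc DIM(real^('n minus1))" "CARD('n) - 1 = DIM(real^('n minus1))" by simp_all
  then show ?thesis
    unfolding omega_def using gauge.surface_integral_eq[where 'b="real^('n minus1)"] by (simp add: n_def)
qed

end

section \<open>The cut-off function and the gradient of the truncated profile\<close>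

locale cutoff = bubble H p n for H :: "real^'n \<Rightarrow> real" and p n +
  fixes \<Omega> :: "(real^'n) set" and \<phi> :: "real^'n \<Rightarrow> real" and r :: real
  assumes open_\<Omega>: "open \<Omega>" and bounded_\<Omega>: "bounded \<Omega>"
    and test: "test_function \<Omega> \<phi>" and \<phi>_range: "\<And>x. 0 \<le> \<phi> x \<and> \<phi> x \<le> 1"
    and r: "0 < r" and ball_\<Omega>: "closure (ball 0 r) \<subseteq> \<Omega>" and \<phi>_ball: "\<And>x. x \<in> ball 0 r \<Longrightarrow> \<phi> x = 1"
begin

lemma borel_\<Omega> [measurable]: "\<Omega> \<in> sets borel"
  using open_\<Omega> by simp

lemma emeasure_\<Omega>_finite: "emeasure lborel \<Omega> < \<infinity>"
  using emeasure_bounded_finite[OF bounded_\<Omega>] by simp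

lemma \<phi>_Ck: "Ck_on m \<phi> UNIV"
  using test by (auto simp: test_function_def smooth_on_def)

lemma continuous_\<phi>: "continuous_on UNIV \<phi>"
  using \<phi>_Ck[of 0] by simp

lemma borel_measurable_\<phi> [measurable]: "\<phi> \<in> borel_measurable borel"
  using continuous_\<phi> by (rule borel_measurable_continuous_onI)

lemma \<phi>_has_derivative: "(\<phi> has_derivative (\<lambda>h. grad \<phi> x \<bullet> h)) (at x)"
  using \<phi>_Ck[of 1] by (intro has_derivative_grad) simp

lemma continuous_grad_\<phi>: "continuous_on UNIV (grad \<phi>)"
  unfolding grad_def[abs_def] using \<phi>_Ck[of 1] by (intro continuous_intros) auto

lemma borel_measurable_grad_\<phi> [measurable]: "grad \<phi> \<in> borel_measurable borel"
  using continuous_grad_\<phi> by (rule borel_measurable_continuous_onI)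

lemma grad_\<phi>_bound:
  obtains M where "0 \<le> M" "\<And>x. x \<in> \<Omega> \<Longrightarrow> norm (grad \<phi> x) \<le> M"
proof -
  have "compact (grad \<phi> ` closure \<Omega>)"
    using bounded_\<Omega> by (intro compact_continuous_image continuous_on_subset[OF continuous_grad_\<phi>]) (auto simp: compact_closure)
  then obtain M where "\<forall>y\<in>grad \<phi> ` closure \<Omega>. norm y \<le> M"
    using compact_imp_bounded bounded_iff by blast
  then have "norm (grad \<phi> x) \<le> max M 0" if "x \<in> \<Omega>" for x
    using closure_subset[of \<Omega>] that by (auto simp: le_max_iff_disj)
  then show ?thesis by (intro that[of "max M 0"]) auto
qed

lemma inner_radius:
  obtains \<rho> where "0 < \<rho>" "{x. N x \<le> \<rho>} \<subseteq> ball 0 r"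
proof -
  obtain m M where m: "0 < m" "\<And>x. m * norm x \<le> N x" by (rule gauge.bounds) blast
  show ?thesis
  proof
    show "0 < m * r / 2" using m r by simp
    show "{x. N x \<le> m * r / 2} \<subseteq> ball 0 r"
    proof
      fix x assume "x \<in> {x. N x \<le> m * r / 2}"
      then have "m * norm x \<le> m * (r / 2)" using m(2)[of x] by simp
      then have "norm x \<le> r / 2" using m(1) by simp
      then show "x \<in> ball 0 r" using r by simp
    qed
  qed
qed

lemma ball_subset: "ball 0 r \<subseteq> \<Omega>"
  using ball_\<Omega> closure_subset by blast

abbreviation "\<eta> \<equiv> eta H p \<phi>"

lemma eta_nonneg: "0 \<le> \<eta> \<epsilon> x"
  using \<phi>_range w_nonneg by (simp add: eta_eq)

lemma eta_le_w: "\<eta> \<epsilon> x \<le> w \<epsilon> x"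
  using mult_right_mono[of "\<phi> x" 1 "w \<epsilon> x"] \<phi>_range w_nonneg by (simp add: eta_eq)

lemma eta_ball: "x \<in> ball 0 r \<Longrightarrow> \<eta> \<epsilon> x = w \<epsilon> x"
  by (simp add: eta_eq \<phi>_ball)

lemma borel_measurable_eta [measurable]: "\<eta> \<epsilon> \<in> borel_measurable borel"
proof -
  have "\<eta> \<epsilon> = (\<lambda>x. \<phi> x * w \<epsilon> x)" by (rule ext) (rule eta_eq)
  then show ?thesis by simp
qed

lemma grad_eta:
  assumes "0 < \<epsilon>" "x \<noteq> 0"
  shows "grad (\<eta> \<epsilon>) x = w \<epsilon> x *\<^sub>R grad \<phi> x - (\<phi> x * slope \<epsilon> (N x)) *\<^sub>R hat_grad x"
proof (rule grad_eqI)
  have eq: "\<eta> \<epsilon> = (\<lambda>x. \<phi> x * w \<epsilon> x)" by (rule ext) (rule eta_eq)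
  show "(\<eta> \<epsilon> has_derivative (\<lambda>h. (w \<epsilon> x *\<^sub>R grad \<phi> x - (\<phi> x * slope \<epsilon> (N x)) *\<^sub>R hat_grad x) \<bullet> h)) (at x)"
    unfolding eq
    by (rule has_derivative_eq_rhs[OF has_derivative_mult[OF \<phi>_has_derivative w_has_derivative[OF assms]]])
       (auto simp: inner_diff_left mult_ac)
qed

lemma grad_eta_ball:
  assumes "0 < \<epsilon>" "x \<noteq> 0" "x \<in> ball 0 r"
  shows "grad (\<eta> \<epsilon>) x = - slope \<epsilon> (N x) *\<^sub>R hat_grad x"
proof (rule grad_eqI)
  show "(\<eta> \<epsilon> has_derivative (\<lambda>h. (- slope \<epsilon> (N x) *\<^sub>R hat_grad x) \<bullet> h)) (at x)"
    by (rule has_derivative_transform_within_open[OF w_has_derivative[OF assms(1,2)] open_ball assms(3)])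
       (simp add: eta_ball)
qed

lemma borel_measurable_H_grad_eta:
  assumes "0 < \<epsilon>"
  shows "(\<lambda>x. H (grad (\<eta> \<epsilon>) x)) \<in> borel_measurable borel"
  by (rule borel_measurable_off_point[where a=0 and
        h'="\<lambda>x. H (w \<epsilon> x *\<^sub>R grad \<phi> x - (\<phi> x * slope \<epsilon> (N x)) *\<^sub>R hat_grad x)"])
     (use assms in \<open>measurable, simp add: grad_eta\<close>)

lemma borel_measurable_H_grad_U: "(\<lambda>x. H (grad (U_ext H p) x)) \<in> borel_measurable borel"
  and H_grad_U: "x \<noteq> 0 \<Longrightarrow> H (grad (U_ext H p) x) = c_const n p powr k * slope 1 (N x)"
proof -
  have eq: "U_ext H p = (\<lambda>x. c_const n p powr k * w 1 x)" by (rule ext) (rule U_ext_eq)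
  have *: "H (grad (U_ext H p) x) = c_const n p powr k * slope 1 (N x)" if "x \<noteq> 0" for x
  proof -
    have "(U_ext H p has_derivative (\<lambda>h. (- (c_const n p powr k * slope 1 (N x)) *\<^sub>R hat_grad x) \<bullet> h)) (at x)"
      unfolding eq
      by (rule has_derivative_eq_rhs[OF has_derivative_mult_right[OF w_has_derivative[OF zero_less_one that]]]) auto
    then have "grad (U_ext H p) x = - (c_const n p powr k * slope 1 (N x)) *\<^sub>R hat_grad x"
      by (rule grad_eqI)
    then show ?thesis using slope_nonneg by (simp only: H_minus_hat_grad mult_nonneg_nonneg powr_ge_zero)
  qed
  then show "x \<noteq> 0 \<Longrightarrow> H (grad (U_ext H p) x) = c_const n p powr k * slope 1 (N x)" .
  show "(\<lambda>x. H (grad (U_ext H p) x)) \<in> borel_measurable borel"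
    by (rule borel_measurable_off_point[where a=0 and h'="\<lambda>x. c_const n p powr k * slope 1 (N x)"])
       (measurable, rule *)
qed

section \<open>The asymptotic expansions\<close>

lemma gradient_expansion:
  shows "\<And>\<epsilon>. 0 < \<epsilon> \<Longrightarrow> in_Lp p \<Omega> (\<lambda>x. H (grad (\<eta> \<epsilon>) x))"
    and "in_Lp p UNIV (\<lambda>x. H (grad (U_ext H p) x))"
    and "(\<lambda>\<epsilon>. Lp_norm p \<Omega> (\<lambda>x. H (grad (\<eta> \<epsilon>) x)) powr p
        - 1 / (c_const n p powr (n - p) * \<epsilon> powr ((n - p) / p))
          * Lp_norm p UNIV (\<lambda>x. H (grad (U_ext H p) x)) powr p) \<in> O[at_right 0](\<lambda>_. 1)"
proof -
  obtain \<rho> where \<rho>: "0 < \<rho>" "{x. N x \<le> \<rho>} \<subseteq> ball 0 r" by (rule inner_radius)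
  obtain MH where MH: "0 < MH" "\<And>x. H x \<le> MH * norm x" by (rule H_upper) blast
  obtain m MN where MN: "0 < MN" "\<And>x. N x \<le> MN * norm x" by (rule gauge.bounds) blast
  obtain M\<phi> where M\<phi>: "0 \<le> M\<phi>" "\<And>x. x \<in> \<Omega> \<Longrightarrow> norm (grad \<phi> x) \<le> M\<phi>" by (rule grad_\<phi>_bound) blast
  \<comment> \<open>\<open>?a\<close> is \<open>p\<close> times the decay rate of the slope.
    \<open>?K\<close> bounds the integrand away from the origin by the product rule: one term for
    the derivative of the cut-off and one for that of the profile, where \<open>MN\<close> bounds
    \<open>hat_grad\<close>.\<close>
  let ?a = "p * ((n - 1) / (p - 1))"
  let ?C = "(k * q) powr p"
  let ?K = "(MH * (\<rho> powr (- (q * k)) * M\<phi> + k * q * \<rho> powr (- ((n - 1) / (p - 1))) * MN)) powr p"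
  let ?f = "\<lambda>\<epsilon> t. slope \<epsilon> t powr p"
  let ?F = "\<lambda>\<epsilon> x. \<bar>H (grad (\<eta> \<epsilon>) x)\<bar> powr p"
  have a: "real DIM(real^'n) < ?a"
  proof -
    have "n * (p - 1) < p * (n - 1)" using pn by (simp add: algebra_simps)
    then show ?thesis unfolding dim using p1 by (simp add: pos_less_divide_eq)
  qed
  have sub: "{x. N x \<le> \<rho>} \<subseteq> \<Omega>" using \<rho> ball_subset by blast
  have tail: "?f \<epsilon> t \<le> ?C * t powr (- ?a)" if "0 < \<epsilon>" "0 < t" for \<epsilon> t
  proof -
    have "?f \<epsilon> t \<le> (k * q * t powr (- ((n - 1) / (p - 1)))) powr p"
      using slope_le[OF that] slope_nonneg p1 by (intro powr_mono2) auto
    also have "\<dots> = ?C * t powr (- ?a)" using k_pos q_pos by (simp add: powr_mult powr_powr mult.commute)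
    finally show ?thesis .
  qed
  have bound1: "?f 1 t \<le> ?C" if "0 \<le> t" for t
    using slope_1_le[OF that] slope_nonneg p1 by (intro powr_mono2) auto
  have scaling: "?f \<epsilon> (\<epsilon> powr (1 / q) * t) = \<epsilon> powr (- (n - 1)) * ?f 1 t" if "0 < \<epsilon>" "0 \<le> t" for \<epsilon> t
  proof -
    have "- ((n - 1) / p) * p = - (n - 1)" using p1 by simp
    then show ?thesis
      using that slope_nonneg by (simp only: slope_scaling powr_mult powr_ge_zero powr_powr)
  qed
  have Fin: "?F \<epsilon> x = ?f \<epsilon> (N x)" if "0 < \<epsilon>" "x \<noteq> 0" "N x \<le> \<rho>" for \<epsilon> x
  proof -
    have "x \<in> ball 0 r" using \<rho> that by auto
    then have "H (grad (\<eta> \<epsilon>) x) = slope \<epsilon> (N x)"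
      by (simp only: grad_eta_ball[OF that(1,2)] H_minus_hat_grad[OF slope_nonneg])
    then show ?thesis using slope_nonneg by simp
  qed
  have Fout: "0 \<le> ?F \<epsilon> x \<and> ?F \<epsilon> x \<le> ?K" if "0 < \<epsilon>" "x \<in> \<Omega>" "\<rho> < N x" for \<epsilon> x
  proof -
    have x0: "x \<noteq> 0" using that \<rho> by auto
    have Nx: "0 < N x" using that \<rho> by simp
    have w: "w \<epsilon> x \<le> \<rho> powr (- (q * k))"
    proof -
      have "w \<epsilon> x \<le> N x powr (- (q * k))"
        unfolding w_def using that(1) Nx k_pos by (intro base_powr_le) auto
      also have "\<dots> \<le> \<rho> powr (- (q * k))" using that \<rho> q_pos k_pos by (intro powr_mono2') auto
      finally show ?thesis .
    qed
    have s: "slope \<epsilon> (N x) \<le> k * q * \<rho> powr (- ((n - 1) / (p - 1)))"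
    proof -
      have "slope \<epsilon> (N x) \<le> k * q * N x powr (- ((n - 1) / (p - 1)))" by (rule slope_le[OF that(1) Nx])
      also have "\<dots> \<le> k * q * \<rho> powr (- ((n - 1) / (p - 1)))"
        using that \<rho> p1 pn q_pos k_pos by (intro mult_left_mono powr_mono2') auto
      finally show ?thesis .
    qed
    have "\<phi> x * slope \<epsilon> (N x) \<le> 1 * slope \<epsilon> (N x)" using \<phi>_range slope_nonneg by (intro mult_right_mono) auto
    then have s': "\<phi> x * slope \<epsilon> (N x) \<le> k * q * \<rho> powr (- ((n - 1) / (p - 1)))" using s by simp
    have "norm (grad (\<eta> \<epsilon>) x) \<le> norm (w \<epsilon> x *\<^sub>R grad \<phi> x) + norm ((\<phi> x * slope \<epsilon> (N x)) *\<^sub>R hat_grad x)"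
      unfolding grad_eta[OF that(1) x0] by (rule norm_triangle_ineq4)
    also have "\<dots> = w \<epsilon> x * norm (grad \<phi> x) + (\<phi> x * slope \<epsilon> (N x)) * norm (hat_grad x)"
      using \<phi>_range[of x] by (simp add: w_nonneg slope_nonneg)
    also have "\<dots> \<le> \<rho> powr (- (q * k)) * M\<phi> + k * q * \<rho> powr (- ((n - 1) / (p - 1))) * MN"
    proof (rule add_mono)
      show "w \<epsilon> x * norm (grad \<phi> x) \<le> \<rho> powr (- (q * k)) * M\<phi>"
        by (rule mult_mono[OF w M\<phi>(2)[OF that(2)]]) auto
      show "(\<phi> x * slope \<epsilon> (N x)) * norm (hat_grad x) \<le> k * q * \<rho> powr (- ((n - 1) / (p - 1))) * MN"
        by (rule mult_mono[OF s' gauge.norm_g_le[OF MN(2) x0]]) (use k_pos q_pos in auto)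
    qed
    finally have "MH * norm (grad (\<eta> \<epsilon>) x) \<le> MH * (\<rho> powr (- (q * k)) * M\<phi> + k * q * \<rho> powr (- ((n - 1) / (p - 1))) * MN)"
      using MH(1) by (intro mult_left_mono) auto
    then have "\<bar>H (grad (\<eta> \<epsilon>) x)\<bar> \<le> MH * (\<rho> powr (- (q * k)) * M\<phi> + k * q * \<rho> powr (- ((n - 1) / (p - 1))) * MN)"
      using MH(2)[of "grad (\<eta> \<epsilon>) x"] H_nonneg[of "grad (\<eta> \<epsilon>) x"] by simp
    then show ?thesis using p1 by (intro conjI powr_mono2) auto
  qed
  have Fm: "?F \<epsilon> \<in> borel_measurable borel" if "0 < \<epsilon>" for \<epsilon>
  proof -
    note borel_measurable_H_grad_eta[OF that, measurable]
    show ?thesis by measurable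
  qed
  have fm: "?f \<epsilon> \<in> borel_measurable borel" for \<epsilon> by measurable
  note trunc = gauge.truncation_estimate[where f="?f" and F="?F" and B="?C" and C="?C" and K="?K" and q=q and b="n - 1",
      OF a \<rho>(1) powr_ge_zero powr_ge_zero borel_\<Omega> emeasure_\<Omega>_finite sub fm powr_ge_zero bound1 tail scaling Fm Fin Fout]
  have est: "integrable lborel (\<lambda>x. ?f 1 (N x))"
    "\<And>\<epsilon>. 0 < \<epsilon> \<Longrightarrow> set_integrable lborel \<Omega> (?F \<epsilon>)"
    "(\<lambda>\<epsilon>. (LINT x:\<Omega>|lborel. ?F \<epsilon> x)
        - \<epsilon> powr (real DIM(real^'n) / q - (n - 1)) * (LINT x|lborel. ?f 1 (N x))) \<in> O[at_right 0](\<lambda>_. 1)"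
    by ((rule trunc(1); assumption), (rule trunc(2); assumption), (rule trunc(3); assumption))
  show "in_Lp p \<Omega> (\<lambda>x. H (grad (\<eta> \<epsilon>) x))" if "0 < \<epsilon>" for \<epsilon>
    unfolding in_Lp_def using est(2)[OF that] by (simp add: set_integrable_lebesgue_iff[OF Fm[OF that] borel_\<Omega>])
  let ?c = "c_const n p powr (n - p)"
  let ?U = "\<lambda>x. \<bar>H (grad (U_ext H p) x)\<bar> powr p"
  have Um: "?U \<in> borel_measurable borel"
    using borel_measurable_H_grad_U by measurable
  have Ueq: "AE x in lborel. ?c * ?f 1 (N x) = ?U x"
  proof (rule AE_mp[OF AE_lborel_singleton[of 0]], intro AE_I2 impI)
    fix x :: "real^'n" assume "x \<noteq> 0"
    then have "?U x = (c_const n p powr k * slope 1 (N x)) powr p"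
      using slope_nonneg by (simp add: H_grad_U)
    also have "\<dots> = ?c * ?f 1 (N x)"
      using slope_nonneg p1 by (simp add: powr_mult powr_powr k_def)
    finally show "?c * ?f 1 (N x) = ?U x" ..
  qed
  have cint: "integrable lborel (\<lambda>x. ?c * ?f 1 (N x))" using est(1) by (intro integrable_mult_right)
  have Uint: "integrable lborel ?U"
    by (rule integrable_cong_AE_imp[OF cint _ Ueq]) (use Um in simp)
  show "in_Lp p UNIV (\<lambda>x. H (grad (U_ext H p) x))"
    unfolding in_Lp_def set_integrable_lebesgue_iff[OF Um space_in_borel]
    using Uint by (simp add: set_integrable_def)
  have "Lp_norm p UNIV (\<lambda>x. H (grad (U_ext H p) x)) powr p = integral\<^sup>L lborel ?U"
    using p1 by (simp add: Lp_norm_powr set_lebesgue_integral_eq_lborel[OF Um]) (simp add: set_lebesgue_integral_def)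
  also have "\<dots> = (LINT x|lborel. ?c * ?f 1 (N x))"
    by (rule integral_cong_AE) (use Um Ueq[THEN AE_symmetric] in auto)
  finally have UU: "Lp_norm p UNIV (\<lambda>x. H (grad (U_ext H p) x)) powr p = ?c * (LINT x|lborel. ?f 1 (N x))"
    by simp
  \<comment> \<open>The dilation contributes the exponent \<open>n / q\<close> and the
    \<open>p\<close>-th power of the slope contributes \<open>- (n - 1)\<close>.\<close>
  have ex: "real DIM(real^'n) / q - (n - 1) = - ((n - p) / p)"
    unfolding dim using p1 by (simp add: q_def field_simps)
  have "\<forall>\<^sub>F \<epsilon> in at_right 0. Lp_norm p \<Omega> (\<lambda>x. H (grad (\<eta> \<epsilon>) x)) powr p
        - 1 / (?c * \<epsilon> powr ((n - p) / p)) * Lp_norm p UNIV (\<lambda>x. H (grad (U_ext H p) x)) powr p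
      = (LINT x:\<Omega>|lborel. ?F \<epsilon> x) - \<epsilon> powr (real DIM(real^'n) / q - (n - 1)) * (LINT x|lborel. ?f 1 (N x))"
    using eventually_at_right_less[of "0::real"]
  proof eventually_elim
    fix \<epsilon> :: real assume e: "0 < \<epsilon>"
    have "Lp_norm p \<Omega> (\<lambda>x. H (grad (\<eta> \<epsilon>) x)) powr p = (LINT x:\<Omega>|lborel. ?F \<epsilon> x)"
      using p1 by (simp add: Lp_norm_powr set_lebesgue_integral_eq_lborel[OF Fm[OF e]])
    then show "Lp_norm p \<Omega> (\<lambda>x. H (grad (\<eta> \<epsilon>) x)) powr p
        - 1 / (?c * \<epsilon> powr ((n - p) / p)) * Lp_norm p UNIV (\<lambda>x. H (grad (U_ext H p) x)) powr p
      = (LINT x:\<Omega>|lborel. ?F \<epsilon> x) - \<epsilon> powr (real DIM(real^'n) / q - (n - 1)) * (LINT x|lborel. ?f 1 (N x))"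
      unfolding UU ex using c_const_pos e by (simp add: powr_minus_divide)
  qed
  from landau_o.big.in_cong[OF this]
  show "(\<lambda>\<epsilon>. Lp_norm p \<Omega> (\<lambda>x. H (grad (\<eta> \<epsilon>) x)) powr p
        - 1 / (?c * \<epsilon> powr ((n - p) / p))
          * Lp_norm p UNIV (\<lambda>x. H (grad (U_ext H p) x)) powr p) \<in> O[at_right 0](\<lambda>_. 1)"
    using est(3) by simp
qed

text \<open>The assumption \<open>large\<close> says that the \<open>e\<close>-th power of the
  profile decays faster than \<open>N powr (- n)\<close>. It holds for the critical exponent, where
  \<open>k * e = n\<close>, and for \<open>e = p\<close> when \<open>n > p\<^sup>2\<close>.\<close>

lemma power_expansion:
  assumes e: "0 < e" and large: "n < q * (k * e)"
  shows "in_Lp e UNIV (U_ext H p)"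
    and "(\<lambda>\<epsilon>. (LINT x:\<Omega>|lebesgue. \<eta> \<epsilon> x powr e)
        - 1 / (c_const n p powr (k * e) * \<epsilon> powr (k * e - n / q))
          * Lp_norm e UNIV (U_ext H p) powr e) \<in> O[at_right 0](\<lambda>_. 1)"
proof -
  obtain \<rho> where \<rho>: "0 < \<rho>" "{x. N x \<le> \<rho>} \<subseteq> ball 0 r" by (rule inner_radius)
  let ?f = "\<lambda>\<epsilon> t. (\<epsilon> + t powr q) powr (- (k * e))"
  let ?F = "\<lambda>\<epsilon> x. \<eta> \<epsilon> x powr e"
  let ?K = "\<rho> powr (- (q * (k * e)))"
  have ke: "0 < k * e" using k_pos e by simp
  have w_e: "w \<epsilon> x powr e = ?f \<epsilon> (N x)" for \<epsilon> x by (simp add: w_def powr_powr)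
  have sub: "{x. N x \<le> \<rho>} \<subseteq> \<Omega>" using \<rho> ball_subset by blast
  have large': "real DIM(real^'n) < q * (k * e)" using large by (simp only: dim)
  have tail: "?f \<epsilon> t \<le> 1 * t powr (- (q * (k * e)))" if "0 < \<epsilon>" "0 < t" for \<epsilon> t
    using base_powr_le[OF that, of "k * e"] ke by simp
  have bound1: "?f 1 t \<le> 1" if "0 \<le> t" for t
  proof -
    have "?f 1 t \<le> 1 powr (- (k * e))" using ke by (intro powr_mono2') auto
    then show ?thesis by simp
  qed
  have scaling: "?f \<epsilon> (\<epsilon> powr (1 / q) * t) = \<epsilon> powr (- (k * e)) * ?f 1 t" if "0 < \<epsilon>" "0 \<le> t" for \<epsilon> t
    by (rule base_scaling[OF that])
  have Fin: "?F \<epsilon> x = ?f \<epsilon> (N x)" if "0 < \<epsilon>" "x \<noteq> 0" "N x \<le> \<rho>" for \<epsilon> x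
  proof -
    have "x \<in> ball 0 r" using \<rho> that by auto
    then show ?thesis by (simp add: eta_ball w_e)
  qed
  have Fout: "0 \<le> ?F \<epsilon> x \<and> ?F \<epsilon> x \<le> ?K" if "0 < \<epsilon>" "x \<in> \<Omega>" "\<rho> < N x" for \<epsilon> x
  proof -
    have "?F \<epsilon> x \<le> w \<epsilon> x powr e" using e eta_le_w eta_nonneg by (intro powr_mono2) auto
    also have "\<dots> \<le> N x powr (- (q * (k * e)))"
      unfolding w_e using that \<rho> ke by (intro base_powr_le) auto
    also have "\<dots> \<le> ?K" using that \<rho> q_pos ke by (intro powr_mono2') auto
    finally show ?thesis by simp
  qed
  have Fm: "?F \<epsilon> \<in> borel_measurable borel" for \<epsilon> by measurable
  have fm: "?f \<epsilon> \<in> borel_measurable borel" for \<epsilon> by measurable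
  note trunc = gauge.truncation_estimate[where f="?f" and F="?F" and B=1 and C=1 and K="?K" and q=q and b="k * e",
      OF large' \<rho>(1) zero_le_one powr_ge_zero borel_\<Omega> emeasure_\<Omega>_finite sub fm powr_ge_zero bound1 tail scaling Fm Fin Fout]
  have est: "integrable lborel (\<lambda>x. ?f 1 (N x))"
    "\<And>\<epsilon>. 0 < \<epsilon> \<Longrightarrow> set_integrable lborel \<Omega> (?F \<epsilon>)"
    "(\<lambda>\<epsilon>. (LINT x:\<Omega>|lborel. ?F \<epsilon> x)
        - \<epsilon> powr (real DIM(real^'n) / q - (k * e)) * (LINT x|lborel. ?f 1 (N x))) \<in> O[at_right 0](\<lambda>_. 1)"
    by ((rule trunc(1); assumption), (rule trunc(2); assumption), (rule trunc(3); assumption))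
  let ?c = "c_const n p powr (k * e)"
  let ?U = "\<lambda>x. \<bar>U_ext H p x\<bar> powr e"
  have Ueq: "?U = (\<lambda>x. ?c * ?f 1 (N x))"
  proof
    fix x
    have "?U x = (c_const n p powr k * w 1 x) powr e" using w_nonneg by (simp add: U_ext_eq)
    also have "\<dots> = ?c * ?f 1 (N x)" using w_nonneg by (simp add: powr_mult powr_powr w_e)
    finally show "?U x = ?c * ?f 1 (N x)" .
  qed
  have Um: "?U \<in> borel_measurable borel" unfolding Ueq by measurable
  have Uint: "integrable lborel ?U" unfolding Ueq using est(1) by (intro integrable_mult_right)
  show "in_Lp e UNIV (U_ext H p)"
    unfolding in_Lp_def set_integrable_lebesgue_iff[OF Um space_in_borel]
    using Uint by (simp add: set_integrable_def)
  have "Lp_norm e UNIV (U_ext H p) powr e = integral\<^sup>L lborel ?U"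
    using e by (simp add: Lp_norm_powr set_lebesgue_integral_eq_lborel[OF Um]) (simp add: set_lebesgue_integral_def)
  also have "\<dots> = ?c * (LINT x|lborel. ?f 1 (N x))" unfolding Ueq by simp
  finally have UU: "Lp_norm e UNIV (U_ext H p) powr e = ?c * (LINT x|lborel. ?f 1 (N x))" .
  have "\<forall>\<^sub>F \<epsilon> in at_right 0. (LINT x:\<Omega>|lebesgue. ?F \<epsilon> x)
        - 1 / (?c * \<epsilon> powr (k * e - n / q)) * Lp_norm e UNIV (U_ext H p) powr e
      = (LINT x:\<Omega>|lborel. ?F \<epsilon> x) - \<epsilon> powr (real DIM(real^'n) / q - k * e) * (LINT x|lborel. ?f 1 (N x))"
    using eventually_at_right_less[of "0::real"]
  proof eventually_elim
    fix \<epsilon> :: real assume "0 < \<epsilon>"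
    have "real DIM(real^'n) / q - k * e = - (k * e - n / q)" unfolding dim by simp
    then have "\<epsilon> powr (real DIM(real^'n) / q - k * e) = 1 / \<epsilon> powr (k * e - n / q)"
      by (simp only: powr_minus_divide)
    then show "(LINT x:\<Omega>|lebesgue. ?F \<epsilon> x)
        - 1 / (?c * \<epsilon> powr (k * e - n / q)) * Lp_norm e UNIV (U_ext H p) powr e
      = (LINT x:\<Omega>|lborel. ?F \<epsilon> x) - \<epsilon> powr (real DIM(real^'n) / q - k * e) * (LINT x|lborel. ?f 1 (N x))"
      unfolding UU set_lebesgue_integral_eq_lborel[OF Fm borel_\<Omega>] using c_const_pos by simp
  qed
  from landau_o.big.in_cong[OF this]
  show "(\<lambda>\<epsilon>. (LINT x:\<Omega>|lebesgue. \<eta> \<epsilon> x powr e)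
        - 1 / (?c * \<epsilon> powr (k * e - n / q)) * Lp_norm e UNIV (U_ext H p) powr e) \<in> O[at_right 0](\<lambda>_. 1)"
    using est(3) by simp
qed

text \<open>For fixed \<epsilon> the profile is bounded by \<open>\<epsilon> powr (- k)\<close> on a
  set of finite measure. This bound blows up as \<epsilon> tends to 0 and serves integrability
  only.\<close>

lemma eta_powr_integrable:
  assumes "0 < \<epsilon>" "0 < e" and [measurable]: "S \<in> sets borel" and S: "S \<subseteq> \<Omega>"
  shows "set_integrable lborel S (\<lambda>x. \<eta> \<epsilon> x powr e)"
  unfolding set_integrable_def
proof (rule Bochner_Integration.integrable_bound)
  show "integrable lborel (\<lambda>x. (\<epsilon> powr (- k)) powr e * indicator \<Omega> x :: real)"
    using emeasure_\<Omega>_finite by (intro integrable_mult_right integrable_real_indicator) auto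
  show "AE x in lborel. norm (indicator S x *\<^sub>R \<eta> \<epsilon> x powr e) \<le> norm ((\<epsilon> powr (- k)) powr e * indicator \<Omega> x)"
  proof (intro AE_I2)
    fix x
    have "w \<epsilon> x \<le> \<epsilon> powr (- k)"
      unfolding w_def using assms(1) k_pos by (intro powr_mono2') auto
    then have "\<eta> \<epsilon> x powr e \<le> (\<epsilon> powr (- k)) powr e"
      using eta_le_w[of \<epsilon> x] eta_nonneg assms(2) by (intro powr_mono2) auto
    then show "norm (indicator S x *\<^sub>R \<eta> \<epsilon> x powr e) \<le> norm ((\<epsilon> powr (- k)) powr e * indicator \<Omega> x)"
      using S by (auto simp: indicator_def)
  qed
  show "(\<lambda>x. indicator S x *\<^sub>R \<eta> \<epsilon> x powr e) \<in> borel_measurable lborel" by measurable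
qed

lemma eta_in_Lp:
  assumes "0 < \<epsilon>" "0 < e"
  shows "in_Lp e \<Omega> (\<eta> \<epsilon>)"
proof -
  have "(\<lambda>x. \<bar>\<eta> \<epsilon> x\<bar> powr e) = (\<lambda>x. \<eta> \<epsilon> x powr e)" using eta_nonneg by simp
  moreover have "(\<lambda>x. \<eta> \<epsilon> x powr e) \<in> borel_measurable borel" by measurable
  ultimately show ?thesis
    unfolding in_Lp_def using eta_powr_integrable[OF assms borel_\<Omega>] by (simp add: set_integrable_lebesgue_iff)
qed

text \<open>\<open>n = p\<^sup>2\<close> is the equality \<open>q * (k * p) = n\<close>, just
  outside the range of \<open>power_expansion\<close>. The main term now comes from the gauge ball
  by \<open>log_estimate\<close>, and the remaining part of \<open>\<Omega>\<close> contributes a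
  bounded amount.\<close>

lemma logarithmic_expansion:
  assumes np: "n = p\<^sup>2"
  shows "(\<lambda>\<epsilon>. (LINT x:\<Omega>|lebesgue. \<eta> \<epsilon> x powr p) - omega H * (p - 1) / p * \<bar>ln \<epsilon>\<bar>) \<in> O[at_right 0](\<lambda>_. 1)"
proof -
  obtain \<rho> where \<rho>: "0 < \<rho>" "{x. N x \<le> \<rho>} \<subseteq> ball 0 r" by (rule inner_radius)
  let ?D = "{x. N x \<le> \<rho>}" and ?F = "\<lambda>\<epsilon> x. \<eta> \<epsilon> x powr p"
  have D [measurable]: "?D \<in> sets borel" by measurable
  have sub: "?D \<subseteq> \<Omega>" using \<rho> ball_subset by blast
  let ?k = "k * p"
  have kp: "0 < ?k" using k_pos p1 by simp
  have "q * ?k = real DIM(real^'n)"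
  proof -
    have "p * (n - p) = n * (p - 1)" using np by (simp add: algebra_simps power2_eq_square)
    moreover have kp': "k * p = n - p" using p1 by (simp add: k_def)
    ultimately show ?thesis unfolding dim kp' q_def using p1 by (simp add: divide_eq_eq)
  qed
  from gauge.log_estimate[OF q_pos less_imp_le[OF kp] this \<rho>(1)]
  obtain C where C: "\<And>\<epsilon>. 0 < \<epsilon> \<Longrightarrow> \<epsilon> < 1 \<Longrightarrow> \<epsilon> < \<rho> powr q \<Longrightarrow>
    \<bar>(LINT x:?D|lborel. (\<epsilon> + N x powr q) powr (- ?k)) - real DIM(real^'n) * gauge.volume / q * \<bar>ln \<epsilon>\<bar>\<bar> \<le> C"
    by blast
  let ?K = "\<rho> powr (- (q * ?k))"
  define c1 where "c1 = (LINT x|lborel. ?K * indicator \<Omega> x)"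
  \<comment> \<open>The only place where the surface integral meets the expansions;
    \<open>1 / q = (p - 1) / p\<close> supplies the remaining factor.\<close>
  have om: "real DIM(real^'n) * gauge.volume / q = omega H * (p - 1) / p"
    by (simp only: dim omega_eq q_def) simp
  have bound: "\<bar>(LINT x:\<Omega>|lebesgue. ?F \<epsilon> x) - omega H * (p - 1) / p * \<bar>ln \<epsilon>\<bar>\<bar> \<le> C + c1"
    if \<epsilon>: "0 < \<epsilon>" "\<epsilon> < 1" "\<epsilon> < \<rho> powr q" for \<epsilon>
  proof -
    have Fm: "?F \<epsilon> \<in> borel_measurable borel" by measurable
    have int: "set_integrable lborel S (?F \<epsilon>)" if "S \<in> sets borel" "S \<subseteq> \<Omega>" for S
      using \<epsilon> p1 that by (intro eta_powr_integrable) auto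
    have un: "\<Omega> = ?D \<union> (\<Omega> - ?D)" using sub by auto
    have "(LINT x:\<Omega>|lebesgue. ?F \<epsilon> x) = (LINT x:?D \<union> (\<Omega> - ?D)|lborel. ?F \<epsilon> x)"
      by (simp only: set_lebesgue_integral_eq_lborel[OF Fm borel_\<Omega>] un[symmetric])
    also have "\<dots> = (LINT x:?D|lborel. ?F \<epsilon> x) + (LINT x:\<Omega> - ?D|lborel. ?F \<epsilon> x)"
      using sub by (intro set_integral_Un int) auto
    also have "(LINT x:?D|lborel. ?F \<epsilon> x) = (LINT x:?D|lborel. (\<epsilon> + N x powr q) powr (- ?k))"
    proof (rule set_lebesgue_integral_cong)
      show "\<forall>x. x \<in> ?D \<longrightarrow> ?F \<epsilon> x = (\<epsilon> + N x powr q) powr (- ?k)"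
        using \<rho>(2) by (auto simp: eta_ball w_def powr_powr subset_iff)
    qed simp
    finally have split: "(LINT x:\<Omega>|lebesgue. ?F \<epsilon> x) =
      (LINT x:?D|lborel. (\<epsilon> + N x powr q) powr (- ?k)) + (LINT x:\<Omega> - ?D|lborel. ?F \<epsilon> x)" .
    have "0 \<le> (LINT x:\<Omega> - ?D|lborel. ?F \<epsilon> x)"
      unfolding set_lebesgue_integral_def by (rule Bochner_Integration.integral_nonneg) (auto simp: indicator_def)
    moreover have "(LINT x:\<Omega> - ?D|lborel. ?F \<epsilon> x) \<le> c1"
      unfolding set_lebesgue_integral_def c1_def
    proof (rule integral_mono)
      show "integrable lborel (\<lambda>x. indicator (\<Omega> - ?D) x *\<^sub>R ?F \<epsilon> x)"
        using int[of "\<Omega> - ?D"] by (simp add: set_integrable_def)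
      show "integrable lborel (\<lambda>x. ?K * indicator \<Omega> x :: real)"
        using emeasure_\<Omega>_finite by (intro integrable_mult_right integrable_real_indicator) auto
      fix x
      have "?F \<epsilon> x \<le> ?K" if "\<rho> < N x"
      proof -
        have "?F \<epsilon> x \<le> w \<epsilon> x powr p" using p1 eta_le_w eta_nonneg by (intro powr_mono2) auto
        also have "\<dots> = (\<epsilon> + N x powr q) powr (- ?k)" by (simp add: w_def powr_powr)
        also have "\<dots> \<le> N x powr (- (q * ?k))"
          using that \<rho> kp \<epsilon> by (intro base_powr_le) auto
        also have "\<dots> \<le> ?K" using that \<rho> q_pos kp by (intro powr_mono2') auto
        finally show ?thesis .
      qed
      then show "indicator (\<Omega> - ?D) x *\<^sub>R ?F \<epsilon> x \<le> ?K * indicator \<Omega> x"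
        by (auto simp: indicator_def)
    qed
    ultimately show ?thesis using C[OF \<epsilon>] unfolding split om by linarith
  qed
  show ?thesis
  proof (rule bigoI[of _ "C + c1"])
    have "\<forall>\<^sub>F \<epsilon> in at_right (0::real). 0 < \<epsilon>" "\<forall>\<^sub>F \<epsilon> in at_right (0::real). \<epsilon> < 1"
      "\<forall>\<^sub>F \<epsilon> in at_right (0::real). \<epsilon> < \<rho> powr q"
      using \<rho>(1) by (auto intro: eventually_at_right_less order_tendstoD(2)[OF tendsto_ident_at])
    then show "\<forall>\<^sub>F \<epsilon> in at_right 0. norm ((LINT x:\<Omega>|lebesgue. \<eta> \<epsilon> x powr p) - omega H * (p - 1) / p * \<bar>ln \<epsilon>\<bar>) \<le> (C + c1) * norm (1::real)"
      by eventually_elim (use bound in simp)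
  qed
qed

text \<open>Only the gauge ball \<open>N x \<le> \<epsilon> powr (1 / q)\<close> is kept. There the
  base is at most \<open>2 * \<epsilon>\<close>, and for \<open>\<epsilon> < \<rho> powr q\<close>
  the cut-off equals 1. Since \<open>k * e \<le> k * crit_exp n p = n\<close>, the factor
  \<open>2 powr (- (k * e))\<close> may be replaced by \<open>2 powr (- n)\<close>, which makes the
  constant independent of the exponent.\<close>

lemma lower_bound:
  assumes e: "p < e" "e < crit_exp n p - 1"
  shows "\<forall>\<^sub>F \<epsilon> in at_right 0. (LINT x:\<Omega>|lebesgue. \<eta> \<epsilon> x powr e)
    \<ge> (2 powr (- n) * gauge.volume) / \<epsilon> powr (e * (n - p) / p - n * (p - 1) / p)"
proof -
  obtain \<rho> where \<rho>: "0 < \<rho>" "{x. N x \<le> \<rho>} \<subseteq> ball 0 r" by (rule inner_radius)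
  have e0: "0 < e" using e p1 by simp
  have ke: "0 \<le> k * e" "k * e \<le> n"
  proof -
    have "k * e \<le> k * crit_exp n p" using e k_pos by (intro mult_left_mono) auto
    also have "\<dots> = n" using p1 pn by (simp add: k_def crit_exp_def)
    finally show "k * e \<le> n" .
  qed (use k_pos e0 in simp)
  have main: "(LINT x:\<Omega>|lebesgue. \<eta> \<epsilon> x powr e)
    \<ge> (2 powr (- n) * gauge.volume) / \<epsilon> powr (e * (n - p) / p - n * (p - 1) / p)"
    if \<epsilon>: "0 < \<epsilon>" "\<epsilon> < \<rho> powr q" for \<epsilon>
  proof -
    define s where "s = \<epsilon> powr (1 / q)"
    have s0: "0 < s" using \<epsilon> by (simp add: s_def)
    have sq: "s powr q = \<epsilon>" using \<epsilon> q_pos by (simp add: s_def powr_powr)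
    have s\<rho>: "s \<le> \<rho>"
    proof (rule ccontr)
      assume "\<not> s \<le> \<rho>"
      then have "\<rho> powr q \<le> s powr q" using \<rho> q_pos by (intro powr_mono2) auto
      then show False using sq \<epsilon> by simp
    qed
    let ?B = "{x. N x \<le> s}"
    have B [measurable]: "?B \<in> sets borel" by measurable
    have Bsub: "?B \<subseteq> ball 0 r" using s\<rho> \<rho> by auto
    have Bfin: "emeasure lborel ?B < \<infinity>" by (rule gauge.emeasure_gauge_ball_finite)
    have Fm: "(\<lambda>x. \<eta> \<epsilon> x powr e) \<in> borel_measurable borel" by measurable
    let ?v = "2 powr (- n) * \<epsilon> powr (- (k * e))"
    have "measure lborel ?B = s ^ DIM(real^'n) * gauge.volume"
      using gauge.emeasure_gauge_ball[of s] s0 gauge.volume_nonneg by (simp add: measure_def)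
    also have "s ^ DIM(real^'n) = \<epsilon> powr (n / q)"
      using s0 \<epsilon> by (simp only: powr_realpow[symmetric] dim) (simp add: s_def powr_powr)
    finally have mB: "measure lborel ?B = \<epsilon> powr (n / q) * gauge.volume" .
    have "?v * measure lborel ?B = (LINT x|lborel. ?v * indicator ?B x)" by simp
    also have "\<dots> \<le> (LINT x|lborel. indicator \<Omega> x *\<^sub>R \<eta> \<epsilon> x powr e)"
    proof (rule integral_mono)
      show "integrable lborel (\<lambda>x. ?v * indicator ?B x :: real)"
        using Bfin by (intro integrable_mult_right integrable_real_indicator) auto
      show "integrable lborel (\<lambda>x. indicator \<Omega> x *\<^sub>R \<eta> \<epsilon> x powr e)"
        using eta_powr_integrable[OF \<epsilon>(1) e0 borel_\<Omega>] by (simp add: set_integrable_def)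
      fix x
      show "?v * indicator ?B x \<le> indicator \<Omega> x *\<^sub>R \<eta> \<epsilon> x powr e"
      proof (cases "x \<in> ?B")
        case True
        then have x: "x \<in> ball 0 r" "x \<in> \<Omega>" using Bsub ball_subset by auto
        have "N x powr q \<le> s powr q" using True gauge.nonneg q_pos by (intro powr_mono2) auto
        then have le: "\<epsilon> + N x powr q \<le> 2 * \<epsilon>" by (simp add: sq)
        have "2 powr (- n) \<le> 2 powr (- (k * e))" using ke by (intro powr_mono) auto
        then have "?v \<le> 2 powr (- (k * e)) * \<epsilon> powr (- (k * e))" by (intro mult_right_mono) auto
        also have "\<dots> = (2 * \<epsilon>) powr (- (k * e))" using \<epsilon> by (simp add: powr_mult)
        also have "\<dots> \<le> (\<epsilon> + N x powr q) powr (- (k * e))"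
          using le ke \<epsilon> by (intro powr_mono2') (auto simp: add_pos_nonneg)
        also have "\<dots> = \<eta> \<epsilon> x powr e" using x by (simp add: eta_ball w_def powr_powr)
        finally show ?thesis using True x by simp
      qed (simp add: indicator_def)
    qed
    also have "\<dots> = (LINT x:\<Omega>|lebesgue. \<eta> \<epsilon> x powr e)"
      by (subst set_lebesgue_integral_eq_lborel[OF Fm borel_\<Omega>]) (simp add: set_lebesgue_integral_def)
    finally have "?v * (\<epsilon> powr (n / q) * gauge.volume) \<le> (LINT x:\<Omega>|lebesgue. \<eta> \<epsilon> x powr e)"
      unfolding mB .
    moreover have "?v * (\<epsilon> powr (n / q) * gauge.volume) = (2 powr (- n) * gauge.volume) / \<epsilon> powr (e * (n - p) / p - n * (p - 1) / p)"
    proof -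
      have "\<epsilon> powr (- (k * e)) * \<epsilon> powr (n / q) = \<epsilon> powr (- (e * (n - p) / p - n * (p - 1) / p))"
        using p1 by (simp add: powr_add[symmetric] k_def q_def mult.commute)
      also have "\<dots> = 1 / \<epsilon> powr (e * (n - p) / p - n * (p - 1) / p)" by (rule powr_minus_divide)
      finally have "2 powr (- n) * gauge.volume * (\<epsilon> powr (- (k * e)) * \<epsilon> powr (n / q))
          = 2 powr (- n) * gauge.volume * (1 / \<epsilon> powr (e * (n - p) / p - n * (p - 1) / p))" by (simp only:)
      then show ?thesis by (simp only: mult_ac times_divide_eq_right mult_1_right)
    qed
    ultimately show ?thesis by simp
  qed
  have "\<forall>\<^sub>F \<epsilon> in at_right (0::real). 0 < \<epsilon>" "\<forall>\<^sub>F \<epsilon> in at_right (0::real). \<epsilon> < \<rho> powr q"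
    using \<rho>(1) by (auto intro: eventually_at_right_less order_tendstoD(2)[OF tendsto_ident_at])
  then show ?thesis by eventually_elim (use main in simp)
qed

end

theorem lemma2p5:
  fixes H :: "real^'n \<Rightarrow> real" and p n :: real
  assumes n_def: "n = real CARD('n)"
    and H: "anisotropic_norm H"
    and p: "1 < p" "p < n"
  shows "\<exists>c>0. \<forall>(\<Omega> :: (real^'n) set) \<phi> r.
    open \<Omega> \<and> connected \<Omega> \<and> bounded \<Omega> \<and> smooth_boundary \<Omega> \<and> 0 \<in> \<Omega> \<and>
    test_function \<Omega> \<phi> \<and> (\<forall>x. 0 \<le> \<phi> x \<and> \<phi> x \<le> 1) \<and>
    0 < r \<and> closure (ball 0 r) \<subseteq> \<Omega> \<and> (\<forall>x\<in>ball 0 r. \<phi> x = 1) \<longrightarrow>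
    ((\<forall>\<epsilon>>0. in_Lp p \<Omega> (\<lambda>x. H (grad (eta H p \<phi> \<epsilon>) x))) \<and>
     in_Lp p UNIV (\<lambda>x. H (grad (U_ext H p) x)) \<and>
     (\<lambda>\<epsilon>. Lp_norm p \<Omega> (\<lambda>x. H (grad (eta H p \<phi> \<epsilon>) x)) powr p
        - 1 / (c_const n p powr (n - p) * \<epsilon> powr ((n - p) / p))
          * Lp_norm p UNIV (\<lambda>x. H (grad (U_ext H p) x)) powr p)
       \<in> O[at_right 0](\<lambda>_. 1)) \<and>
    ((\<forall>\<epsilon>>0. in_Lp (crit_exp n p) \<Omega> (eta H p \<phi> \<epsilon>)) \<and>
     in_Lp (crit_exp n p) UNIV (U_ext H p) \<and>
     (\<lambda>\<epsilon>. (LINT x:\<Omega>|lebesgue. eta H p \<phi> \<epsilon> x powr crit_exp n p)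
        - 1 / (c_const n p powr n * \<epsilon> powr (n / p))
          * Lp_norm (crit_exp n p) UNIV (U_ext H p) powr crit_exp n p)
       \<in> O[at_right 0](\<lambda>_. 1)) \<and>
    (\<forall>\<epsilon>>0. in_Lp p \<Omega> (eta H p \<phi> \<epsilon>)) \<and>
    (n > p\<^sup>2 \<longrightarrow>
     in_Lp p UNIV (U_ext H p) \<and>
     (\<lambda>\<epsilon>. (LINT x:\<Omega>|lebesgue. eta H p \<phi> \<epsilon> x powr p)
        - 1 / (c_const n p powr (n - p) * \<epsilon> powr ((n - p\<^sup>2) / p))
          * Lp_norm p UNIV (U_ext H p) powr p)
       \<in> O[at_right 0](\<lambda>_. 1)) \<and>
    (n = p\<^sup>2 \<longrightarrow>
     (\<lambda>\<epsilon>. (LINT x:\<Omega>|lebesgue. eta H p \<phi> \<epsilon> x powr p)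
        - omega H * (p - 1) / p * \<bar>ln \<epsilon>\<bar>)
       \<in> O[at_right 0](\<lambda>_. 1)) \<and>
    (\<forall>q. p < q \<and> q < crit_exp n p - 1 \<longrightarrow>
     (\<forall>\<^sub>F \<epsilon> in at_right 0.
        (LINT x:\<Omega>|lebesgue. eta H p \<phi> \<epsilon> x powr q)
          \<ge> c / \<epsilon> powr (q * (n - p) / p - n * (p - 1) / p)))"
proof -
  interpret bubble H p n
    by unfold_locales (use H n_def p in auto)
  have crit: "0 < crit_exp n p" "k * crit_exp n p = n" "n < q * (k * crit_exp n p)" "k * crit_exp n p - n / q = n / p"
  proof -
    show "0 < crit_exp n p" using p by (simp add: crit_exp_def)
    show k: "k * crit_exp n p = n" using p by (simp add: crit_exp_def k_def)
    show "n < q * (k * crit_exp n p)" unfolding k using q_gt_1 n_pos by simp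
    show "k * crit_exp n p - n / q = n / p" unfolding k using p by (simp add: q_def field_simps)
  qed
  have kp: "k * p = n - p" "k * p - n / q = (n - p\<^sup>2) / p"
    using p by (simp_all add: k_def q_def field_simps power2_eq_square)
  \<comment> \<open>After multiplication by \<open>p - 1\<close> the inequality reads
    \<open>n * (p - 1) < p * (n - p)\<close>, that is \<open>p\<^sup>2 < n\<close>.\<close>
  have large: "n < q * (k * p)" if "p\<^sup>2 < n"
  proof -
    have "n * (p - 1) < p * (n - p)" using that by (simp add: algebra_simps power2_eq_square)
    then show ?thesis unfolding kp using p by (simp add: q_def pos_less_divide_eq)
  qed
  show ?thesis
  \<comment> \<open>The witness is fixed before the domain, the cut-off, the radius and the
    exponent: it involves only \<open>n\<close> and the volume of the unit ball of
    \<open>N\<close>.\<close>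
  proof (intro exI[of _ "2 powr (- n) * gauge.volume"] conjI allI impI)
    show "0 < 2 powr (- n) * gauge.volume" using volume_pos by simp
  next
    fix \<Omega> :: "(real^'n) set" and \<phi> r
    assume *: "open \<Omega> \<and> connected \<Omega> \<and> bounded \<Omega> \<and> smooth_boundary \<Omega> \<and> 0 \<in> \<Omega> \<and>
      test_function \<Omega> \<phi> \<and> (\<forall>x. 0 \<le> \<phi> x \<and> \<phi> x \<le> 1) \<and>
      0 < r \<and> closure (ball 0 r) \<subseteq> \<Omega> \<and> (\<forall>x\<in>ball 0 r. \<phi> x = 1)"
    interpret cutoff H p n \<Omega> \<phi> r
      by unfold_locales (use * in auto)
    note crit_exp = power_expansion[OF crit(1,3)]
    note p_exp = power_expansion[OF order_less_trans[OF zero_less_one p(1)] large]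
    show "in_Lp p \<Omega> (\<lambda>x. H (grad (eta H p \<phi> \<epsilon>) x))" if "0 < \<epsilon>" for \<epsilon>
      by (rule gradient_expansion(1)[OF that])
    show "in_Lp p UNIV (\<lambda>x. H (grad (U_ext H p) x))" by (rule gradient_expansion(2))
    show "(\<lambda>\<epsilon>. Lp_norm p \<Omega> (\<lambda>x. H (grad (eta H p \<phi> \<epsilon>) x)) powr p
        - 1 / (c_const n p powr (n - p) * \<epsilon> powr ((n - p) / p))
          * Lp_norm p UNIV (\<lambda>x. H (grad (U_ext H p) x)) powr p) \<in> O[at_right 0](\<lambda>_. 1)"
      by (rule gradient_expansion(3))
    show "in_Lp (crit_exp n p) \<Omega> (eta H p \<phi> \<epsilon>)" if "0 < \<epsilon>" for \<epsilon>
      by (rule eta_in_Lp[OF that crit(1)])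
    show "in_Lp (crit_exp n p) UNIV (U_ext H p)" by (rule crit_exp(1))
    show "(\<lambda>\<epsilon>. (LINT x:\<Omega>|lebesgue. eta H p \<phi> \<epsilon> x powr crit_exp n p)
        - 1 / (c_const n p powr n * \<epsilon> powr (n / p))
          * Lp_norm (crit_exp n p) UNIV (U_ext H p) powr crit_exp n p) \<in> O[at_right 0](\<lambda>_. 1)"
      using crit_exp(2) unfolding crit(4) unfolding crit(2) .
    show "in_Lp p \<Omega> (eta H p \<phi> \<epsilon>)" if "0 < \<epsilon>" for \<epsilon>
      using eta_in_Lp[OF that] p by simp
    show "in_Lp p UNIV (U_ext H p)" if "p\<^sup>2 < n"
      by (rule p_exp(1)[OF that])
    show "(\<lambda>\<epsilon>. (LINT x:\<Omega>|lebesgue. eta H p \<phi> \<epsilon> x powr p)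
        - 1 / (c_const n p powr (n - p) * \<epsilon> powr ((n - p\<^sup>2) / p))
          * Lp_norm p UNIV (U_ext H p) powr p) \<in> O[at_right 0](\<lambda>_. 1)" if "p\<^sup>2 < n"
      using p_exp(2)[OF that] unfolding kp(2) unfolding kp(1) .
    show "(\<lambda>\<epsilon>. (LINT x:\<Omega>|lebesgue. eta H p \<phi> \<epsilon> x powr p) - omega H * (p - 1) / p * \<bar>ln \<epsilon>\<bar>)
       \<in> O[at_right 0](\<lambda>_. 1)" if "n = p\<^sup>2"
      by (rule logarithmic_expansion[OF that])
    \<comment> \<open>Here \<open>q\<close> is the exponent of the last claim and hides the
      conjugate exponent \<open>p / (p - 1)\<close> of the same name.\<close>
    show "\<forall>\<^sub>F \<epsilon> in at_right 0. (LINT x:\<Omega>|lebesgue. eta H p \<phi> \<epsilon> x powr q)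
          \<ge> (2 powr (- n) * gauge.volume) / \<epsilon> powr (q * (n - p) / p - n * (p - 1) / p)"
      if "p < q \<and> q < crit_exp n p - 1" for q
      using that by (intro lower_bound) auto
  qed
qed

end
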